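(* Let $N\ge 1$ be an integer, $\alpha\in(0,N)$, $p,q>0$, and let $m>s>1$ be such that $m>s\ge N$. Let $g:[0,\infty)\to(0,\infty)$ be a non-increasing function of class $C^1(0,\infty)\cap C[0,\infty)$ such that $\lim_{t\to 0^+}\frac{t g'(t)}{g(t)}=0$ and $\frac{t g'(t)}{g(t)}+m-1\ge 0$ for all $t>0$. Then the inequality $$ \mathcal L_g u-\Delta_s u\ \ge\ (|x|^{-\alpha}*u^p)\,u^q\qquad\text{in }\mathbb R^N\setminus\overline B_1 $$ has no positive solutions.
   Context: $B_R$ is the open ball of radius $R$ centred at the origin in $\mathbb R^N$. $\Delta_s u=\operatorname{div}(|\nabla u|^{s-2}\nabla u)$ and $\mathcal L_g u=-\operatorname{div}\big(|\nabla u|^{m-2}g(|\nabla u|)\nabla u\big)$. The convolution is taken over $\mathbb R^N\setminus B_1$: $(|x|^{-\alpha}*u^p)(x)=\int_{\mathbb R^N\setminus B_1}\frac{u^p(y)}{|x-y|^{\alpha}}\,dy$ for $x\in\mathbb R^N\setminus\overline B_1$. A positive solution of the inequality is a function $u\in C(\mathbb R^N\setminus\overline B_1)\cap W^{1,m}_{loc}(\mathbb R^N\setminus\overline B_1)$ with $u>0$, with $\int_{\mathbb R^N\setminus B_1}\frac{u^p(y)}{1+|y|^\alpha}\,dy<\infty$, and such that for every $\phi\in C_c^\infty(\mathbb R^N\setminus\overline B_1)$, $\phi\ge0$, $$ \int_{\mathbb R^N\setminus B_1}\Big(|\nabla u|^{m-2}g(|\nabla u|)+|\nabla u|^{s-2}\Big)\nabla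 u\cdot\nabla\phi\,dx\ \ge\ \int_{\mathbb R^N\setminus B_1}(|x|^{-\alpha}*u^p)u^q\phi\,dx . $$ *)

theory Defs
  imports "HOL-Analysis.Analysis"
begin

fun Ck :: "nat \<Rightarrow> ('a::euclidean_space \<Rightarrow> real) \<Rightarrow> bool" where
  "Ck 0 f \<longleftrightarrow> continuous_on UNIV f"
| "Ck (Suc k) f \<longleftrightarrow> (\<forall>x. f differentiable (at x)) \<and>
     (\<forall>b\<in>Basis. Ck k (\<lambda>x. frechet_derivative f (at x) b))"

text \<open>Elements of \<open>C\<^sub>c\<^sup>\<infinity>(\<Omega>)\<close>, extended by zero to the whole space.\<close>

definition test_function :: "'a::euclidean_space set \<Rightarrow> ('a \<Rightarrow> real) \<Rightarrow> bool" where
  "test_function \<Omega> \<phi> \<longleftrightarrow> (\<forall>k. Ck k \<phi>) \<and>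
     compact (closure {x. \<phi> x \<noteq> 0}) \<and> closure {x. \<phi> x \<noteq> 0} \<subseteq> \<Omega>"

definition grad :: "('a::euclidean_space \<Rightarrow> real) \<Rightarrow> 'a \<Rightarrow> 'a" where
  "grad \<phi> x = (\<Sum>b\<in>Basis. frechet_derivative \<phi> (at x) b *\<^sub>R b)"

definition Lp_loc :: "'a::euclidean_space set \<Rightarrow> real \<Rightarrow> ('a \<Rightarrow> 'b::euclidean_space) \<Rightarrow> bool" where
  "Lp_loc \<Omega> r f \<longleftrightarrow> (\<forall>K. compact K \<and> K \<subseteq> \<Omega> \<longrightarrow>
     set_borel_measurable lebesgue K f \<and>
     set_integrable lebesgue K (\<lambda>x. norm (f x) powr r))"

definition has_weak_gradient :: "'a::euclidean_space set \<Rightarrow> ('a \<Rightarrow> real) \<Rightarrow> ('a \<Rightarrow> 'a) \<Rightarrow> bool" where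
  "has_weak_gradient \<Omega> u Du \<longleftrightarrow> Lp_loc \<Omega> 1 u \<and> Lp_loc \<Omega> 1 Du \<and>
     (\<forall>\<phi>. test_function \<Omega> \<phi> \<longrightarrow>
        (LINT x:\<Omega>|lebesgue. u x *\<^sub>R grad \<phi> x) = - (LINT x:\<Omega>|lebesgue. \<phi> x *\<^sub>R Du x))"

definition W1_loc :: "'a::euclidean_space set \<Rightarrow> real \<Rightarrow> ('a \<Rightarrow> real) \<Rightarrow> bool" where
  "W1_loc \<Omega> r u \<longleftrightarrow> Lp_loc \<Omega> r u \<and> (\<exists>Du. has_weak_gradient \<Omega> u Du \<and> Lp_loc \<Omega> r Du)"

text \<open>The field in the divergence form of the operator: the differential inequality has left-hand
  side \<open>- div (flux g m s (\<nabla>u))\<close>. Since \<^term>\<open>0 powr a = (0::real)\<close> and the scalar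
  multiplies \<open>v\<close>, the flux vanishes at \<open>v = 0\<close> also for exponents \<open>s < 2\<close> or \<open>m < 2\<close>.\<close>

definition flux :: "(real \<Rightarrow> real) \<Rightarrow> real \<Rightarrow> real \<Rightarrow> 'a::euclidean_space \<Rightarrow> 'a" where
  "flux g m s v = (norm v powr (m - 2) * g (norm v) + norm v powr (s - 2)) *\<^sub>R v"

definition riesz_conv :: "real \<Rightarrow> real \<Rightarrow> ('a::euclidean_space \<Rightarrow> real) \<Rightarrow> 'a \<Rightarrow> real" where
  "riesz_conv \<alpha> p u x =
     (LINT y:(- ball 0 1)|lebesgue. u y powr p / norm (x - y) powr \<alpha>)"

text \<open>A solution is a function on the open exterior domain; its values on the closed unit ball are
  irrelevant, since the unit sphere, which belongs to \<^term>\<open>- ball 0 1\<close>, is a Lebesgue null set.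
  The weak gradient is unique up to null sets, so quantifying over it existentially
  makes no choice. Under the other clauses (and for \<open>0 < \<alpha> < N\<close>, \<open>g\<close> bounded, \<open>1 < s < m\<close>) all
  integrals in the last clause converge absolutely: the convolution is locally bounded in the
  exterior domain and the flux of \<open>\<nabla>u\<close> is locally integrable. So the convention that a divergent
  Bochner integral is \<open>0\<close> plays no role; for the nonnegative integrand
  \<open>u\<^sup>p / (1 + |y|\<^sup>\<alpha>)\<close>, \<^const>\<open>set_integrable\<close> says that the integral is finite.\<close>

definition positive_solution ::
  "(real \<Rightarrow> real) \<Rightarrow> real \<Rightarrow> real \<Rightarrow> real \<Rightarrow> real \<Rightarrow> real \<Rightarrow> ('a::euclidean_space \<Rightarrow> real) \<Rightarrow> bool" where
  "positive_solution g m s \<alpha> p q u \<longleftrightarrow>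
     continuous_on (- cball 0 1) u \<and>
     W1_loc (- cball 0 1) m u \<and>
     (\<forall>x \<in> - cball 0 1. u x > 0) \<and>
     set_integrable lebesgue (- ball 0 1) (\<lambda>y. u y powr p / (1 + norm y powr \<alpha>)) \<and>
     (\<exists>Du. has_weak_gradient (- cball 0 1) u Du \<and>
        (\<forall>\<phi>. test_function (- cball 0 1) \<phi> \<and> (\<forall>x. \<phi> x \<ge> 0) \<longrightarrow>
           (LINT x:(- ball 0 1)|lebesgue. flux g m s (Du x) \<bullet> grad \<phi> x)
             \<ge> (LINT x:(- ball 0 1)|lebesgue. riesz_conv \<alpha> p u x * u x powr q * \<phi> x)))"

end

theory Submission
  imports Defs
begin

text \<open>
  The right-hand side of the inequality is nonnegative, so a positive solution is a supersolution of
  the operator alone. As \<open>s \<ge> N\<close>, the exterior domain is parabolic: let \<open>M\<close> be the minimum of \<open>u\<close> on the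
  sphere of radius \<open>2\<close> and test with \<open>\<phi> = F(u) \<zeta>\<close>, where \<open>F\<close> is smooth, decreasing on \<open>(0, M/2)\<close> and zero
  beyond, and \<open>\<zeta>\<close> is a logarithmic cutoff. By Young's inequality the energy of \<open>u\<close> on \<open>{u < M/2}\<close> is
  controlled by the \<open>s\<close>- and \<open>m\<close>-capacities of the cutoff, which tend to zero. Hence the gradient
  vanishes on \<open>{u < M/2}\<close>, so \<open>u\<close> is bounded below by \<open>M/4\<close> outside the ball of radius \<open>2\<close>, and then
  \<open>\<alpha> < N\<close> contradicts the integrability of \<open>u\<^sup>p / (1 + |y|\<^sup>\<alpha>)\<close>.

  The test functions have to be smooth, so \<open>F(u) \<zeta>\<close> is only reached as a limit of \<open>F(w\<^sub>n) \<zeta>\<close> with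
  mollifications \<open>w\<^sub>n\<close> of \<open>min u M\<close> (set to \<open>M\<close> on the ball of radius \<open>2\<close>). No chain rule for the
  truncation is needed, because \<open>F'(w\<^sub>n)\<close> vanishes unless \<open>w\<^sub>n\<close> only sees values where \<open>min u M = u\<close>.
\<close>

section \<open>Calculus of the classes \<open>C\<^sup>k\<close> and flat functions\<close>

text \<open>F and \<zeta> are shaped by one estimate. With A the flux, F |A| |grad \<zeta>| must be
  absorbed into |F'| \<zeta> (A . grad u); Young's inequality is applied to |A| \<kappa> with
  \<kappa> = (F / |F'|) (|grad \<zeta>| / \<zeta>), so only these two ratios matter. The function
  \<open>flat\<close>, exp (-1/t) for t > 0, satisfies flat' = flat / t^2: for F(t) = flat (M/2 - t)
  the first ratio is bounded, and for \<zeta> = flat \<tau> the second is |grad \<tau>| / \<tau>^2,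
  whose powers in 1/\<tau> are killed by the factor flat \<tau>. With \<tau> logarithmic in |x|
  there remains, for r = s and r = m, a multiple of (log R)^(-r) |x|^(-r). Since r \<ge> N, the
  dyadic shells contribute equally bounded amounts; there are about log R of them, so the total is
  of order (log R)^(1-r), which tends to 0.

  In the approximation the nonlinear flux is always taken at the true gradient; only grad \<phi>
  contains mollified quantities. The limit is thus linear in what is approximated, and no
  convergence of fluxes is needed.\<close>

lemma grad_eqI:
  assumes "(\<phi> has_derivative (\<lambda>h. w \<bullet> h)) (at x)"
  shows "grad \<phi> x = w"
proof -
  have "frechet_derivative \<phi> (at x) = (\<lambda>h. w \<bullet> h)"
    using frechet_derivative_at[OF assms] by simp
  then show ?thesis
    by (simp add: grad_def euclidean_representation)
qed

lemma has_derivative_grad: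
  assumes "\<phi> differentiable (at x)"
  shows "(\<phi> has_derivative (\<lambda>h. grad \<phi> x \<bullet> h)) (at x)"
proof -
  have d: "(\<phi> has_derivative frechet_derivative \<phi> (at x)) (at x)"
    using assms frechet_derivative_works by blast
  then interpret L: bounded_linear "frechet_derivative \<phi> (at x)"
    by (rule has_derivative_bounded_linear)
  have "frechet_derivative \<phi> (at x) h = grad \<phi> x \<bullet> h" for h
  proof -
    have "frechet_derivative \<phi> (at x) h = frechet_derivative \<phi> (at x) (\<Sum>b\<in>Basis. (h \<bullet> b) *\<^sub>R b)"
      by (simp add: euclidean_representation)
    also have "\<dots> = (\<Sum>b\<in>Basis. (h \<bullet> b) * frechet_derivative \<phi> (at x) b)"
      by (simp add: L.sum L.scaleR)
    also have "\<dots> = grad \<phi> x \<bullet> h"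
      by (simp add: grad_def inner_sum_left inner_sum_right inner_commute mult.commute)
    finally show ?thesis .
  qed
  then have "frechet_derivative \<phi> (at x) = (\<lambda>h. grad \<phi> x \<bullet> h)" by auto
  with d show ?thesis by simp
qed

lemma frechet_derivative_eqI:
  assumes "(f has_derivative f') (at x)"
  shows "frechet_derivative f (at x) b = f' b"
  using frechet_derivative_at[OF assms] by simp

lemma Ck_SucI:
  assumes "\<And>x. (f has_derivative f' x) (at x)" and "\<And>b. b \<in> Basis \<Longrightarrow> Ck k (\<lambda>x. f' x b)"
  shows "Ck (Suc k) f"
proof -
  have "(\<lambda>x. frechet_derivative f (at x) b) = (\<lambda>x. f' x b)" for b
    using frechet_derivative_eqI[OF assms(1)] by auto
  then show ?thesis using assms by (auto simp: differentiable_def)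
qed

lemma Ck_SucD:
  assumes "Ck (Suc k) f"
  shows "\<And>x. (f has_derivative frechet_derivative f (at x)) (at x)"
    and "\<And>b. b \<in> Basis \<Longrightarrow> Ck k (\<lambda>x. frechet_derivative f (at x) b)"
  using assms frechet_derivative_works by auto

lemma Ck_pred: "Ck (Suc k) f \<Longrightarrow> Ck k f"
proof (induction k arbitrary: f)
  case 0
  then show ?case
    by (auto simp: continuous_on_eq_continuous_at differentiable_imp_continuous_within)
next
  case (Suc k)
  from Suc.prems have "\<forall>x. f differentiable at x" by simp
  moreover have "Ck k (\<lambda>x. frechet_derivative f (at x) b)" if "b \<in> Basis" for b
    using Suc.prems that by (intro Suc.IH) simp
  ultimately show ?case by simp
qed

lemma Ck_continuous: "Ck k f \<Longrightarrow> continuous_on UNIV f"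
proof (induction k)
  case (Suc k)
  then show ?case using Ck_pred by blast
qed simp

lemma Ck_const: "Ck k (\<lambda>x. c)"
proof (induction k arbitrary: c)
  case (Suc k)
  show ?case by (rule Ck_SucI[where f'="\<lambda>x h. 0"]) (auto intro: Suc.IH)
qed simp

lemma Ck_add: "Ck k f \<Longrightarrow> Ck k h \<Longrightarrow> Ck k (\<lambda>x. f x + h x)"
proof (induction k arbitrary: f h)
  case 0
  then show ?case by (auto intro: continuous_intros)
next
  case (Suc k)
  note D = Ck_SucD[OF Suc.prems(1)] Ck_SucD[OF Suc.prems(2)]
  show ?case
    by (rule Ck_SucI[OF has_derivative_add[OF D(1) D(3)]]) (intro Suc.IH D)
qed

lemma Ck_mult: "Ck k f \<Longrightarrow> Ck k h \<Longrightarrow> Ck k (\<lambda>x. f x * h x)"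
proof (induction k arbitrary: f h)
  case 0
  then show ?case by (auto intro: continuous_intros)
next
  case (Suc k)
  note D = Ck_SucD[OF Suc.prems(1)] Ck_SucD[OF Suc.prems(2)]
  note P = Ck_pred[OF Suc.prems(1)] Ck_pred[OF Suc.prems(2)]
  show ?case
    by (rule Ck_SucI[OF has_derivative_mult[OF D(1) D(3)]]) (intro Ck_add Suc.IH D P)
qed

lemma Ck_affine: "Ck k f \<Longrightarrow> Ck k (\<lambda>x. f (a + c *\<^sub>R x))"
proof (induction k arbitrary: f)
  case 0
  then show ?case
    by (auto intro!: continuous_intros continuous_on_compose2[where f="\<lambda>x. a + c *\<^sub>R x"])
next
  case (Suc k)
  note D = Ck_SucD[OF Suc.prems(1)]
  have "((\<lambda>x. f (a + c *\<^sub>R x)) has_derivative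
      (\<lambda>h. c * frechet_derivative f (at (a + c *\<^sub>R x)) h)) (at x)" for x
  proof -
    interpret L: bounded_linear "frechet_derivative f (at (a + c *\<^sub>R x))"
      using D(1) by (rule has_derivative_bounded_linear)
    have "((\<lambda>x. f (a + c *\<^sub>R x)) has_derivative
      (\<lambda>h. frechet_derivative f (at (a + c *\<^sub>R x)) (c *\<^sub>R h))) (at x)"
      by (rule has_derivative_compose[OF _ D(1), where f="\<lambda>x. a + c *\<^sub>R x"])
        (auto intro!: derivative_eq_intros)
    then show ?thesis by (simp add: L.scaleR)
  qed
  then show ?case
    by (rule Ck_SucI) (intro Ck_mult Ck_const Suc.IH[of "\<lambda>y. frechet_derivative f (at y) _"] D)
qed

lemma Ck_inner_const: "Ck k (\<lambda>x. x \<bullet> b)"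
proof (cases k)
  case 0
  then show ?thesis by (auto intro: continuous_intros)
next
  case (Suc j)
  have "Ck (Suc j) (\<lambda>x. x \<bullet> b)"
    by (rule Ck_SucI[where f'="\<lambda>x h. h \<bullet> b"])
      (auto intro!: derivative_eq_intros Ck_const)
  then show ?thesis using Suc by simp
qed

lemma Ck_inner_const': "Ck k (\<lambda>x. b \<bullet> x)"
  using Ck_inner_const[of k b] by (subst inner_commute)

lemma Ck_inner_self: "Ck k (\<lambda>x::'a::euclidean_space. x \<bullet> x)"
proof (cases k)
  case 0
  then show ?thesis by (auto intro: continuous_intros)
next
  case (Suc j)
  have "Ck (Suc j) (\<lambda>x::'a. x \<bullet> x)"
  proof (rule Ck_SucI)
    show "((\<lambda>x. x \<bullet> x) has_derivative (\<lambda>h. x \<bullet> h + h \<bullet> x)) (at x)" for x :: 'a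
      by (rule has_derivative_inner) (rule has_derivative_ident)+
  qed (intro Ck_add Ck_inner_const Ck_inner_const')
  then show ?thesis using Suc by simp
qed

text \<open>Closure of a family of one-variable functions under differentiation is all the induction
  needs, so no higher derivative is ever computed. The set S allows functions that are
  differentiable only on part of the line, such as the logarithm.\<close>

lemma Ck_compose_family:
  fixes v :: "'a::euclidean_space \<Rightarrow> real"
  assumes fam: "\<And>f. f \<in> \<F> \<Longrightarrow> \<exists>f'\<in>\<F>. \<forall>t\<in>S. (f has_real_derivative f' t) (at t)"
    and S: "\<And>x. v x \<in> S"
  shows "Ck k v \<Longrightarrow> f \<in> \<F> \<Longrightarrow> Ck k (\<lambda>x. f (v x))"
proof (induction k arbitrary: f)
  case 0
  obtain f' where "\<forall>t\<in>S. (f has_real_derivative f' t) (at t)"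
    using fam[OF 0(2)] by blast
  then have "continuous_on S f"
    by (intro continuous_at_imp_continuous_on) (blast intro: DERIV_isCont)
  then show ?case
    using 0 S by (auto intro!: continuous_on_compose2[where f=v and s=UNIV])
next
  case (Suc k)
  obtain f' where f': "f' \<in> \<F>" "\<And>t. t \<in> S \<Longrightarrow> (f has_real_derivative f' t) (at t)"
    using fam[OF Suc(3)] by blast
  note D = Ck_SucD[OF Suc.prems(1)]
  have "((\<lambda>x. f (v x)) has_derivative (\<lambda>h. f' (v x) * frechet_derivative v (at x) h)) (at x)" for x
    using has_derivative_compose[OF D(1) f'(2)[OF S, unfolded has_field_derivative_def]]
    by simp
  then show ?case
  proof (rule Ck_SucI)
    fix b :: 'a assume "b \<in> Basis"
    then show "Ck k (\<lambda>x. f' (v x) * frechet_derivative v (at x) b)"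
      using Suc.IH[OF Ck_pred[OF Suc.prems(1)] f'(1)] D(2) by (intro Ck_mult)
  qed
qed

lemma Ck_ln:
  fixes v :: "'a::euclidean_space \<Rightarrow> real"
  assumes "Ck k v" "\<And>x. v x > 0"
  shows "Ck k (\<lambda>x. ln (v x))"
\<comment> \<open>The logarithm together with all multiples of t^(-n-1) is closed under
  differentiation on the positive half-line.\<close>
proof (rule Ck_compose_family[where \<F>="insert ln (range (\<lambda>(c, n::nat) t::real. c * (1/t) ^ Suc n))" and S="{0<..}" and f=ln and v=v])
  fix f :: "real \<Rightarrow> real"
  assume "f \<in> insert ln (range (\<lambda>(c, n::nat) t::real. c * (1/t) ^ Suc n))"
  then consider "f = ln" | c n where "f = (\<lambda>t. c * (1/t) ^ Suc n)" by auto
  then show "\<exists>f'\<in>insert ln (range (\<lambda>(c, n::nat) t::real. c * (1/t) ^ Suc n)).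
      \<forall>t\<in>{0<..}. (f has_real_derivative f' t) (at t)"
  proof cases
    case 1
    have "(\<lambda>t::real. 1 * (1/t) ^ Suc 0) \<in> insert ln (range (\<lambda>(c, n::nat) t::real. c * (1/t) ^ Suc n))" by (auto intro: image_eqI[where x="(1,0)"])
    moreover have "\<forall>t\<in>{0<..}. (f has_real_derivative 1 * (1/t) ^ Suc 0) (at t)"
      using 1 by (auto intro!: derivative_eq_intros)
    ultimately show ?thesis by (intro bexI)
  next
    case 2
    have "(\<lambda>t::real. - (c * real (Suc n)) * (1/t) ^ Suc (Suc n)) \<in> insert ln (range (\<lambda>(c, n::nat) t::real. c * (1/t) ^ Suc n))"
      by (auto intro!: image_eqI[where x="(- (c * real (Suc n)), Suc n)"])
    moreover have "\<forall>t\<in>{0<..}. (f has_real_derivative - (c * real (Suc n)) * (1/t) ^ Suc (Suc n)) (at t)"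
      proof
      fix t :: real assume "t \<in> {0<..}"
      then have "((\<lambda>t. 1 / t) has_real_derivative - (1/t)\<^sup>2) (at t)"
        by (auto intro!: derivative_eq_intros simp: power2_eq_square)
      from DERIV_cmult[OF DERIV_power[OF this], of c "Suc n"]
      show "(f has_real_derivative - (c * real (Suc n)) * (1/t) ^ Suc (Suc n)) (at t)"
        unfolding 2 by (rule DERIV_cong) (simp add: power2_eq_square)
    qed
    ultimately show ?thesis by (intro bexI)
  qed
qed (use assms in auto)

text \<open>The classical smooth function that vanishes to infinite order at 0. It serves as
  mollifier profile, as penalty in u and as profile of the cutoff; in the last two roles the
  relation flat' = flat / t^2 is essential.\<close>

definition flat :: "real \<Rightarrow> real" where
  "flat t = (if t > 0 then exp (- (1 / t)) else 0)"

definition flat' :: "real \<Rightarrow> real" where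
  "flat' t = (if t > 0 then exp (- (1 / t)) / t\<^sup>2 else 0)"

text \<open>The extra factor x^k makes the induction over coefficients work: a + x P turns the claim
  for k into the claim for P with k + 1.\<close>

lemma exp_decay_poly:
  fixes P :: "real poly"
  shows "((\<lambda>x. x ^ k * poly P x * exp (- x)) \<longlongrightarrow> 0) at_top"
proof (induction P arbitrary: k)
  case (pCons a P)
  have "((\<lambda>x::real. a * (x ^ k / exp x) + x ^ Suc k * poly P x * exp (- x)) \<longlongrightarrow> a * 0 + 0) at_top"
    by (intro tendsto_intros tendsto_power_div_exp_0 pCons.IH)
  then show ?case by (simp add: exp_minus divide_inverse algebra_simps)
qed simp

text \<open>The functions P(1/t) exp (-1/t), extended by 0, are closed under differentiation: the
  new polynomial is X^2 (P - P'), where \<open>[:0,0,1:]\<close> is X^2. Only t = 0 needs an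
  argument, namely that exponential decay beats the difference quotient.\<close>

lemma flat_family_derivative:
  fixes P :: "real poly"
  defines "E \<equiv> \<lambda>P t. if t > 0 then poly P (1 / t) * exp (- (1 / t)) else 0"
  shows "(E P has_real_derivative E ([:0,0,1:] * (P - pderiv P)) t) (at t)"
proof -
  consider "t > 0" | "t < 0" | "t = 0" by linarith
  then show ?thesis
  proof cases
    case 1
    have "((\<lambda>t. poly P (1 / t) * exp (- (1 / t))) has_real_derivative
        E ([:0,0,1:] * (P - pderiv P)) t) (at t)"
      using 1 by (auto intro!: derivative_eq_intros simp: E_def field_simps power2_eq_square)
    then show ?thesis
      by (rule has_field_derivative_transform_within_open[where S="{0<..}"]) (use 1 in \<open>auto simp: E_def\<close>)
  next
    case 2
    have "((\<lambda>t. 0) has_real_derivative 0) (at t)" by simp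
    then have "(E P has_real_derivative 0) (at t)"
      by (rule has_field_derivative_transform_within_open[where S="{..<0}"]) (use 2 in \<open>auto simp: E_def\<close>)
    then show ?thesis using 2 by (simp add: E_def)
  next
    case 3
    have "((\<lambda>h. E P h / h) \<longlongrightarrow> 0) (at_right 0)"
    proof -
      \<comment> \<open>The difference quotient at 0 from the right, written in the variable x =
        1/h; dividing by h supplies the power k = 1.\<close>
      have "((\<lambda>h. inverse h ^ 1 * poly P (inverse h) * exp (- (inverse h))) \<longlongrightarrow> 0) (at_right 0)"
        by (rule filterlim_compose[OF exp_decay_poly[of 1 P] filterlim_inverse_at_top_right])
      then show ?thesis
        by (rule Lim_transform_eventually)
          (auto simp: E_def field_simps eventually_at_right_less
            intro!: eventually_mono[OF eventually_at_right_less])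
    qed
    moreover have "((\<lambda>h. E P h / h) \<longlongrightarrow> 0) (at_left 0)"
      by (rule Lim_transform_eventually[OF tendsto_const])
        (auto simp: E_def eventually_at_left_real intro!: eventually_at_leftI[of "-1"])
    ultimately have "((\<lambda>h. E P h / h) \<longlongrightarrow> 0) (at 0)"
      by (simp add: filterlim_split_at)
    then show ?thesis using 3 by (simp add: has_field_derivative_iff E_def)
  qed
qed

lemma flat_has_derivative: "(flat has_real_derivative flat' t) (at t)"
  using flat_family_derivative[of 1 t]
  by (simp add: flat_def[abs_def] flat'_def power2_eq_square pderiv_1 field_simps cong: if_cong)

lemma Ck_flat:
  fixes v :: "'a::euclidean_space \<Rightarrow> real"
  assumes "Ck k v"
  shows "Ck k (\<lambda>x. flat (v x))"
proof -
  define E :: "real poly \<Rightarrow> real \<Rightarrow> real"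
    where "E = (\<lambda>P t. if t > 0 then poly P (1 / t) * exp (- (1 / t)) else 0)"
  have E: "(E P has_real_derivative E ([:0,0,1:] * (P - pderiv P)) t) (at t)" for P t
    unfolding E_def by (rule flat_family_derivative)
  have fam: "\<exists>f'\<in>range E. \<forall>t\<in>UNIV. (f has_real_derivative f' t) (at t)" if f: "f \<in> range E" for f
  proof -
    obtain P where "f = E P" using f by blast
    then show ?thesis using E[of P] by (intro bexI[of _ "E ([:0,0,1:] * (P - pderiv P))"]) auto
  qed
  have "flat = E 1" by (auto simp: flat_def E_def)
  then have "flat \<in> range E" by simp
  then show ?thesis
    by (intro Ck_compose_family[where S=UNIV and \<F>="range E", OF fam _ assms]) auto
qed

lemma flat_nonneg: "0 \<le> flat t" and flat'_nonneg: "0 \<le> flat' t"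
  by (auto simp: flat_def flat'_def)

lemma flat_le_1: "flat t \<le> 1"
  by (auto simp: flat_def)

text \<open>The maximum of x^a exp (-x) is attained at x = a; \<open>ln y \<le> y - 1\<close> at y =
  x/a gives the value a^a exp (-a), and the last factor is discarded.\<close>

lemma powr_exp_bound:
  fixes a x :: real
  assumes "a > 0" "x > 0"
  shows "x powr a * exp (- x) \<le> a powr a"
proof -
  have "ln (x / a) \<le> x / a - 1" using assms by (intro ln_le_minus_one) auto
  then have "a * (ln x - ln a) \<le> a * (x / a - 1)"
    using assms by (intro mult_left_mono) (auto simp: ln_div)
  then have "a * ln x - x \<le> a * ln a - a" using assms by (simp add: algebra_simps)
  then have "exp (a * ln x - x) \<le> exp (a * ln a)" using assms by simp
  then show ?thesis using assms by (simp add: powr_def exp_diff exp_minus divide_inverse)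
qed

lemma flat'_eq: "t > 0 \<Longrightarrow> flat' t = flat t / t\<^sup>2"
  by (simp add: flat_def flat'_def)

lemma flat'_le: "flat' t \<le> 4"
proof (cases "t > 0")
  case True
  have "(1/t) powr 2 * exp (- (1/t)) \<le> 2 powr 2" by (rule powr_exp_bound) (use True in auto)
  then show ?thesis using True by (simp add: flat'_def powr_numeral power_divide)
qed (simp add: flat'_def)

lemma continuous_on_flat': "continuous_on UNIV flat'"
proof -
  have "Ck 1 (\<lambda>x::real. x)" using Ck_inner_const[of 1 "1::real"] by (simp only: inner_real_def mult_1_right)
  then have "Ck 1 (\<lambda>x::real. flat x)" by (rule Ck_flat)
  then have "continuous_on UNIV (\<lambda>x. frechet_derivative flat (at x) 1)" by simp
  moreover have "frechet_derivative flat (at x) 1 = flat' x" for x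
    using frechet_derivative_eqI[OF flat_has_derivative[unfolded has_field_derivative_def]] by simp
  ultimately show ?thesis by simp
qed

lemma continuous_on_flat: "continuous_on UNIV flat"
  using flat_has_derivative by (intro continuous_at_imp_continuous_on) (blast intro: DERIV_isCont)

section \<open>Mollifiers\<close>

lemma frechet_derivative_eq_grad:
  "f differentiable (at x) \<Longrightarrow> frechet_derivative f (at x) h = grad f x \<bullet> h"
  using frechet_derivative_eqI[OF has_derivative_grad] .

lemma Ck_Suc_differentiable: "Ck (Suc k) f \<Longrightarrow> f differentiable (at x)"
  by simp

lemma continuous_on_grad: "Ck (Suc k) f \<Longrightarrow> continuous_on UNIV (grad f)"
  unfolding grad_def[abs_def] by (intro continuous_intros) (auto intro: Ck_continuous)

lemma Ck_grad_inner: "Ck (Suc k) f \<Longrightarrow> b \<in> Basis \<Longrightarrow> Ck k (\<lambda>x. grad f x \<bullet> b)"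
  using frechet_derivative_eq_grad[of f] by simp

text \<open>The integral runs over a fixed box, the setting of \<open>leibniz_rule\<close>, so that
  smoothness of the kernel suffices and no support condition is needed. The derivative appears as a
  bounded linear function because that rule integrates derivatives as such objects.\<close>

lemma moll_has_derivative:
  fixes k w :: "'a::euclidean_space \<Rightarrow> real"
  assumes k: "Ck (Suc j) k" and w: "continuous_on UNIV w"
  shows "((\<lambda>x. integral (cbox a b) (\<lambda>y. k (x - y) * w y)) has_derivative
    (\<lambda>h. integral (cbox a b) (\<lambda>y. w y *\<^sub>R grad k (x - y)) \<bullet> h)) (at x)"
proof -
  have ck: "continuous_on UNIV k" using k by (rule Ck_continuous)
  note cg = continuous_on_grad[OF k]
  let ?fx = "\<lambda>x y. blinfun_inner_right (w y *\<^sub>R grad k (x - y))"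
  have cont: "continuous_on S (\<lambda>y. w y *\<^sub>R grad k (x - y))" for S x
    by (intro continuous_intros continuous_on_compose2[OF cg] continuous_on_subset[OF w]) auto
  have "((\<lambda>x. integral (cbox a b) (\<lambda>y. k (x - y) * w y)) has_derivative
     blinfun_apply (integral (cbox a b) (?fx x))) (at x within UNIV)"
  proof (rule leibniz_rule)
    fix x y assume "y \<in> cbox a b"
    have "((\<lambda>x. k (x - y)) has_derivative (\<lambda>h. grad k (x - y) \<bullet> h)) (at x)"
      by (rule has_derivative_compose[OF _ has_derivative_grad[OF Ck_Suc_differentiable[OF k]], where f="\<lambda>x. x - y"])
        (auto intro!: derivative_eq_intros)
    then have "((\<lambda>x. k (x - y) * w y) has_derivative (\<lambda>h. (grad k (x - y) \<bullet> h) * w y)) (at x)"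
      by (auto intro!: derivative_eq_intros)
    then show "((\<lambda>x. k (x - y) * w y) has_derivative blinfun_apply (?fx x y)) (at x within UNIV)"
      by (simp add: mult.commute blinfun_inner_right.rep_eq[abs_def] inner_scaleR_left[abs_def])
  next
    fix x
    show "(\<lambda>y. k (x - y) * w y) integrable_on cbox a b"
      by (intro integrable_continuous continuous_intros continuous_on_compose2[OF ck]
        continuous_on_subset[OF w]) auto
  next
    show "continuous_on (UNIV \<times> cbox a b) (\<lambda>(x, y). ?fx x y)"
      unfolding split_beta
      by (intro bounded_linear.continuous_on[OF bounded_linear_blinfun_inner_right]
          continuous_intros continuous_on_compose2[OF cg] continuous_on_compose2[OF w]) auto
  qed auto
  moreover have "blinfun_apply (integral (cbox a b) (?fx x)) =
      (\<lambda>h. integral (cbox a b) (\<lambda>y. w y *\<^sub>R grad k (x - y)) \<bullet> h)"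
  proof -
    have "integral (cbox a b) (?fx x) = blinfun_inner_right (integral (cbox a b) (\<lambda>y. w y *\<^sub>R grad k (x - y)))"
      using integral_linear[OF integrable_continuous[OF cont] bounded_linear_blinfun_inner_right]
      by (simp add: o_def)
    then show ?thesis by auto
  qed
  ultimately show ?thesis by (simp only:)
qed

lemma grad_moll:
  fixes k w :: "'a::euclidean_space \<Rightarrow> real"
  assumes "Ck (Suc j) k" and "continuous_on UNIV w"
  shows "grad (\<lambda>x. integral (cbox a b) (\<lambda>y. k (x - y) * w y)) x =
    integral (cbox a b) (\<lambda>y. w y *\<^sub>R grad k (x - y))"
  by (rule grad_eqI[OF moll_has_derivative[OF assms]])

text \<open>A partial derivative of the mollification is the mollification of the same w with a
  partial derivative of the kernel, which is again smooth; hence the induction is over all kernels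
  at once.\<close>

lemma Ck_moll:
  fixes k w :: "'a::euclidean_space \<Rightarrow> real"
  assumes "\<And>j. Ck j k" and w: "continuous_on UNIV w"
  shows "Ck n (\<lambda>x. integral (cbox a b) (\<lambda>y. k (x - y) * w y))"
  using assms(1)
proof (induction n arbitrary: k)
  case 0
  have "continuous_on UNIV (\<lambda>x. integral (cbox a b) (\<lambda>y. k (x - y) * w y))"
    using has_derivative_continuous[OF moll_has_derivative[OF 0 w]]
    by (intro continuous_at_imp_continuous_on) auto
  then show ?case by simp
next
  case (Suc n)
  show ?case
  proof (rule Ck_SucI[OF moll_has_derivative[OF Suc.prems w]])
    fix c :: 'a assume c: "c \<in> Basis"
    have cont: "continuous_on S (\<lambda>y. w y *\<^sub>R grad k (x - y))" for S x
      by (intro continuous_intros continuous_on_compose2[OF continuous_on_grad[OF Suc.prems]]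
        continuous_on_subset[OF w]) auto
    have "integral (cbox a b) (\<lambda>y. w y *\<^sub>R grad k (x - y)) \<bullet> c =
        integral (cbox a b) (\<lambda>y. (grad k (x - y) \<bullet> c) * w y)" for x
      using integral_linear[OF integrable_continuous[OF cont] bounded_linear_inner_left, of a b c x]
      by (simp add: o_def mult.commute)
    moreover have "Ck n (\<lambda>x. integral (cbox a b) (\<lambda>y. (grad k (x - y) \<bullet> c) * w y))"
      by (rule Suc.IH) (rule Ck_grad_inner[OF Suc.prems c])
    ultimately show "Ck n (\<lambda>x. integral (cbox a b) (\<lambda>y. w y *\<^sub>R grad k (x - y)) \<bullet> c)" by simp
  qed
qed

section \<open>Existence and elementary properties of mollifiers\<close>

lemma flat_mono:
  assumes "s \<le> t"
  shows "flat s \<le> flat t"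
proof (cases "0 < s")
  case True
  then have "1 / t \<le> 1 / s" using assms by (intro frac_le) auto
  then show ?thesis using True assms by (simp add: flat_def)
next
  case False
  then show ?thesis using flat_nonneg[of t] by (simp add: flat_def)
qed

text \<open>No rescaled family is fixed: e only bounds the support. Nonnegativity, unit mass and
  small support are all that the convergence results use, and they hold uniformly over such
  kernels.\<close>

definition mollifier :: "real \<Rightarrow> ('a::euclidean_space \<Rightarrow> real) \<Rightarrow> bool" where
  "mollifier e k \<longleftrightarrow> (\<forall>j. Ck j k) \<and> (\<forall>z. 0 \<le> k z) \<and> (\<forall>z. e \<le> norm z \<longrightarrow> k z = 0) \<and>
     integrable lborel k \<and> integral\<^sup>L lborel k = 1"

lemma integrable_compact_support:
  fixes f :: "'a::euclidean_space \<Rightarrow> 'b::{banach, second_countable_topology}"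
  assumes "continuous_on UNIV f" "compact K" "\<And>x. x \<notin> K \<Longrightarrow> f x = 0"
  shows "integrable lborel f"
proof -
  have "(\<lambda>x. indicator K x *\<^sub>R f x) = f"
    using assms(3) by (auto simp: indicator_def)
  with borel_integrable_compact[OF assms(2) continuous_on_subset[OF assms(1)]] show ?thesis by simp
qed

lemma integrable_indicator_bounded:
  fixes A :: "'a::euclidean_space set"
  shows "bounded A \<Longrightarrow> A \<in> sets borel \<Longrightarrow> integrable lborel (indicator A :: 'a \<Rightarrow> real)"
  using emeasure_bounded_finite[of A] by (intro integrable_real_indicator) auto

lemma ex_mollifier:
  assumes "e > 0"
  shows "\<exists>k :: 'a::euclidean_space \<Rightarrow> real. mollifier e k"
proof -
  define r :: "'a \<Rightarrow> real" where "r = (\<lambda>z. flat (e\<^sup>2 + (-1) * (z \<bullet> z)))"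
  have smooth: "Ck j r" for j
    unfolding r_def by (intro Ck_flat Ck_add Ck_const Ck_mult Ck_inner_self)
  have nn: "0 \<le> r z" for z by (simp add: r_def flat_nonneg)
  have z: "r z = 0" if "e \<le> norm z" for z
  proof -
    have "e\<^sup>2 \<le> (norm z)\<^sup>2" using that assms by (intro power_mono) auto
    then show ?thesis by (auto simp: r_def flat_def power2_norm_eq_inner)
  qed
  have int: "integrable lborel r"
    by (rule integrable_compact_support[where K="cball 0 e"]) (use z Ck_continuous[OF smooth] in auto)
  define c where "c = integral\<^sup>L lborel r"
  have "0 < c"
  proof -
    \<comment> \<open>Positivity of the mass: on the half ball e^2 - |z|^2 stays above e^2/2, so
      monotonicity of \<open>flat\<close> gives a positive constant below r there.\<close>
    have b: "flat (e\<^sup>2 / 2) * indicator (ball 0 (e/2)) z \<le> r z" for z :: 'a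
    proof (cases "norm z < e / 2")
      case True
      then have "(norm z)\<^sup>2 \<le> (e/2)\<^sup>2" by (intro power_mono) auto
      then have "z \<bullet> z \<le> e\<^sup>2 / 4" by (simp add: power_divide power2_norm_eq_inner)
      then have "e\<^sup>2 / 2 \<le> e\<^sup>2 - z \<bullet> z" using zero_le_power2[of e] by linarith
      then have "flat (e\<^sup>2 / 2) \<le> flat (e\<^sup>2 - z \<bullet> z)" by (rule flat_mono)
      then show ?thesis using True by (simp add: r_def)
    qed (auto simp: nn indicator_def)
    have "flat (e\<^sup>2 / 2) * measure lborel (ball 0 (e/2) :: 'a set) =
        (LINT z|lborel. flat (e\<^sup>2 / 2) * indicator (ball 0 (e/2) :: 'a set) z)"
      by simp
    also have "\<dots> \<le> c" unfolding c_def
      by (rule integral_mono[OF _ int b], intro integrable_mult_right integrable_indicator_bounded) auto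
    finally have "flat (e\<^sup>2 / 2) * measure lborel (ball 0 (e/2) :: 'a set) \<le> c" .
    moreover have "0 < flat (e\<^sup>2 / 2) * measure lborel (ball 0 (e/2) :: 'a set)"
      using assms by (intro mult_pos_pos) (auto simp: flat_def content_ball_pos)
    ultimately show ?thesis by linarith
  qed
  then have "mollifier e (\<lambda>z. (1 / c) * r z)"
    unfolding mollifier_def
  proof (intro conjI allI impI)
    show "Ck j (\<lambda>z. (1 / c) * r z)" for j by (intro Ck_mult Ck_const smooth)
    show "integral\<^sup>L lborel (\<lambda>z. (1 / c) * r z) = 1" using \<open>0 < c\<close> by (simp add: c_def)
  qed (use \<open>0 < c\<close> nn z int in auto)
  then show ?thesis by blast
qed

lemma mollifierD:
  assumes "mollifier e k"
  shows "Ck j k" "0 \<le> k z" "e \<le> norm z \<Longrightarrow> k z = 0" "integrable lborel k" "integral\<^sup>L lborel k = 1"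
  using assms by (auto simp: mollifier_def)

lemma mollifier_borel: "mollifier e k \<Longrightarrow> k \<in> borel_measurable borel"
  using Ck_continuous[OF mollifierD(1)] by (rule borel_measurable_continuous_onI)

lemma lborel_reflect:
  fixes x :: "'a::euclidean_space"
  shows "distr lborel borel (\<lambda>y. x - y) = lborel"
  using lborel_affine[of "-1" x] by (simp add: density_1 one_ennreal_def[symmetric])

lemma integral_reflect:
  fixes f :: "'a::euclidean_space \<Rightarrow> 'b::euclidean_space"
  assumes "f \<in> borel_measurable borel"
  shows "(LINT y|lborel. f (x - y)) = integral\<^sup>L lborel f"
    and "integrable lborel (\<lambda>y. f (x - y)) \<longleftrightarrow> integrable lborel f"
proof -
  have m: "(\<lambda>y. x - y) \<in> lborel \<rightarrow>\<^sub>M borel" by measurable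
  show "(LINT y|lborel. f (x - y)) = integral\<^sup>L lborel f"
    using integral_distr[OF m assms] by (simp add: lborel_reflect)
  show "integrable lborel (\<lambda>y. f (x - y)) \<longleftrightarrow> integrable lborel f"
    using integrable_distr_eq[OF m assms] by (simp add: lborel_reflect)
qed

lemma mollifier_shift:
  assumes "mollifier e k"
  shows "integrable lborel (\<lambda>y. k (x - y))" "(LINT y|lborel. k (x - y)) = 1"
  using integral_reflect[OF mollifier_borel[OF assms]] mollifierD[OF assms] by auto

lemma mollifier_bound:
  assumes "mollifier e k"
  obtains B where "B > 0" "\<And>z. k z \<le> B"
proof -
  have "compact (k ` cball 0 e)"
    using continuous_on_subset[OF Ck_continuous[OF mollifierD(1)[OF assms]]]
    by (intro compact_continuous_image) auto
  then obtain B where B: "\<And>z. z \<in> cball 0 e \<Longrightarrow> norm (k z) \<le> B"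
    by (meson bounded_iff compact_imp_bounded image_eqI)
  have "k z \<le> max B 1" for z
    using B[of z] mollifierD(3)[OF assms, of z] by (cases "norm z \<le> e") auto
  then show ?thesis using that[of "max B 1"] by simp
qed

section \<open>Mollification in Lebesgue spaces\<close>

lemma integrable_dominated:
  fixes f :: "'a \<Rightarrow> 'b::{banach, second_countable_topology}" and w :: "'a \<Rightarrow> real"
  assumes "integrable M w" "f \<in> borel_measurable M" "\<And>x. norm (f x) \<le> w x"
  shows "integrable M f"
  using assms(1,2)
  by (rule Bochner_Integration.integrable_bound) (use assms(3) in \<open>auto intro!: AE_I2 intro: order_trans[OF _ abs_ge_self]\<close>)

definition mconv :: "('a::euclidean_space \<Rightarrow> real) \<Rightarrow> ('a \<Rightarrow> 'b::euclidean_space) \<Rightarrow> 'a \<Rightarrow> 'b" where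
  "mconv k f x = (LINT y|lborel. k (x - y) *\<^sub>R f y)"

text \<open>Convexity of t^r in tangent form, extended to the endpoints a = 0 and t = 0, where the
  derivative argument on the open half-line does not apply. It is the pointwise core of Jensen's
  inequality.\<close>

lemma powr_tangent:
  fixes a t r :: real
  assumes "1 \<le> r" "0 \<le> a" "0 \<le> t"
  shows "a powr r + r * a powr (r - 1) * (t - a) \<le> t powr r"
proof -
  consider "a = 0" | "a > 0" "t = 0" | "a > 0" "t > 0" using assms by linarith
  then show ?thesis
  proof cases
    case 2
    have "a powr r = a * a powr (r - 1)" using 2 by (simp add: powr_mult_base)
    then have "a powr r + r * a powr (r - 1) * (t - a) = (1 - r) * a powr r"
      using 2 by (simp add: algebra_simps)
    also have "\<dots> \<le> 0" using assms by (intro mult_nonpos_nonneg) auto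
    finally show ?thesis using 2 by simp
  next
    case 3
    have "(r * a powr (r - 1)) * (t - a) \<le> t powr r - a powr r"
      by (rule convex_on_imp_above_tangent[OF powr_convex[OF assms(1)]])
        (use 3 in \<open>auto intro!: derivative_eq_intros simp: interior_open\<close>)
    then show ?thesis by simp
  qed auto
qed

lemma powr_add_le:
  fixes a b r :: real
  assumes "0 \<le> a" "0 \<le> b" "0 \<le> r"
  shows "(a + b) powr r \<le> 2 powr r * (a powr r + b powr r)"
proof -
  have "(a + b) powr r \<le> (2 * max a b) powr r" using assms by (intro powr_mono2) auto
  also have "\<dots> = 2 powr r * (max a b) powr r" using assms by (simp add: powr_mult)
  also have "\<dots> \<le> 2 powr r * (a powr r + b powr r)"
    by (intro mult_left_mono) (auto simp: max_def)
  finally show ?thesis .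
qed

lemma le_1_plus_powr: "1 \<le> r \<Longrightarrow> 0 \<le> (a::real) \<Longrightarrow> a \<le> 1 + a powr r"
proof (cases "a \<le> 1")
  case True
  then show ?thesis using powr_ge_zero[of a r] by linarith
next
  case False
  assume "1 \<le> r"
  then have "a powr 1 \<le> a powr r" using False by (intro powr_mono) auto
  then show ?thesis using False by simp
qed

lemma mconv_integrable:
  fixes f :: "'a::euclidean_space \<Rightarrow> 'b::euclidean_space"
  assumes k: "mollifier e k" and [measurable]: "f \<in> borel_measurable borel"
    and r: "1 \<le> r" and int: "integrable lborel (\<lambda>y. norm (f y) powr r)"
  shows "integrable lborel (\<lambda>y. k (x - y) * norm (f y) powr r)"
    and "integrable lborel (\<lambda>y. k (x - y) * norm (f y))"
    and "integrable lborel (\<lambda>y. k (x - y) *\<^sub>R f y)"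
proof -
  have [measurable]: "k \<in> borel_measurable borel" using mollifier_borel[OF k] .
  obtain B where B: "B > 0" "\<And>z. k z \<le> B" using mollifier_bound[OF k] by blast
  show 1: "integrable lborel (\<lambda>y. k (x - y) * norm (f y) powr r)"
    by (rule Bochner_Integration.integrable_bound[OF integrable_mult_right[OF int, of B]])
      (use B mollifierD(2)[OF k] in \<open>auto simp: abs_mult intro!: mult_right_mono\<close>)
  show 2: "integrable lborel (\<lambda>y. k (x - y) * norm (f y))"
  proof (rule Bochner_Integration.integrable_bound[OF Bochner_Integration.integrable_add[OF mollifier_shift(1)[OF k, of x] 1]])
    show "AE y in lborel. norm (k (x - y) * norm (f y)) \<le> norm (k (x - y) + k (x - y) * norm (f y) powr r)"
    proof (rule AE_I2)
      fix y
      have "k (x - y) * norm (f y) \<le> k (x - y) * (1 + norm (f y) powr r)"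
        by (intro mult_left_mono le_1_plus_powr r mollifierD(2)[OF k]) auto
      then show "norm (k (x - y) * norm (f y)) \<le> norm (k (x - y) + k (x - y) * norm (f y) powr r)"
        using mollifierD(2)[OF k, of "x - y"] by (simp add: algebra_simps)
    qed
  qed measurable
  show "integrable lborel (\<lambda>y. k (x - y) *\<^sub>R f y)"
    by (rule Bochner_Integration.integrable_bound[OF 2])
      (use mollifierD(2)[OF k] in auto)
qed

text \<open>Jensen's inequality for the probability density k(x - y): the tangent inequality is
  taken at the mean a of |f| and integrated.\<close>

lemma mconv_jensen:
  fixes f :: "'a::euclidean_space \<Rightarrow> 'b::euclidean_space"
  assumes k: "mollifier e k" and f[measurable]: "f \<in> borel_measurable borel"
    and r: "1 \<le> r" and int: "integrable lborel (\<lambda>y. norm (f y) powr r)"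
  shows "norm (mconv k f x) powr r \<le> (LINT y|lborel. k (x - y) * norm (f y) powr r)"
proof -
  note I = mconv_integrable[OF assms, of x]
  define a where "a = (LINT y|lborel. k (x - y) * norm (f y))"
  have a0: "0 \<le> a" unfolding a_def using mollifierD(2)[OF k] by (intro Bochner_Integration.integral_nonneg) auto
  have "norm (mconv k f x) \<le> (LINT y|lborel. norm (k (x - y) *\<^sub>R f y))"
    unfolding mconv_def by (rule integral_norm_bound)
  also have "\<dots> = a" unfolding a_def using mollifierD(2)[OF k] by simp
  finally have "norm (mconv k f x) powr r \<le> a powr r" using r by (intro powr_mono2) auto
  \<comment> \<open>The linear term integrates to 0 because a is the mean and the kernel has mass
    1.\<close>
  also have "\<dots> = (LINT y|lborel. a powr r * k (x - y) + r * a powr (r - 1) * (k (x - y) * norm (f y) - a * k (x - y)))"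
    using I(2) mollifier_shift[OF k, of x] by (simp add: a_def[symmetric])
  also have "\<dots> \<le> (LINT y|lborel. k (x - y) * norm (f y) powr r)"
  proof (rule integral_mono)
    fix y
    have "k (x - y) * (a powr r + r * a powr (r - 1) * (norm (f y) - a)) \<le> k (x - y) * norm (f y) powr r"
      by (intro mult_left_mono powr_tangent r a0 mollifierD(2)[OF k]) auto
    then show "a powr r * k (x - y) + r * a powr (r - 1) * (k (x - y) * norm (f y) - a * k (x - y)) \<le> k (x - y) * norm (f y) powr r"
      by (simp add: algebra_simps)
  qed (use I mollifier_shift[OF k, of x] in auto)
  finally show ?thesis .
qed

lemma mconv_borel:
  fixes f :: "'a::euclidean_space \<Rightarrow> 'b::euclidean_space"
  assumes "mollifier e k" and [measurable]: "f \<in> borel_measurable borel"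
  shows "mconv k f \<in> borel_measurable borel"
proof -
  have [measurable]: "k \<in> borel_measurable borel" using mollifier_borel[OF assms(1)] .
  show ?thesis unfolding mconv_def[abs_def] by measurable
qed

lemma lborel_translate: "distr lborel borel (\<lambda>x. x - y) = (lborel :: 'a::euclidean_space measure)"
  using lborel_affine[of 1 "- y"] by (simp add: density_1 one_ennreal_def[symmetric])

text \<open>Jensen's bound is integrated in x and the order of integration exchanged. The
  computation is done with nonnegative extended integrals, so that integrability comes out of it
  rather than being needed for it.\<close>

lemma mconv_contract:
  fixes f :: "'a::euclidean_space \<Rightarrow> 'b::euclidean_space"
  assumes k: "mollifier e k" and f[measurable]: "f \<in> borel_measurable borel"
    and r: "1 \<le> r" and int: "integrable lborel (\<lambda>y. norm (f y) powr r)"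
  shows "integrable lborel (\<lambda>x. norm (mconv k f x) powr r)"
    and "(LINT x|lborel. norm (mconv k f x) powr r) \<le> (LINT x|lborel. norm (f x) powr r)"
proof -
  have [measurable]: "k \<in> borel_measurable borel" using mollifier_borel[OF k] .
  have [measurable]: "mconv k f \<in> borel_measurable borel" using mconv_borel[OF k f] .
  have k0: "0 \<le> k z" for z using mollifierD(2)[OF k] .
  have one: "(\<integral>\<^sup>+x. ennreal (k (x - y)) \<partial>lborel) = 1" for y
  proof -
    have "(\<integral>\<^sup>+x. ennreal (k (x - y)) \<partial>lborel) = (\<integral>\<^sup>+x. ennreal (k x) \<partial>distr lborel borel (\<lambda>x. x - y))"
      by (subst nn_integral_distr) auto
    also have "\<dots> = 1" unfolding lborel_translate
      using nn_integral_eq_integral[OF mollifierD(4)[OF k]] k0 mollifierD(5)[OF k] by simp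
    finally show ?thesis .
  qed
  have "(\<integral>\<^sup>+x. ennreal (norm (mconv k f x) powr r) \<partial>lborel)
      \<le> (\<integral>\<^sup>+x. (\<integral>\<^sup>+y. ennreal (k (x - y)) * ennreal (norm (f y) powr r) \<partial>lborel) \<partial>lborel)"
  proof (rule nn_integral_mono)
    fix x
    have "ennreal (norm (mconv k f x) powr r) \<le> ennreal (LINT y|lborel. k (x - y) * norm (f y) powr r)"
      using mconv_jensen[OF assms] by (rule ennreal_leI)
    also have "\<dots> = (\<integral>\<^sup>+y. ennreal (k (x - y) * norm (f y) powr r) \<partial>lborel)"
      using k0 by (intro nn_integral_eq_integral[symmetric] mconv_integrable(1)[OF assms]) auto
    finally show "ennreal (norm (mconv k f x) powr r) \<le> (\<integral>\<^sup>+y. ennreal (k (x - y)) * ennreal (norm (f y) powr r) \<partial>lborel)"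
      using k0 by (simp add: ennreal_mult)
  qed
  also have "\<dots> = (\<integral>\<^sup>+y. (\<integral>\<^sup>+x. ennreal (k (x - y)) * ennreal (norm (f y) powr r) \<partial>lborel) \<partial>lborel)"
    by (rule lborel_pair.Fubini') measurable
  also have "\<dots> = (\<integral>\<^sup>+y. ennreal (norm (f y) powr r) \<partial>lborel)"
    by (simp add: nn_integral_multc one)
  also have "\<dots> = ennreal (LINT x|lborel. norm (f x) powr r)"
    by (rule nn_integral_eq_integral[OF int]) auto
  finally have le: "(\<integral>\<^sup>+x. ennreal (norm (mconv k f x) powr r) \<partial>lborel) \<le> ennreal (LINT x|lborel. norm (f x) powr r)" .
  then show I: "integrable lborel (\<lambda>x. norm (mconv k f x) powr r)"
    by (auto simp: integrable_iff_bounded intro: le_less_trans)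
  show "(LINT x|lborel. norm (mconv k f x) powr r) \<le> (LINT x|lborel. norm (f x) powr r)"
    using le nn_integral_eq_integral[OF I] by (simp add: integral_nonneg)
qed

text \<open>The radial retraction onto the closed ball of radius c; unlike a cutoff by an indicator
  it is continuous.\<close>

definition clamp_norm :: "real \<Rightarrow> 'b::euclidean_space \<Rightarrow> 'b" where
  "clamp_norm c v = (1 / max 1 (norm v / c)) *\<^sub>R v"

lemma clamp_norm:
  assumes "c > 0"
  shows "continuous_on UNIV (clamp_norm c)" "norm (clamp_norm c v) \<le> c"
    "norm v \<le> c \<Longrightarrow> clamp_norm c v = v" "norm (v - clamp_norm c v) \<le> norm v"
proof -
  show "continuous_on UNIV (clamp_norm c)"
    unfolding clamp_norm_def[abs_def] by (intro continuous_intros) (use assms in auto)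
  have m: "1 \<le> max 1 (norm v / c)" by simp
  show "norm (clamp_norm c v) \<le> c"
    using assms by (auto simp: clamp_norm_def max_def field_simps)
  show "norm v \<le> c \<Longrightarrow> clamp_norm c v = v"
    using assms by (auto simp: clamp_norm_def max_def field_simps)
  have "v - clamp_norm c v = (1 - 1 / max 1 (norm v / c)) *\<^sub>R v"
    by (simp add: clamp_norm_def algebra_simps)
  moreover have "\<bar>1 - 1 / max 1 (norm v / c)\<bar> \<le> 1" using m by (auto simp: field_simps)
  ultimately show "norm (v - clamp_norm c v) \<le> norm v"
    by (simp add: mult_left_le_one_le)
qed

text \<open>Two dominated approximations. Clamping the values gives a bounded h, dominated by |f|^r;
  then h is an almost everywhere limit of continuous functions, which are clamped and cut off in
  space so that one bounded, compactly supported function dominates all errors.\<close>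

lemma Lr_dense_continuous:
  fixes f :: "'a::euclidean_space \<Rightarrow> 'b::euclidean_space"
  assumes f[measurable]: "f \<in> borel_measurable borel"
    and r: "0 < r" and int: "integrable lborel (\<lambda>y. norm (f y) powr r)"
    and supp: "\<And>x. norm x > B \<Longrightarrow> f x = 0" and "0 < \<delta>"
  shows "\<exists>h. continuous_on UNIV h \<and> (\<forall>x. norm x > B + 1 \<longrightarrow> h x = 0) \<and>
    integrable lborel (\<lambda>x. norm (f x - h x) powr r) \<and> (LINT x|lborel. norm (f x - h x) powr r) < \<delta>"
proof -
  \<comment> \<open>Two errors below \<eta>, combined by \<open>powr_add_le\<close> at the price
    2^r, add up to at most \<delta>.\<close>
  define \<eta> where "\<eta> = \<delta> / (2 * 2 powr r)"
  have \<eta>: "0 < \<eta>" using \<open>0 < \<delta>\<close> by (simp add: \<eta>_def)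
  have [measurable]: "clamp_norm (real (Suc j)) \<in> borel_measurable borel" for j
    using clamp_norm(1)[of "real (Suc j)"] by (intro borel_measurable_continuous_onI) auto
  have "(\<lambda>j. LINT x|lborel. norm (f x - clamp_norm (real (Suc j)) (f x)) powr r) \<longlonglongrightarrow> (LINT x::'a|lborel. 0)"
  proof (rule integral_dominated_convergence[OF _ _ int])
    show "AE x in lborel. (\<lambda>j. norm (f x - clamp_norm (real (Suc j)) (f x)) powr r) \<longlonglongrightarrow> 0"
    proof (rule AE_I2)
      fix x
      obtain J :: nat where J: "norm (f x) \<le> real J" using real_arch_simple by blast
      have "norm (f x - clamp_norm (real (Suc j)) (f x)) powr r = 0" if "j \<ge> J" for j
        using clamp_norm(3)[of "real (Suc j)" "f x"] that J r by simp
      then show "(\<lambda>j. norm (f x - clamp_norm (real (Suc j)) (f x)) powr r) \<longlonglongrightarrow> 0"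
        by (intro tendsto_eventually) (auto simp: eventually_sequentially)
    qed
    show "AE x in lborel. norm (norm (f x - clamp_norm (real (Suc j)) (f x)) powr r) \<le> norm (f x) powr r" for j
      using clamp_norm(4)[of "real (Suc j)"] r by (intro AE_I2) (auto intro!: powr_mono2)
  qed measurable
  then have "eventually (\<lambda>j. (LINT x|lborel. norm (f x - clamp_norm (real (Suc j)) (f x)) powr r) < \<eta>) sequentially"
    using \<eta> by (intro order_tendstoD(2)[where a="\<eta>"]) auto
  then obtain j where j: "(LINT x|lborel. norm (f x - clamp_norm (real (Suc j)) (f x)) powr r) < \<eta>"
    by (auto simp: eventually_sequentially)
  define c where "c = real (Suc j)"
  define h where "h = (\<lambda>x. clamp_norm c (f x))"
  have c: "c > 0" by (simp add: c_def)
  have h[measurable]: "h \<in> borel_measurable borel" unfolding h_def c_def by measurable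
  have int1: "integrable lborel (\<lambda>x. norm (f x - h x) powr r)"
  proof (rule integrable_dominated[OF int])
    show "norm (norm (f x - h x) powr r) \<le> norm (f x) powr r" for x
      using clamp_norm(4)[OF c] r by (auto simp: h_def intro!: powr_mono2)
  qed measurable
  \<comment> \<open>The gauge-integral notion of measurability is, by definition, almost everywhere
    approximation by continuous functions.\<close>
  have "h measurable_on UNIV"
    by (rule lebesgue_measurable_imp_measurable_on) (auto intro: measurable_completion)
  then obtain Z G where Z: "negligible Z" and G: "\<And>n. continuous_on UNIV (G n)"
    and lim: "\<And>x. x \<notin> Z \<Longrightarrow> (\<lambda>n. G n x) \<longlonglongrightarrow> h x"
    unfolding measurable_on_def by auto
  define cut :: "'a \<Rightarrow> real" where "cut = (\<lambda>x. max 0 (min 1 (B + 1 - norm x)))"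
  define H where "H = (\<lambda>n x. cut x *\<^sub>R clamp_norm c (G n x))"
  have "continuous_on UNIV cut" unfolding cut_def by (intro continuous_intros)
  moreover have "continuous_on UNIV (\<lambda>x. clamp_norm c (G n x))" for n
    by (rule continuous_on_compose2[OF clamp_norm(1)[OF c] G]) simp
  ultimately have contH: "continuous_on UNIV (H n)" for n
    unfolding H_def by (intro continuous_on_scaleR)
  then have [measurable]: "H n \<in> borel_measurable borel" for n
    by (rule borel_measurable_continuous_onI)
  have suppH: "H n x = 0" if "norm x > B + 1" for n x
    using that by (simp add: H_def cut_def)
  have chi: "0 \<le> cut x" "cut x \<le> 1" for x by (auto simp: cut_def)
  have normH: "norm (H n x) \<le> c" for n x
  proof -
    have "norm (H n x) \<le> 1 * c" unfolding H_def norm_scaleR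
      using chi[of x] c by (intro mult_mono clamp_norm(2)) auto
    then show ?thesis by simp
  qed
  have suppf: "h x = 0" if "norm x > B" for x
    using supp[OF that] by (simp add: h_def clamp_norm_def)
  have normh: "norm (h x) \<le> c" for x using clamp_norm(2)[OF c] by (simp add: h_def)
  define W where "W = (\<lambda>x::'a. (2 * c) powr r * indicator (cball 0 (B + 1)) x :: real)"
  have intW: "integrable lborel W"
    unfolding W_def
    by (intro integrable_mult_right integrable_indicator_bounded) auto
  have bound: "norm (norm (h x - H n x) powr r) \<le> W x" for n x
  proof (cases "norm x > B + 1")
    case True
    then show ?thesis using suppH suppf r by (simp add: W_def)
  next
    case False
    have "norm (h x - H n x) \<le> 2 * c"
      using norm_triangle_ineq4[of "h x" "H n x"] normH[of n x] normh[of x] by linarith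
    then show ?thesis using False r by (auto simp: W_def intro!: powr_mono2)
  qed
  have dct: "(\<lambda>n. LINT x|lborel. norm (h x - H n x) powr r) \<longlonglongrightarrow> (LINT x::'a|lborel. 0)"
  proof (rule integral_dominated_convergence[OF _ _ intW])
    have "AE x in lebesgue. x \<notin> Z"
      using Z unfolding negligible_iff_null_sets by (rule AE_not_in)
    then have "AE x in lborel. x \<notin> Z" by (simp only: AE_completion_iff)
    then show "AE x in lborel. (\<lambda>n. norm (h x - H n x) powr r) \<longlonglongrightarrow> 0"
    proof eventually_elim
      case (elim x)
      have "(\<lambda>n. clamp_norm c (G n x)) \<longlonglongrightarrow> clamp_norm c (h x)"
        by (rule continuous_on_tendsto_compose[OF clamp_norm(1)[OF c] lim[OF elim]]) auto
      then have "(\<lambda>n. norm (h x - H n x) powr r) \<longlonglongrightarrow> norm (h x - cut x *\<^sub>R clamp_norm c (h x)) powr r"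
        unfolding H_def using r by (intro tendsto_intros tendsto_powr') auto
      \<comment> \<open>Inside radius B the factor \<open>cut\<close> is 1 and h already obeys the
        norm bound; outside, h vanishes.\<close>
      moreover have "h x - cut x *\<^sub>R clamp_norm c (h x) = 0"
        using suppf[of x] clamp_norm(3)[OF c normh[of x]] by (cases "norm x > B") (auto simp: cut_def)
      ultimately show ?case using r by simp
    qed
    show "AE x in lborel. norm (norm (h x - H n x) powr r) \<le> W x" for n
      using bound by simp
  qed measurable
  then have "eventually (\<lambda>n. (LINT x|lborel. norm (h x - H n x) powr r) < \<eta>) sequentially"
    using \<eta> by (intro order_tendstoD(2)[where a="\<eta>"]) auto
  then obtain n where n: "(LINT x|lborel. norm (h x - H n x) powr r) < \<eta>"
    by (auto simp: eventually_sequentially)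
  have int2: "integrable lborel (\<lambda>x. norm (h x - H n x) powr r)"
    by (rule integrable_dominated[OF intW _ bound]) measurable
  have le: "norm (f x - H n x) powr r \<le> 2 powr r * (norm (f x - h x) powr r + norm (h x - H n x) powr r)" for x
  proof -
    have "norm (f x - H n x) \<le> norm (f x - h x) + norm (h x - H n x)"
      using norm_triangle_ineq[of "f x - h x" "h x - H n x"] by simp
    then have "norm (f x - H n x) powr r \<le> (norm (f x - h x) + norm (h x - H n x)) powr r"
      using r by (intro powr_mono2) auto
    also have "\<dots> \<le> 2 powr r * (norm (f x - h x) powr r + norm (h x - H n x) powr r)"
      using r by (intro powr_add_le) auto
    finally show ?thesis .
  qed
  have int3: "integrable lborel (\<lambda>x. 2 powr r * (norm (f x - h x) powr r + norm (h x - H n x) powr r))"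
    using int1 int2 by simp
  have int4: "integrable lborel (\<lambda>x. norm (f x - H n x) powr r)"
  proof (rule integrable_dominated[OF int3])
    show "norm (norm (f x - H n x) powr r) \<le> 2 powr r * (norm (f x - h x) powr r + norm (h x - H n x) powr r)" for x
      using le[of x] by simp
  qed measurable
  have "(LINT x|lborel. norm (f x - H n x) powr r) \<le> (LINT x|lborel. 2 powr r * (norm (f x - h x) powr r + norm (h x - H n x) powr r))"
    by (rule integral_mono[OF int4 int3 le])
  also have "\<dots> = 2 powr r * ((LINT x|lborel. norm (f x - h x) powr r) + (LINT x|lborel. norm (h x - H n x) powr r))"
    using int1 int2 by simp
  also have "\<dots> < 2 powr r * (\<eta> + \<eta>)"
    using j n by (intro mult_strict_left_mono add_strict_mono) (auto simp: h_def c_def)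
  also have "\<dots> = \<delta>" by (simp add: \<eta>_def)
  finally have "(LINT x|lborel. norm (f x - H n x) powr r) < \<delta>" .
  then show ?thesis using contH suppH int4 by blast
qed

lemma mconv_diff:
  fixes f h :: "'a::euclidean_space \<Rightarrow> 'b::euclidean_space"
  assumes "integrable lborel (\<lambda>y. k (x - y) *\<^sub>R f y)" "integrable lborel (\<lambda>y. k (x - y) *\<^sub>R h y)"
  shows "mconv k (\<lambda>y. f y - h y) x = mconv k f x - mconv k h x"
  unfolding mconv_def using assms by (simp add: scaleR_diff_right)

lemma mconv_near:
  fixes h :: "'a::euclidean_space \<Rightarrow> 'b::euclidean_space"
  assumes k: "mollifier e k" and int: "integrable lborel (\<lambda>y. k (x - y) *\<^sub>R h y)"
    and near: "\<And>y. norm (x - y) < e \<Longrightarrow> norm (h y - c) \<le> \<eta>"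
  shows "norm (mconv k h x - c) \<le> \<eta>"
proof -
  note K = mollifier_shift[OF k, of x]
  have "mconv k h x - c = (LINT y|lborel. k (x - y) *\<^sub>R h y) - (LINT y|lborel. k (x - y) *\<^sub>R c)"
    using K by (simp add: mconv_def)
  also have "\<dots> = (LINT y|lborel. k (x - y) *\<^sub>R (h y - c))"
    using int K by (simp add: scaleR_diff_right)
  finally have "norm (mconv k h x - c) \<le> (LINT y|lborel. k (x - y) * \<eta>)"
  proof (rule ord_eq_le_trans[OF arg_cong[where f=norm]])
    show "norm (LINT y|lborel. k (x - y) *\<^sub>R (h y - c)) \<le> (LINT y|lborel. k (x - y) * \<eta>)"
    proof (rule order_trans[OF integral_norm_bound integral_mono])
      show "integrable lborel (\<lambda>y. norm (k (x - y) *\<^sub>R (h y - c)))"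
        unfolding scaleR_diff_right using int K
        by (intro integrable_norm Bochner_Integration.integrable_diff) auto
      show "integrable lborel (\<lambda>y. k (x - y) * \<eta>)" using K by simp
      fix y
      show "norm (k (x - y) *\<^sub>R (h y - c)) \<le> k (x - y) * \<eta>"
        using near[of y] mollifierD(2,3)[OF k, of "x - y"]
        by (cases "norm (x - y) < e") (auto intro!: mult_left_mono)
    qed
  qed
  also have "\<dots> = \<eta>" using K by simp
  finally show ?thesis .
qed

text \<open>The error is split as J(f - h) + (J h - h) - (f - h) with h continuous: contraction
  controls the first term by the third, uniform continuity controls the second. The threshold d does
  not depend on the kernel, so several smallness conditions can later be imposed on one
  mollifier.\<close>

lemma mconv_Lr:
  fixes f :: "'a::euclidean_space \<Rightarrow> 'b::euclidean_space"
  assumes f[measurable]: "f \<in> borel_measurable borel"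
    and r: "1 \<le> r" and int: "integrable lborel (\<lambda>y. norm (f y) powr r)"
    and supp: "\<And>x. norm x > B \<Longrightarrow> f x = 0" and "0 < \<delta>"
  shows "\<exists>d>0. \<forall>e k. 0 < e \<and> e < d \<and> mollifier e k \<longrightarrow>
    integrable lborel (\<lambda>x. norm (mconv k f x - f x) powr r) \<and>
    (LINT x|lborel. norm (mconv k f x - f x) powr r) < \<delta>"
proof -
  \<comment> \<open>Three errors below \<epsilon>, with the constant 4^r from using
    \<open>powr_add_le\<close> twice, stay below \<delta>.\<close>
  define \<epsilon> where "\<epsilon> = \<delta> / (4 * 4 powr r)"
  have \<epsilon>: "0 < \<epsilon>" using \<open>0 < \<delta>\<close> by (simp add: \<epsilon>_def)
  have r0: "0 < r" using r by simp
  obtain h where h: "continuous_on UNIV h" "\<And>x. norm x > B + 1 \<Longrightarrow> h x = 0"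
    "integrable lborel (\<lambda>x. norm (f x - h x) powr r)" "(LINT x|lborel. norm (f x - h x) powr r) < \<epsilon>"
    using Lr_dense_continuous[OF f r0 int supp \<epsilon>] by blast
  have [measurable]: "h \<in> borel_measurable borel" using h(1) by (rule borel_measurable_continuous_onI)
  define V where "V = measure lborel (cball (0::'a) (B + 2))"
  \<comment> \<open>A uniform error \<eta> on the ball of volume V costs less than \<epsilon>; V + 1
    yields the strict inequality.\<close>
  define \<eta> where "\<eta> = (\<epsilon> / (V + 1)) powr (1 / r)"
  have V: "0 \<le> V" by (simp add: V_def)
  have \<eta>: "0 < \<eta>" "\<eta> powr r * V < \<epsilon>"
  proof -
    show "0 < \<eta>" using \<epsilon> V by (simp add: \<eta>_def)
    have "\<eta> powr r = \<epsilon> / (V + 1)" using \<epsilon> V r by (simp add: \<eta>_def powr_powr)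
    then have "\<eta> powr r * V + \<eta> powr r = \<epsilon>" using V by (simp add: field_simps)
    moreover have "0 < \<eta> powr r" using \<open>0 < \<eta>\<close> by simp
    ultimately show "\<eta> powr r * V < \<epsilon>" by linarith
  qed
  \<comment> \<open>As e < 1, the error J h - h lives in radius B + 2, and computing it there uses
    values of h up to radius B + 3.\<close>
  have "uniformly_continuous_on (cball 0 (B + 3)) h"
    by (rule compact_uniformly_continuous[OF continuous_on_subset[OF h(1)]]) auto
  then obtain d where d: "0 < d" "\<And>x y. x \<in> cball 0 (B + 3) \<Longrightarrow> y \<in> cball 0 (B + 3) \<Longrightarrow> dist y x < d \<Longrightarrow> dist (h y) (h x) < \<eta>"
    unfolding uniformly_continuous_on_def using \<eta>(1) by metis
  have "integrable lborel (\<lambda>x. norm (mconv k f x - f x) powr r) \<and>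
    (LINT x|lborel. norm (mconv k f x - f x) powr r) < \<delta>"
    if e: "0 < e" "e < min d 1" and k: "mollifier e k" for e k
  proof -
    have [measurable]: "mconv k f \<in> borel_measurable borel" by (rule mconv_borel[OF k f])
    have "continuous_on UNIV (\<lambda>y. norm (h y) powr r)"
      by (rule continuous_on_powr'[OF continuous_on_norm[OF h(1)] continuous_on_const]) (use r in auto)
    then have hint: "integrable lborel (\<lambda>y. norm (h y) powr r)"
      by (rule integrable_compact_support[where K="cball 0 (B + 1)"])
        (use h(2) r in auto)
    have [measurable]: "mconv k h \<in> borel_measurable borel" by (rule mconv_borel[OF k]) measurable
    have fint: "integrable lborel (\<lambda>y. k (x - y) *\<^sub>R f y)" for x
      by (rule mconv_integrable(3)[OF k f r int])
    have hint': "integrable lborel (\<lambda>y. k (x - y) *\<^sub>R h y)" for x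
      by (rule mconv_integrable(3)[OF k _ r hint]) measurable
    have C: "integrable lborel (\<lambda>x. norm (mconv k (\<lambda>y. f y - h y) x) powr r)"
       "(LINT x|lborel. norm (mconv k (\<lambda>y. f y - h y) x) powr r) \<le> (LINT x|lborel. norm (f x - h x) powr r)"
      by (rule mconv_contract[OF k _ r h(3)], measurable)+
    have near: "norm (mconv k h x - h x) powr r \<le> \<eta> powr r * indicator (cball 0 (B + 2)) x" for x
    proof (cases "norm x > B + 2")
      case True
      have "norm (mconv k h x - h x) \<le> 0"
      proof (rule mconv_near[OF k hint'])
        fix y assume "norm (x - y) < e"
        then have "norm y > B + 1" using norm_triangle_sub[of x y] True e by simp
        then show "norm (h y - h x) \<le> 0" using h(2) True by simp
      qed
      then show ?thesis using r by (auto simp: indicator_def)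
    next
      case False
      have "norm (mconv k h x - h x) \<le> \<eta>"
      proof (rule mconv_near[OF k hint'])
        fix y assume y: "norm (x - y) < e"
        then have "norm y \<le> B + 3" using norm_triangle_sub[of y x] False e by (simp add: norm_minus_commute)
        then show "norm (h y - h x) \<le> \<eta>" using d(2)[of x y] y e False
          by (simp add: dist_norm norm_minus_commute)
      qed
      then show ?thesis using False r by (auto intro!: powr_mono2)
    qed
    have Wint: "integrable lborel (\<lambda>x::'a. \<eta> powr r * indicator (cball 0 (B + 2)) x :: real)"
      by (intro integrable_mult_right integrable_indicator_bounded) auto
    have N: "integrable lborel (\<lambda>x. norm (mconv k h x - h x) powr r)"
    proof (rule integrable_dominated[OF Wint])
      show "norm (norm (mconv k h x - h x) powr r) \<le> \<eta> powr r * indicator (cball 0 (B + 2)) x" for x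
        using near[of x] by simp
    qed measurable
    have "(LINT x|lborel. norm (mconv k h x - h x) powr r) \<le> (LINT x::'a|lborel. \<eta> powr r * indicator (cball 0 (B + 2)) x)"
      by (rule integral_mono[OF N Wint near])
    also have "\<dots> = \<eta> powr r * V" by (simp add: V_def)
    finally have N2: "(LINT x|lborel. norm (mconv k h x - h x) powr r) < \<epsilon>" using \<eta>(2) by simp
    let ?S = "\<lambda>x. 4 powr r * (norm (mconv k (\<lambda>y. f y - h y) x) powr r + (norm (mconv k h x - h x) powr r + norm (f x - h x) powr r))"
    have le: "norm (mconv k f x - f x) powr r \<le> ?S x" for x
    proof -
      let ?a = "norm (mconv k (\<lambda>y. f y - h y) x)" and ?b = "norm (mconv k h x - h x)" and ?c = "norm (f x - h x)"
      have "mconv k f x - f x = mconv k (\<lambda>y. f y - h y) x + (mconv k h x - h x) - (f x - h x)"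
        by (simp add: mconv_diff[OF fint hint'])
      then have "norm (mconv k f x - f x) \<le> ?a + ?b + ?c"
        using norm_triangle_ineq4[of "mconv k (\<lambda>y. f y - h y) x + (mconv k h x - h x)" "f x - h x"]
          norm_triangle_ineq[of "mconv k (\<lambda>y. f y - h y) x" "mconv k h x - h x"] by simp
      then have "norm (mconv k f x - f x) powr r \<le> (?a + (?b + ?c)) powr r"
        using r by (intro powr_mono2) auto
      also have "\<dots> \<le> 2 powr r * (?a powr r + (?b + ?c) powr r)"
        using r by (intro powr_add_le) auto
      also have "\<dots> \<le> 2 powr r * (2 powr r * ?a powr r + 2 powr r * (?b powr r + ?c powr r))"
        using r ge_one_powr_ge_zero[of 2 r]
        by (intro mult_left_mono add_mono powr_add_le) (auto simp: mult_le_cancel_right1)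
      also have "\<dots> = ?S x"
        using powr_mult[of 2 2 r] by (simp add: algebra_simps)
      finally show ?thesis .
    qed
    have Sint: "integrable lborel ?S" using C(1) N h(3) by simp
    have I: "integrable lborel (\<lambda>x. norm (mconv k f x - f x) powr r)"
    proof (rule integrable_dominated[OF Sint])
      show "norm (norm (mconv k f x - f x) powr r) \<le> ?S x" for x
        using le[of x] by simp
    qed measurable
    have "(LINT x|lborel. norm (mconv k f x - f x) powr r) \<le> integral\<^sup>L lborel ?S"
      by (rule integral_mono[OF I Sint le])
    also have "\<dots> = 4 powr r * ((LINT x|lborel. norm (mconv k (\<lambda>y. f y - h y) x) powr r) +
        ((LINT x|lborel. norm (mconv k h x - h x) powr r) + (LINT x|lborel. norm (f x - h x) powr r)))"
      using C(1) N h(3) by simp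
    also have "\<dots> < 4 powr r * (\<epsilon> + (\<epsilon> + \<epsilon>))"
      using C(2) N2 h(4) by (intro mult_strict_left_mono add_strict_mono) auto
    also have "\<dots> < \<delta>" using \<open>0 < \<delta>\<close> by (simp add: \<epsilon>_def)
    finally show ?thesis using I by blast
  qed
  then show ?thesis using d(1) by (intro exI[of _ "min d 1"]) auto
qed

section \<open>Weak gradients and mollification\<close>

lemma lebesgue_borel_version:
  fixes f :: "'a::euclidean_space \<Rightarrow> 'b::euclidean_space"
  assumes "f \<in> borel_measurable lebesgue"
  obtains f' where "f' \<in> borel_measurable borel" "AE x in lborel. f x = f' x"
proof -
  have "\<exists>h\<in>borel_measurable lborel. AE x in lborel. f x \<bullet> b = h x" for b
    using borel_measurable_inner[OF assms borel_measurable_const]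
    by (rule completion_ex_borel_measurable_real)
  then obtain h where h: "\<And>b. h b \<in> borel_measurable lborel" "\<And>b. AE x in lborel. f x \<bullet> b = h b x"
    by metis
  have "AE x in lborel. \<forall>b\<in>Basis. f x \<bullet> b = h b x"
    using h(2) by (intro AE_finite_allI) auto
  then have "AE x in lborel. f x = (\<Sum>b\<in>Basis. h b x *\<^sub>R b)"
  proof eventually_elim
    case (elim x)
    then have "(\<Sum>b\<in>Basis. h b x *\<^sub>R b) = (\<Sum>b\<in>Basis. (f x \<bullet> b) *\<^sub>R b)" by simp
    then show ?case by (simp add: euclidean_representation)
  qed
  moreover have "(\<lambda>x. \<Sum>b\<in>Basis. h b x *\<^sub>R b) \<in> borel_measurable borel"
    using h(1) by simp
  ultimately show ?thesis using that by blast
qed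

lemma Lp_loc_measurable:
  fixes f :: "'a::euclidean_space \<Rightarrow> 'b::euclidean_space"
  assumes "open \<Omega>" "Lp_loc \<Omega> r f"
  shows "(\<lambda>x. indicator \<Omega> x *\<^sub>R f x) \<in> borel_measurable lebesgue"
proof -
  obtain C where C: "\<And>n. compact (C n)" "\<And>n. C n \<subseteq> \<Omega>" "\<And>n. C n \<subseteq> interior (C (Suc n))" "\<Union>(range C) = \<Omega>"
    "\<And>K. compact K \<Longrightarrow> K \<subseteq> \<Omega> \<Longrightarrow> \<exists>N. \<forall>n\<ge>N. K \<subseteq> C n"
    using open_Union_compact_subsets[OF assms(1)] by metis
  show ?thesis
  proof (rule borel_measurable_LIMSEQ_metric)
    show "(\<lambda>x. indicator (C n) x *\<^sub>R f x) \<in> borel_measurable lebesgue" for n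
      using assms(2) C(1,2) by (auto simp: Lp_loc_def set_borel_measurable_def)
    fix x
    show "(\<lambda>n. indicator (C n) x *\<^sub>R f x) \<longlonglongrightarrow> indicator \<Omega> x *\<^sub>R f x"
    proof (cases "x \<in> \<Omega>")
      case True
      then obtain N where "\<forall>n\<ge>N. {x} \<subseteq> C n" using C(5)[of "{x}"] by auto
      then show ?thesis using True
        by (intro tendsto_eventually) (auto simp: eventually_sequentially intro!: exI[of _ N])
    next
      case False
      then have "x \<notin> C n" for n using C(2) by blast
      then show ?thesis using False by simp
    qed
  qed
qed

text \<open>Passage from Lebesgue measurable functions on \<Omega> to Borel functions on the whole
  space, where Tonelli's theorem and the mollifier lemmas are available. The Borel version vanishes
  almost everywhere outside \<Omega>.\<close>

lemma Lp_loc_borel_version: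
  fixes f :: "'a::euclidean_space \<Rightarrow> 'b::euclidean_space"
  assumes "open \<Omega>" "Lp_loc \<Omega> r f"
  obtains D where "D \<in> borel_measurable borel" "AE x in lborel. indicator \<Omega> x *\<^sub>R f x = D x"
    "\<And>K. compact K \<Longrightarrow> K \<subseteq> \<Omega> \<Longrightarrow> integrable lborel (\<lambda>x. indicator K x * norm (D x) powr r)"
proof -
  obtain D where D: "D \<in> borel_measurable borel" "AE x in lborel. indicator \<Omega> x *\<^sub>R f x = D x"
    using lebesgue_borel_version[OF Lp_loc_measurable[OF assms]] by blast
  have "integrable lborel (\<lambda>x. indicator K x * norm (D x) powr r)" if K: "compact K" "K \<subseteq> \<Omega>" for K
  proof -
    have [measurable]: "K \<in> sets borel" using K by (simp add: borel_compact)
    have m: "(\<lambda>x. indicator K x * norm (D x) powr r) \<in> borel_measurable borel"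
      using D(1) by measurable
    have i: "integrable lebesgue (\<lambda>x. indicator K x *\<^sub>R norm (f x) powr r)"
      using assms(2) K by (auto simp: Lp_loc_def set_integrable_def)
    have "integrable lebesgue (\<lambda>x. indicator K x * norm (D x) powr r)"
    proof (rule integrable_cong_AE_imp[OF i])
      have "AE x in lebesgue. indicator \<Omega> x *\<^sub>R f x = D x" using D(2) by (rule AE_completion)
      then show "AE x in lebesgue. indicator K x *\<^sub>R norm (f x) powr r = indicator K x * norm (D x) powr r"
        by eventually_elim (use K(2) in \<open>auto simp: indicator_def split: if_splits\<close>)
      show "(\<lambda>x. indicator K x * norm (D x) powr r) \<in> borel_measurable lebesgue"
        using m by (auto intro: measurable_completion)
    qed
    then show ?thesis using m by (simp add: integrable_completion)
  qed
  then show ?thesis using that D by blast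
qed

lemma grad_eq_0_outside:
  assumes "x \<notin> closure {x. \<phi> x \<noteq> 0}"
  shows "grad \<phi> x = 0"
proof (rule grad_eqI)
  have "((\<lambda>_. 0) has_derivative (\<lambda>h. 0 \<bullet> h)) (at x)" by simp
  then show "(\<phi> has_derivative (\<lambda>h. 0 \<bullet> h)) (at x)"
  proof (rule has_derivative_transform_within_open)
    show "open (- closure {x. \<phi> x \<noteq> 0})" by (simp add: open_Compl)
    show "x \<in> - closure {x. \<phi> x \<noteq> 0}" using assms by simp
    show "0 = \<phi> y" if "y \<in> - closure {x. \<phi> x \<noteq> 0}" for y
      using that closure_subset[of "{x. \<phi> x \<noteq> 0}"] by auto
  qed
qed

lemma test_functionD:
  assumes "test_function \<Omega> \<phi>"
  shows "Ck k \<phi>" "continuous_on UNIV \<phi>" "continuous_on UNIV (grad \<phi>)"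
    "x \<notin> \<Omega> \<Longrightarrow> \<phi> x = 0" "x \<notin> \<Omega> \<Longrightarrow> grad \<phi> x = 0"
proof -
  have C: "\<And>k. Ck k \<phi>" and s: "closure {x. \<phi> x \<noteq> 0} \<subseteq> \<Omega>"
    using assms by (auto simp: test_function_def)
  show "Ck k \<phi>" "continuous_on UNIV \<phi>" "continuous_on UNIV (grad \<phi>)"
    using C Ck_continuous continuous_on_grad by blast+
  show "x \<notin> \<Omega> \<Longrightarrow> grad \<phi> x = 0" using s by (intro grad_eq_0_outside) auto
  show "x \<notin> \<Omega> \<Longrightarrow> \<phi> x = 0" using s closure_subset[of "{x. \<phi> x \<noteq> 0}"] by auto
qed

lemma test_functionI:
  assumes "\<And>k. Ck k \<phi>" "compact K" "K \<subseteq> \<Omega>" "\<And>x. x \<notin> K \<Longrightarrow> \<phi> x = 0"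
  shows "test_function \<Omega> \<phi>"
proof -
  have "closure {x. \<phi> x \<noteq> 0} \<subseteq> K"
    using assms(2,4) by (intro closure_minimal compact_imp_closed) auto
  moreover then have "compact (closure {x. \<phi> x \<noteq> 0})"
    using assms(2) by (metis closed_closure compact_Int_closed inf.absorb_iff2)
  ultimately show ?thesis using assms(1,3) by (auto simp: test_function_def)
qed

lemma integral_lebesgue_AE_borel:
  fixes G :: "'a::euclidean_space \<Rightarrow> 'c::{banach, second_countable_topology}"
  assumes "F \<in> borel_measurable lebesgue" "G \<in> borel_measurable borel" "AE x in lborel. F x = G x"
  shows "integral\<^sup>L lebesgue F = integral\<^sup>L lborel G"
proof -
  have "integral\<^sup>L lebesgue F = integral\<^sup>L lebesgue G"
    using assms by (intro integral_cong_AE) (auto intro: measurable_completion AE_completion)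
  also have "\<dots> = integral\<^sup>L lborel G"
    using assms(2) by (intro integral_completion) simp
  finally show ?thesis .
qed

text \<open>Integrability of D is kept out of the predicate, since it is needed with exponent 1 for
  uniqueness and with exponent m for the energy. The integral with D may run over the whole space
  because \<phi> vanishes outside \<Omega>.\<close>

definition borel_weak_grad :: "'a::euclidean_space set \<Rightarrow> ('a \<Rightarrow> real) \<Rightarrow> ('a \<Rightarrow> 'a) \<Rightarrow> bool" where
  "borel_weak_grad \<Omega> u D \<longleftrightarrow> D \<in> borel_measurable borel \<and>
    (\<forall>\<phi>. test_function \<Omega> \<phi> \<longrightarrow> (LINT x:\<Omega>|lebesgue. u x *\<^sub>R grad \<phi> x) = - (LINT x|lborel. \<phi> x *\<^sub>R D x))"

lemma has_weak_gradient_borel: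
  fixes u :: "'a::euclidean_space \<Rightarrow> real"
  assumes "has_weak_gradient \<Omega> u Du" "open \<Omega>"
    and "D \<in> borel_measurable borel" "AE x in lborel. indicator \<Omega> x *\<^sub>R Du x = D x"
  shows "borel_weak_grad \<Omega> u D"
  unfolding borel_weak_grad_def
proof (intro conjI allI impI)
  fix \<phi> assume t: "test_function \<Omega> \<phi>"
  have [measurable]: "\<phi> \<in> borel_measurable borel"
    using test_functionD(2)[OF t] by (rule borel_measurable_continuous_onI)
  then have m: "\<phi> \<in> borel_measurable lebesgue" by (auto intro: measurable_completion)
  have mD: "(\<lambda>x. indicator \<Omega> x *\<^sub>R Du x) \<in> borel_measurable lebesgue"
    using assms(1,2) Lp_loc_measurable by (auto simp: has_weak_gradient_def)
  have "(LINT x:\<Omega>|lebesgue. \<phi> x *\<^sub>R Du x) = (LINT x|lborel. \<phi> x *\<^sub>R D x)"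
    unfolding set_lebesgue_integral_def
  proof (rule integral_lebesgue_AE_borel)
    have "(\<lambda>x. \<phi> x *\<^sub>R indicator \<Omega> x *\<^sub>R Du x) \<in> borel_measurable lebesgue"
      using m mD by measurable
    then show "(\<lambda>x. indicator \<Omega> x *\<^sub>R \<phi> x *\<^sub>R Du x) \<in> borel_measurable lebesgue"
      by (simp add: mult.commute)
    show "(\<lambda>x. \<phi> x *\<^sub>R D x) \<in> borel_measurable borel" using assms(3) by measurable
    show "AE x in lborel. indicator \<Omega> x *\<^sub>R \<phi> x *\<^sub>R Du x = \<phi> x *\<^sub>R D x"
      using assms(4) by eventually_elim (metis scaleR_left_commute)
  qed
  then show "(LINT x:\<Omega>|lebesgue. u x *\<^sub>R grad \<phi> x) = - (LINT x|lborel. \<phi> x *\<^sub>R D x)"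
    using assms(1) t by (simp add: has_weak_gradient_def)
qed (rule assms(3))

lemma mollifier_test_function:
  assumes "mollifier e k" "cball x e \<subseteq> \<Omega>"
  shows "test_function \<Omega> (\<lambda>y. k (x - y))"
proof (rule test_functionI[OF _ compact_cball assms(2)])
  show "Ck j (\<lambda>y. k (x - y))" for j
    using Ck_affine[OF mollifierD(1)[OF assms(1)], of j x "-1"] by simp
  show "k (x - y) = 0" if "y \<notin> cball x e" for y
    using that by (intro mollifierD(3)[OF assms(1)]) (simp add: dist_norm)
qed

lemma grad_reflect:
  assumes "Ck (Suc j) k"
  shows "grad (\<lambda>y. k (x - y)) y = - grad k (x - y)"
proof (rule grad_eqI)
  have "((\<lambda>y. k (x - y)) has_derivative (\<lambda>h. grad k (x - y) \<bullet> (- h))) (at y)"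
    by (rule has_derivative_compose[OF _ has_derivative_grad[OF Ck_Suc_differentiable[OF assms]]])
      (auto intro!: derivative_eq_intros)
  then show "((\<lambda>y. k (x - y)) has_derivative (\<lambda>h. - grad k (x - y) \<bullet> h)) (at y)"
    by simp
qed

lemma integral_cbox_eq_lborel:
  fixes F :: "'a::euclidean_space \<Rightarrow> 'b::euclidean_space"
  assumes cF: "continuous_on UNIV F" and F0: "\<And>y. y \<notin> cball x e \<Longrightarrow> F y = 0"
    and sub: "cball x e \<subseteq> cbox a b"
  shows "integral (cbox a b) F = integral\<^sup>L lborel F"
proof -
  have iF: "integrable lborel F"
    by (rule integrable_compact_support[OF cF compact_cball F0])
  have "(F has_integral integral\<^sup>L lborel F) UNIV" by (rule has_integral_integral_lborel[OF iF])
  moreover have "(\<lambda>y. if y \<in> cbox a b then F y else 0) = F" using F0 sub by (intro ext) (metis subsetD)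
  ultimately have "(F has_integral integral\<^sup>L lborel F) (cbox a b)"
    using has_integral_restrict_UNIV[of "cbox a b" F "integral\<^sup>L lborel F"] by simp
  then show ?thesis by (rule integral_unique)
qed

lemma moll_eq_mconv:
  fixes w :: "'a::euclidean_space \<Rightarrow> real"
  assumes k: "mollifier e k" and w: "continuous_on UNIV w" and sub: "cball x e \<subseteq> cbox a b"
  shows "integral (cbox a b) (\<lambda>y. k (x - y) * w y) = mconv k w x"
    and "integrable lborel (\<lambda>y. k (x - y) *\<^sub>R w y)"
proof -
  have c: "continuous_on UNIV (\<lambda>y. k (x - y) *\<^sub>R w y)"
    by (intro continuous_on_scaleR w continuous_on_compose2[OF Ck_continuous[OF mollifierD(1)[OF k]]]
      continuous_intros) auto
  have z: "k (x - y) *\<^sub>R w y = 0" if "y \<notin> cball x e" for y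
    using that mollifierD(3)[OF k, of "x - y"] by (simp add: dist_norm)
  show "integral (cbox a b) (\<lambda>y. k (x - y) * w y) = mconv k w x"
    using integral_cbox_eq_lborel[OF c z sub] by (simp add: mconv_def)
  show "integrable lborel (\<lambda>y. k (x - y) *\<^sub>R w y)"
    by (rule integrable_compact_support[OF c compact_cball z])
qed

text \<open>The derivative falls on the kernel, y \<mapsto> k(x - y) is an admissible test function,
  and the weak gradient identity moves the derivative onto u. Only the values of w on the ball of
  radius e about x enter, so w needs to agree with u merely there.\<close>

lemma grad_moll_weak:
  fixes u w :: "'a::euclidean_space \<Rightarrow> real"
  assumes D: "borel_weak_grad \<Omega> u D" and k: "mollifier e k"
    and sub: "cball x e \<subseteq> \<Omega>" "cball x e \<subseteq> cbox a b"
    and w: "continuous_on UNIV w" "\<And>y. y \<in> cball x e \<Longrightarrow> w y = u y"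
  shows "grad (\<lambda>x. integral (cbox a b) (\<lambda>y. k (x - y) * w y)) x = mconv k D x"
proof -
  have S: "Ck (Suc 0) k" using mollifierD(1)[OF k] .
  have t: "test_function \<Omega> (\<lambda>y. k (x - y))" by (rule mollifier_test_function[OF k sub(1)])
  have off: "grad k (x - y) = 0" if "y \<notin> cball x e" for y
    using test_functionD(5)[OF mollifier_test_function[OF k order_refl], of y x] that
    by (simp add: grad_reflect[OF S])
  define F where "F = (\<lambda>y. w y *\<^sub>R grad k (x - y))"
  have F0: "F y = 0" if "y \<notin> cball x e" for y using off[OF that] by (simp add: F_def)
  have cF: "continuous_on UNIV F"
    unfolding F_def by (intro continuous_on_scaleR w(1) continuous_on_compose2[OF continuous_on_grad[OF S]] continuous_intros) auto
  have iF: "integrable lborel F"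
    by (rule integrable_compact_support[OF cF compact_cball F0])
  have "integral (cbox a b) F = integral\<^sup>L lborel F"
    by (rule integral_cbox_eq_lborel[OF cF F0 sub(2)])
  also have "\<dots> = integral\<^sup>L lebesgue F"
    using iF by (intro integral_completion[symmetric]) auto
  also have "\<dots> = - (LINT y:\<Omega>|lebesgue. u y *\<^sub>R grad (\<lambda>y. k (x - y)) y)"
  proof -
    have "indicator \<Omega> y *\<^sub>R u y *\<^sub>R grad (\<lambda>y. k (x - y)) y = - F y" for y
      using off[of y] sub(1) w(2)[of y] by (cases "y \<in> cball x e") (auto simp: F_def grad_reflect[OF S])
    then show ?thesis by (simp add: set_lebesgue_integral_def)
  qed
  also have "\<dots> = mconv k D x"
    using D t by (simp add: borel_weak_grad_def mconv_def)
  finally show ?thesis by (simp add: grad_moll[OF S w(1)] F_def)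
qed

section \<open>The fundamental lemma of the calculus of variations\<close>

lemma compact_fattening:
  fixes K :: "'a::euclidean_space set"
  assumes "compact K"
  shows "compact (\<Union>x\<in>K. cball x e)"
proof -
  have "(\<Union>x\<in>K. cball x e) = {x + y | x y. x \<in> K \<and> y \<in> cball 0 e}"
  proof (intro equalityI subsetI)
    fix z assume "z \<in> (\<Union>x\<in>K. cball x e)"
    then obtain x where "x \<in> K" "dist x z \<le> e" by auto
    then show "z \<in> {x + y | x y. x \<in> K \<and> y \<in> cball 0 e}"
      by (intro CollectI exI[of _ x] exI[of _ "z - x"]) (auto simp: dist_norm norm_minus_commute)
  next
    fix z assume "z \<in> {x + y | x y. x \<in> K \<and> y \<in> cball 0 e}"
    then obtain x y where "x \<in> K" "norm y \<le> e" "z = x + y" by auto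
    then show "z \<in> (\<Union>x\<in>K. cball x e)" by (intro UN_I[of x]) (auto simp: dist_norm)
  qed
  then show ?thesis using compact_sums[OF assms compact_cball[of 0 e]] by simp
qed

text \<open>Mollify h restricted to a compact neighbourhood K' of a compact K. On K the
  mollification is an integral of h against a test function, hence 0, while it is close to h in L^1;
  so the integral of |h| over K is below every \<delta>. An exhaustion of \<Omega> finishes the
  proof.\<close>

lemma weakly_zero_imp_AE_zero:
  fixes h :: "'a::euclidean_space \<Rightarrow> 'b::euclidean_space"
  assumes "open \<Omega>" and [measurable]: "h \<in> borel_measurable borel"
    and int: "\<And>K. compact K \<Longrightarrow> K \<subseteq> \<Omega> \<Longrightarrow> integrable lborel (\<lambda>x. indicator K x * norm (h x))"
    and zero: "\<And>\<phi>. test_function \<Omega> \<phi> \<Longrightarrow> (LINT x|lborel. \<phi> x *\<^sub>R h x) = 0"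
  shows "AE x in lborel. x \<in> \<Omega> \<longrightarrow> h x = 0"
proof -
  obtain C where C: "\<And>n. compact (C n)" "\<And>n. C n \<subseteq> \<Omega>" "\<And>n. C n \<subseteq> interior (C (Suc n))" "\<Union>(range C) = \<Omega>"
    "\<And>K. compact K \<Longrightarrow> K \<subseteq> \<Omega> \<Longrightarrow> \<exists>N. \<forall>n\<ge>N. K \<subseteq> C n"
    using open_Union_compact_subsets[OF assms(1)] by metis
  have "AE x in lborel. x \<in> K \<longrightarrow> h x = 0" if K: "compact K" "K \<subseteq> \<Omega>" for K
  proof -
    obtain \<epsilon> where \<epsilon>: "\<epsilon> > 0" "(\<Union>x\<in>K. cball x \<epsilon>) \<subseteq> \<Omega>"
      using compact_subset_open_imp_cball_epsilon_subset[OF K(1) \<open>open \<Omega>\<close> K(2)] by blast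
    define K' where "K' = (\<Union>x\<in>K. cball x \<epsilon>)"
    have K': "compact K'" "K' \<subseteq> \<Omega>" using compact_fattening[OF K(1)] \<epsilon> by (auto simp: K'_def)
    have [measurable]: "K \<in> sets borel" "K' \<in> sets borel" using K K' by (auto simp: borel_compact)
    define f where "f = (\<lambda>x. indicator K' x *\<^sub>R h x)"
    have f[measurable]: "f \<in> borel_measurable borel" unfolding f_def by measurable
    have nf: "norm (f x) = indicator K' x * norm (h x)" for x by (simp add: f_def)
    have fi: "integrable lborel (\<lambda>x. norm (f x) powr 1)" using int[OF K'] by (simp add: nf)
    obtain B where B: "\<And>x. x \<in> K' \<Longrightarrow> norm x \<le> B"
      using compact_imp_bounded[OF K'(1)] by (auto simp: bounded_iff)
    have supp: "f x = 0" if "norm x > B" for x using B[of x] that by (auto simp: f_def indicator_def)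
    have Ki: "integrable lborel (\<lambda>x. indicator K x * norm (h x))" by (rule int[OF K])
    have "(LINT x|lborel. indicator K x * norm (h x)) \<le> \<delta>" if \<delta>: "0 < \<delta>" for \<delta>
    proof -
      have "\<exists>d>0. \<forall>e k. 0 < e \<and> e < d \<and> mollifier e k \<longrightarrow>
          integrable lborel (\<lambda>x. norm (mconv k f x - f x) powr 1) \<and> (LINT x|lborel. norm (mconv k f x - f x) powr 1) < \<delta>"
        by (rule mconv_Lr[where B=B, OF f order_refl fi _ \<delta>]) (rule supp)
      then obtain d where d: "0 < d" "\<And>e k. 0 < e \<and> e < d \<and> mollifier e k \<longrightarrow>
          integrable lborel (\<lambda>x. norm (mconv k f x - f x) powr 1) \<and> (LINT x|lborel. norm (mconv k f x - f x) powr 1) < \<delta>"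
        by blast
      define e where "e = min (d / 2) \<epsilon>"
      have e: "0 < e" "e < d" "e \<le> \<epsilon>" using d(1) \<epsilon>(1) by (auto simp: e_def)
      obtain k :: "'a \<Rightarrow> real" where k: "mollifier e k" using ex_mollifier[OF e(1)] by blast
      have z: "mconv k f x = 0" if "x \<in> K" for x
      proof -
        have sub: "cball x e \<subseteq> K'" using that e(3) by (auto simp: K'_def)
        have "k (x - y) *\<^sub>R f y = k (x - y) *\<^sub>R h y" for y
          using sub mollifierD(3)[OF k, of "x - y"] by (cases "y \<in> cball x e") (auto simp: f_def dist_norm)
        then have "mconv k f x = (LINT y|lborel. k (x - y) *\<^sub>R h y)" by (simp only: mconv_def)
        also have "\<dots> = 0" using sub K'(2) by (intro zero mollifier_test_function[OF k]) auto
        finally show ?thesis .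
      qed
      have dk: "integrable lborel (\<lambda>x. norm (mconv k f x - f x))" "(LINT x|lborel. norm (mconv k f x - f x)) < \<delta>"
        using d(2)[of e k] e k by auto
      have "(LINT x|lborel. indicator K x * norm (h x)) \<le> (LINT x|lborel. norm (mconv k f x - f x))"
      proof (rule integral_mono[OF Ki dk(1)])
        fix x
        have "x \<in> K \<Longrightarrow> x \<in> K'" using \<epsilon>(1) by (auto simp: K'_def intro!: bexI[of _ x])
        then show "indicator K x * norm (h x) \<le> norm (mconv k f x - f x)"
          using z[of x] by (cases "x \<in> K") (auto simp: f_def)
      qed
      then show ?thesis using dk(2) by simp
    qed
    then have "(LINT x|lborel. indicator K x * norm (h x)) \<le> 0" by (rule field_le_epsilon[of _ 0, simplified])
    then have "(LINT x|lborel. indicator K x * norm (h x)) = 0"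
      by (intro antisym Bochner_Integration.integral_nonneg) auto
    then have "AE x in lborel. indicator K x * norm (h x) = 0"
      using integral_nonneg_eq_0_iff_AE[OF Ki] by auto
    then show ?thesis by eventually_elim (auto simp: indicator_def split: if_splits)
  qed
  then have "AE x in lborel. \<forall>n. x \<in> C n \<longrightarrow> h x = 0"
    using C(1,2) unfolding AE_all_countable by blast
  then show ?thesis by eventually_elim (use C(4) in blast)
qed

section \<open>The flux\<close>

lemma powr_mult_norm:
  fixes t r :: real
  assumes "0 \<le> t"
  shows "t powr (r - 1) * t = t powr r"
  using assms powr_mult_base[of t "r - 1"] by (simp add: mult.commute)

lemma flux_inner_self:
  "flux g m s v \<bullet> v = norm v powr m * g (norm v) + norm v powr s"
proof -
  have "norm v powr (r - 2) * (v \<bullet> v) = norm v powr r" for r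
  proof -
    have "norm v powr (r - 2) * (v \<bullet> v) = (norm v powr (r - 1 - 1) * norm v) * norm v"
      by (simp add: power2_norm_eq_inner[symmetric] power2_eq_square algebra_simps)
    then show ?thesis by (simp only: powr_mult_norm norm_ge_zero)
  qed
  from this[of m] this[of s] show ?thesis
    by (simp add: flux_def algebra_simps)
qed

lemma norm_flux:
  assumes "g (norm v) \<ge> 0"
  shows "norm (flux g m s v) = norm v powr (m - 1) * g (norm v) + norm v powr (s - 1)"
proof -
  have p: "norm v powr (r - 2) * norm v = norm v powr (r - 1)" for r
    using powr_mult_norm[of "norm v" "r - 1"] by simp
  have "norm (flux g m s v) = (norm v powr (m - 2) * g (norm v) + norm v powr (s - 2)) * norm v"
    using assms by (simp add: flux_def)
  also have "\<dots> = norm v powr (m - 1) * g (norm v) + norm v powr (s - 1)"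
    using p[of m] p[of s] by (metis distrib_right mult.assoc mult.commute)
  finally show ?thesis .
qed

lemma flux_borel:
  assumes "continuous_on {0..} g"
  shows "(flux g m s :: 'a::euclidean_space \<Rightarrow> 'a) \<in> borel_measurable borel"
proof -
  have "continuous_on UNIV (\<lambda>v::'a. g (norm v))"
    by (rule continuous_on_compose2[OF assms]) (auto intro!: continuous_intros)
  then have [measurable]: "(\<lambda>v::'a. g (norm v)) \<in> borel_measurable borel"
    by (rule borel_measurable_continuous_onI)
  show ?thesis unfolding flux_def[abs_def] by measurable
qed

text \<open>Young's inequality with explicit constants and no conjugate exponent: if \<kappa> \<le>
  t/2 the first term suffices, otherwise t < 2 \<kappa> and the second one does.\<close>

lemma powr_young:
  fixes t \<kappa> r :: real
  assumes "0 \<le> t" "0 \<le> \<kappa>" "1 < r"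
  shows "t powr (r - 1) * \<kappa> \<le> t powr r / 2 + 2 powr (r - 1) * \<kappa> powr r"
proof (cases "\<kappa> \<le> t / 2")
  case True
  have "t powr (r - 1) * \<kappa> \<le> t powr (r - 1) * (t / 2)" using True by (intro mult_left_mono) auto
  also have "\<dots> = t powr r / 2" using powr_mult_norm[OF assms(1), of r] by simp
  also have "\<dots> \<le> t powr r / 2 + 2 powr (r - 1) * \<kappa> powr r" by simp
  finally show ?thesis .
next
  case False
  have "t powr (r - 1) * \<kappa> \<le> (2 * \<kappa>) powr (r - 1) * \<kappa>"
    using False assms by (intro mult_right_mono powr_mono2) auto
  also have "\<dots> = 2 powr (r - 1) * \<kappa> powr r"
    using assms powr_mult_norm[OF assms(2), of r] by (simp add: powr_mult mult.assoc)
  also have "\<dots> \<le> t powr r / 2 + 2 powr (r - 1) * \<kappa> powr r" by simp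
  finally show ?thesis .
qed

text \<open>The weight g is kept in the first term, so that exactly half of the energy density
  appears for absorption, and is replaced by its bound G only in the remainder.\<close>

lemma flux_young:
  assumes g: "0 \<le> g (norm v)" "g (norm v) \<le> G" and "0 \<le> \<kappa>" "1 < s" "1 < m"
  shows "norm (flux g m s v) * \<kappa> \<le>
    (flux g m s v \<bullet> v) / 2 + G * 2 powr (m - 1) * \<kappa> powr m + 2 powr (s - 1) * \<kappa> powr s"
proof -
  have 1: "g (norm v) * (norm v powr (m - 1) * \<kappa>) \<le> g (norm v) * (norm v powr m / 2 + 2 powr (m - 1) * \<kappa> powr m)"
    using assms by (intro mult_left_mono powr_young) auto
  have 2: "g (norm v) * (2 powr (m - 1) * \<kappa> powr m) \<le> G * (2 powr (m - 1) * \<kappa> powr m)"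
    using assms by (intro mult_right_mono) auto
  have 3: "norm v powr (s - 1) * \<kappa> \<le> norm v powr s / 2 + 2 powr (s - 1) * \<kappa> powr s"
    using assms by (intro powr_young) auto
  show ?thesis unfolding norm_flux[of g v, OF g(1)] flux_inner_self
    using 1 2 3 by (simp add: algebra_simps add_divide_distrib)
qed

lemma flux_bound:
  assumes g: "0 \<le> g (norm v)" "g (norm v) \<le> G" and "1 < s" "s < m"
  shows "norm (flux g m s v) \<le> (G + 1) * (1 + norm v powr (m - 1))"
    and "norm (flux g m s v) * norm v \<le> (G + 1) * (1 + norm v powr m)"
proof -
  have G: "0 \<le> G" using g by linarith
  have p: "norm v powr a \<le> 1 + norm v powr b" if "0 < a" "a < b" for a b
  proof (cases "norm v \<le> 1")
    case True
    then have "norm v powr a \<le> 1" using that powr_mono2[of a "norm v" 1] by simp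
    then show ?thesis using powr_ge_zero[of "norm v" b] by linarith
  next
    case False
    then have "norm v powr a \<le> norm v powr b" using that by (intro powr_mono) auto
    then show ?thesis by simp
  qed
  have c: "norm v powr b * g (norm v) + norm v powr a \<le> (G + 1) * (1 + norm v powr b)"
    if "0 < a" "a < b" for a b
  proof -
    have "norm v powr b * g (norm v) \<le> norm v powr b * G"
      using g by (intro mult_left_mono) auto
    then have "norm v powr b * g (norm v) + norm v powr a \<le> norm v powr b * G + (1 + norm v powr b)"
      using p[OF that] by linarith
    also have "\<dots> \<le> (G + 1) * (1 + norm v powr b)" using G by (simp add: algebra_simps)
    finally show ?thesis .
  qed
  show "norm (flux g m s v) \<le> (G + 1) * (1 + norm v powr (m - 1))"
    unfolding norm_flux[of g v, OF g(1)] using assms by (intro c) auto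
  have "norm (flux g m s v) * norm v = norm v powr m * g (norm v) + norm v powr s"
    unfolding norm_flux[of g v, OF g(1)] using powr_mult_norm[of "norm v" m] powr_mult_norm[of "norm v" s]
    by (simp add: algebra_simps)
  also have "\<dots> \<le> (G + 1) * (1 + norm v powr m)" using assms by (intro c) auto
  finally show "norm (flux g m s v) * norm v \<le> (G + 1) * (1 + norm v powr m)" .
qed

lemma flux_0 [simp]: "flux g m s 0 = 0"
  by (simp add: flux_def)

lemma borel_weak_grad_unique:
  fixes u :: "'a::euclidean_space \<Rightarrow> real"
  assumes "open \<Omega>" and D: "borel_weak_grad \<Omega> u D" "borel_weak_grad \<Omega> u D'"
    and i: "\<And>K. compact K \<Longrightarrow> K \<subseteq> \<Omega> \<Longrightarrow> integrable lborel (\<lambda>x. indicator K x * norm (D x) powr 1)"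
    and i': "\<And>K. compact K \<Longrightarrow> K \<subseteq> \<Omega> \<Longrightarrow> integrable lborel (\<lambda>x. indicator K x * norm (D' x) powr 1)"
  shows "AE x in lborel. x \<in> \<Omega> \<longrightarrow> D x = D' x"
proof -
  have [measurable]: "D \<in> borel_measurable borel" "D' \<in> borel_measurable borel"
    using D by (auto simp: borel_weak_grad_def)
  have "AE x in lborel. x \<in> \<Omega> \<longrightarrow> D x - D' x = 0"
  proof (rule weakly_zero_imp_AE_zero[OF assms(1)])
    show "integrable lborel (\<lambda>x. indicator K x * norm (D x - D' x))" if K: "compact K" "K \<subseteq> \<Omega>" for K
    proof (rule integrable_dominated[OF Bochner_Integration.integrable_add[OF i[OF K] i'[OF K]]])
      have [measurable]: "K \<in> sets borel" using K by (simp add: borel_compact)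
      show "(\<lambda>x. indicator K x * norm (D x - D' x)) \<in> borel_measurable lborel" by measurable
      show "norm (indicator K x * norm (D x - D' x)) \<le> indicator K x * norm (D x) powr 1 + indicator K x * norm (D' x) powr 1" for x
        using norm_triangle_ineq4[of "D x" "D' x"] by (auto simp: indicator_def)
    qed
    fix \<phi> assume t: "test_function \<Omega> \<phi>"
    define K where "K = closure {x. \<phi> x \<noteq> 0}"
    have K: "compact K" "K \<subseteq> \<Omega>" using t by (auto simp: test_function_def K_def)
    have c: "continuous_on UNIV \<phi>" by (rule test_functionD(2)[OF t])
    then have [measurable]: "\<phi> \<in> borel_measurable borel" by (rule borel_measurable_continuous_onI)
    obtain B where B: "\<And>x. x \<in> K \<Longrightarrow> norm (\<phi> x) \<le> B"
      using compact_imp_bounded[OF compact_continuous_image[OF continuous_on_subset[OF c] K(1)]]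
      by (auto simp: bounded_iff)
    have int: "integrable lborel (\<lambda>x. \<phi> x *\<^sub>R E x)"
      if [measurable]: "E \<in> borel_measurable borel" and iE: "integrable lborel (\<lambda>x. indicator K x * norm (E x) powr 1)"
      for E :: "'a \<Rightarrow> 'a"
    proof (rule integrable_dominated[OF integrable_mult_right[OF iE, of B]])
      show "norm (\<phi> x *\<^sub>R E x) \<le> B * (indicator K x * norm (E x) powr 1)" for x
      proof (cases "x \<in> K")
        case True
        then show ?thesis using B[of x] by (auto intro!: mult_right_mono)
      next
        case False
        then have "\<phi> x = 0" using closure_subset[of "{x. \<phi> x \<noteq> 0}"] by (auto simp: K_def)
        then show ?thesis using False by simp
      qed
    qed measurable
    have "(LINT x|lborel. \<phi> x *\<^sub>R (D x - D' x)) = (LINT x|lborel. \<phi> x *\<^sub>R D x) - (LINT x|lborel. \<phi> x *\<^sub>R D' x)"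
      unfolding scaleR_diff_right
      by (intro Bochner_Integration.integral_diff int i[OF K] i'[OF K]) measurable
    also have "\<dots> = 0" using D t unfolding borel_weak_grad_def by (metis minus_minus right_minus_eq)
    finally show "(LINT x|lborel. \<phi> x *\<^sub>R (D x - D' x)) = 0" .
  qed measurable
  then show ?thesis by simp
qed

text \<open>A solution comes with two weak gradients: one in L^m_loc from the Sobolev condition and
  one in the inequality, known only to be locally integrable. Uniqueness merges them into a single
  Borel field. The right-hand side of the inequality is dropped here by its sign.\<close>

lemma positive_solution_borel:
  fixes u :: "'a::euclidean_space \<Rightarrow> real"
  assumes sol: "positive_solution g m s \<alpha> p q u" and cg: "continuous_on {0..} g"
  obtains D where "borel_weak_grad (- cball 0 1) u D"
    "\<And>K. compact K \<Longrightarrow> K \<subseteq> - cball 0 1 \<Longrightarrow> integrable lborel (\<lambda>x. indicator K x * norm (D x) powr m)"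
    "\<And>\<phi>. test_function (- cball 0 1) \<phi> \<Longrightarrow> (\<And>x. 0 \<le> \<phi> x) \<Longrightarrow>
       0 \<le> (LINT x|lborel. flux g m s (D x) \<bullet> grad \<phi> x)"
proof -
  let ?\<Omega> = "- cball 0 1 :: 'a set"
  have o: "open ?\<Omega>" by (simp add: open_Compl)
  note [measurable] = flux_borel[OF cg]
  obtain Du1 where W1: "has_weak_gradient ?\<Omega> u Du1"
    and ineq: "\<And>\<phi>. test_function ?\<Omega> \<phi> \<Longrightarrow> (\<And>x. \<phi> x \<ge> 0) \<Longrightarrow>
           (LINT x:(- ball 0 1)|lebesgue. flux g m s (Du1 x) \<bullet> grad \<phi> x)
             \<ge> (LINT x:(- ball 0 1)|lebesgue. riesz_conv \<alpha> p u x * u x powr q * \<phi> x)"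
    using sol unfolding positive_solution_def by blast
  obtain Du2 where W2: "has_weak_gradient ?\<Omega> u Du2" and L2: "Lp_loc ?\<Omega> m Du2"
    using sol unfolding positive_solution_def W1_loc_def by blast
  have L1: "Lp_loc ?\<Omega> 1 Du1" "Lp_loc ?\<Omega> 1 Du2" using W1 W2 by (auto simp: has_weak_gradient_def)
  obtain D1 where D1: "D1 \<in> borel_measurable borel" "AE x in lborel. indicator ?\<Omega> x *\<^sub>R Du1 x = D1 x"
    "\<And>K. compact K \<Longrightarrow> K \<subseteq> ?\<Omega> \<Longrightarrow> integrable lborel (\<lambda>x. indicator K x * norm (D1 x) powr 1)"
    using Lp_loc_borel_version[OF o L1(1)] by blast
  obtain D2 where D2: "D2 \<in> borel_measurable borel" "AE x in lborel. indicator ?\<Omega> x *\<^sub>R Du2 x = D2 x"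
    "\<And>K. compact K \<Longrightarrow> K \<subseteq> ?\<Omega> \<Longrightarrow> integrable lborel (\<lambda>x. indicator K x * norm (D2 x) powr m)"
    using Lp_loc_borel_version[OF o L2] by blast
  \<comment> \<open>A second Borel version of the same gradient, this time with local integrability
    in exponent 1, as uniqueness asks for; it agrees with \<open>D2\<close> almost
    everywhere.\<close>
  obtain D3 where D3: "D3 \<in> borel_measurable borel" "AE x in lborel. indicator ?\<Omega> x *\<^sub>R Du2 x = D3 x"
    "\<And>K. compact K \<Longrightarrow> K \<subseteq> ?\<Omega> \<Longrightarrow> integrable lborel (\<lambda>x. indicator K x * norm (D3 x) powr 1)"
    using Lp_loc_borel_version[OF o L1(2)] by blast
  have "AE x in lborel. x \<in> ?\<Omega> \<longrightarrow> D1 x = D3 x"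
    by (rule borel_weak_grad_unique[OF o has_weak_gradient_borel[OF W1 o D1(1,2)]
       has_weak_gradient_borel[OF W2 o D3(1,2)] D1(3) D3(3)])
  then have eq: "AE x in lborel. indicator ?\<Omega> x *\<^sub>R Du1 x = D2 x"
    using D1(2) D2(2) D3(2) by eventually_elim (auto simp: indicator_def split: if_splits)
  have "0 \<le> (LINT x|lborel. flux g m s (D2 x) \<bullet> grad \<phi> x)"
    if t: "test_function ?\<Omega> \<phi>" and nn: "\<And>x. 0 \<le> \<phi> x" for \<phi>
  proof -
    have [measurable]: "grad \<phi> \<in> borel_measurable borel" "D2 \<in> borel_measurable borel"
      using test_functionD(3)[OF t] D2(1) by (auto intro: borel_measurable_continuous_onI)
    \<comment> \<open>This holds at every x, convergent or not, since a divergent Bochner integral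
      has the value 0.\<close>
    have "0 \<le> riesz_conv \<alpha> p u x" for x
      unfolding riesz_conv_def set_lebesgue_integral_def by (intro Bochner_Integration.integral_nonneg) auto
    then have "0 \<le> (LINT x:(- ball 0 1)|lebesgue. riesz_conv \<alpha> p u x * u x powr q * \<phi> x)"
      unfolding set_lebesgue_integral_def using nn by (intro Bochner_Integration.integral_nonneg) auto
    also have "\<dots> \<le> (LINT x:(- ball 0 1)|lebesgue. flux g m s (Du1 x) \<bullet> grad \<phi> x)"
      by (rule ineq[OF t nn])
    also have "\<dots> = (LINT x|lebesgue. flux g m s (indicator ?\<Omega> x *\<^sub>R Du1 x) \<bullet> grad \<phi> x)"
    proof -
      have "indicator (- ball 0 1) x *\<^sub>R (flux g m s (Du1 x) \<bullet> grad \<phi> x) =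
          flux g m s (indicator ?\<Omega> x *\<^sub>R Du1 x) \<bullet> grad \<phi> x" for x
        using test_functionD(5)[OF t, of x] by (cases "x \<in> ?\<Omega>") auto
      then show ?thesis by (simp only: set_lebesgue_integral_def)
    qed
    also have "\<dots> = (LINT x|lborel. flux g m s (D2 x) \<bullet> grad \<phi> x)"
    proof (rule integral_lebesgue_AE_borel)
      have "(\<lambda>x. flux g m s (indicator ?\<Omega> x *\<^sub>R Du1 x)) \<in> borel_measurable lebesgue"
        using measurable_compose[OF Lp_loc_measurable[OF o L1(1)] flux_borel[OF cg]] .
      moreover have "grad \<phi> \<in> borel_measurable lebesgue" by (auto intro: measurable_completion)
      ultimately show "(\<lambda>x. flux g m s (indicator ?\<Omega> x *\<^sub>R Du1 x) \<bullet> grad \<phi> x) \<in> borel_measurable lebesgue"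
        by (rule borel_measurable_inner)
      show "(\<lambda>x. flux g m s (D2 x) \<bullet> grad \<phi> x) \<in> borel_measurable borel" by measurable
      show "AE x in lborel. flux g m s (indicator ?\<Omega> x *\<^sub>R Du1 x) \<bullet> grad \<phi> x = flux g m s (D2 x) \<bullet> grad \<phi> x"
        using eq by eventually_elim simp
    qed
    finally show ?thesis .
  qed
  then show ?thesis
    using that[OF has_weak_gradient_borel[OF W2 o D2(1,2)] D2(3)] by blast
qed

section \<open>Truncation of a supersolution below its minimum on a sphere\<close>

text \<open>The convolution has disappeared: what remains is a positive supersolution with a Borel
  gradient in L^m_loc. G stands for an upper bound of g.\<close>

locale exterior_supersolution =
  fixes g :: "real \<Rightarrow> real" and m s G :: real and u :: "'a::euclidean_space \<Rightarrow> real" and D :: "'a \<Rightarrow> 'a"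
  assumes s1: "1 < s" and sm: "s < m" and sN: "real DIM('a) \<le> s"
    and g_pos: "\<And>t. 0 \<le> t \<Longrightarrow> 0 < g t" and g_le: "\<And>t. 0 \<le> t \<Longrightarrow> g t \<le> G"
    and g_cont: "continuous_on {0..} g"
    and u_cont: "continuous_on (- cball 0 1) u" and u_pos: "\<And>x. x \<in> - cball 0 1 \<Longrightarrow> 0 < u x"
    and D_grad: "borel_weak_grad (- cball 0 1) u D"
    and D_int: "\<And>K. compact K \<Longrightarrow> K \<subseteq> - cball 0 1 \<Longrightarrow> integrable lborel (\<lambda>x. indicator K x * norm (D x) powr m)"
    and super: "\<And>\<phi>. test_function (- cball 0 1) \<phi> \<Longrightarrow> (\<And>x. 0 \<le> \<phi> x) \<Longrightarrow>
       0 \<le> (LINT x|lborel. flux g m s (D x) \<bullet> grad \<phi> x)"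
begin

lemma D_borel[measurable]: "D \<in> borel_measurable borel"
  using D_grad by (simp add: borel_weak_grad_def)

lemma flux_borel'[measurable]: "flux g m s \<in> borel_measurable borel"
  by (rule flux_borel[OF g_cont])

definition M :: real where "M = Inf (u ` sphere 0 2)"

lemma M: "0 < M" "norm x = 2 \<Longrightarrow> M \<le> u x"
proof -
  have c: "compact (u ` sphere 0 2)"
    by (intro compact_continuous_image continuous_on_subset[OF u_cont]) auto
  have ne: "u ` sphere 0 2 \<noteq> {}" by simp
  have "M \<in> u ` sphere 0 2"
    unfolding M_def using c ne
    by (intro closed_contains_Inf compact_imp_closed bounded_imp_bdd_below compact_imp_bounded)
  then show "0 < M" using u_pos by auto
  show "M \<le> u x" if "norm x = 2"
    unfolding M_def using c that
    by (intro cInf_lower bounded_imp_bdd_below compact_imp_bounded) auto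
qed

definition w :: "'a \<Rightarrow> real" where "w x = (if norm x \<le> 2 then M else min (u x) M)"

text \<open>The two branches meet on the sphere of radius 2, where u \<ge> M makes the truncation
  equal to M.\<close>

lemma continuous_w: "continuous_on UNIV w"
proof -
  have "continuous_on (cball 0 2 \<union> {x. 2 \<le> norm x}) (\<lambda>x. if norm x \<le> 2 then M else min (u x) M)"
  proof (rule continuous_on_cases)
    show "closed {x::'a. 2 \<le> norm x}" by (intro closed_Collect_le continuous_intros)
    show "continuous_on {x. 2 \<le> norm x} (\<lambda>x. min (u x) M)"
      by (intro continuous_intros continuous_on_subset[OF u_cont]) auto
    show "\<forall>x. x \<in> cball 0 2 \<and> \<not> norm x \<le> 2 \<or> x \<in> {x. 2 \<le> norm x} \<and> norm x \<le> 2 \<longrightarrow> M = min (u x) M"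
      using M(2) by (auto simp: min_def intro!: antisym)
  qed auto
  moreover have "cball 0 2 \<union> {x. 2 \<le> norm x} = (UNIV :: 'a set)" by auto
  ultimately show ?thesis by (simp add: w_def[abs_def])
qed

lemma w_less_M: "w x < M \<Longrightarrow> 2 < norm x \<and> w x = u x"
  by (auto simp: w_def min_def split: if_splits)

lemma w_pos: "0 < w x"
  using M(1) u_pos[of x] by (auto simp: w_def min_def)

text \<open>The outer radius exceeds R by 1 to leave room for mollification radii up to 1 about
  points of \<open>cball 0 R\<close>.\<close>

definition K :: "real \<Rightarrow> 'a set" where "K R = {x. 2 \<le> norm x \<and> norm x \<le> R + 1}"

lemma K: "compact (K R)" "K R \<subseteq> - cball 0 1"
proof -
  have "K R = {x. 2 \<le> norm x} \<inter> cball 0 (R + 1)" by (auto simp: K_def)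
  moreover have "closed {x::'a. 2 \<le> norm x}" by (intro closed_Collect_le continuous_intros)
  ultimately show "compact (K R)" by (simp add: closed_Int_compact)
qed (auto simp: K_def)

lemma K_borel[measurable]: "K R \<in> sets borel"
  by (rule borel_compact[OF K(1)])

text \<open>D is only locally in L^m of the exterior domain; cut off to the shell it lies in L^m of
  the whole space and can be mollified.\<close>

definition f :: "real \<Rightarrow> 'a \<Rightarrow> 'a" where "f R x = indicator (K R) x *\<^sub>R D x"

lemma f_borel[measurable]: "f R \<in> borel_measurable borel"
  unfolding f_def[abs_def] by measurable

lemma norm_f_powr: "norm (f R x) powr m = indicator (K R) x * norm (D x) powr m"
  using s1 sm by (simp add: f_def indicator_def)

lemma f_int: "integrable lborel (\<lambda>x. norm (f R x) powr m)"
  unfolding norm_f_powr by (rule D_int[OF K])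

lemma K_int: "integrable lborel (indicator (K R) :: 'a \<Rightarrow> real)"
  by (intro integrable_indicator_bounded compact_imp_bounded[OF K(1)]) simp

text \<open>A single mollifier gives all properties. The gradient identity is claimed only where w
  is below M by a margin; the clause on vanishing gradients says that mollification does not spread
  the gradient into regions whose neighbourhood carries none, and is used to show that a vanishing
  gradient forces a lower bound.\<close>

lemma approx:
  assumes "0 < \<eta>" "\<eta> < M" "0 < \<delta>" "0 \<le> R"
  shows "\<exists>k W. (\<forall>j. Ck j W) \<and> mconv k (f R) \<in> borel_measurable borel \<and>
    (\<forall>x\<in>cball 0 R. \<bar>W x - w x\<bar> \<le> \<eta>) \<and>
    (\<forall>x\<in>cball 0 R. w x \<le> M - \<eta> \<longrightarrow> grad W x = mconv k (f R) x) \<and>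
    (\<forall>x\<in>cball 0 R. (AE y in lborel. w y < w x + \<eta> \<longrightarrow> f R y = 0) \<longrightarrow> mconv k (f R) x = 0) \<and>
    integrable lborel (\<lambda>x. norm (mconv k (f R) x - f R x) powr m) \<and>
    (LINT x|lborel. norm (mconv k (f R) x - f R x) powr m) < \<delta>"
proof -
  have m1: "1 \<le> m" using s1 sm by simp
  have supp: "f R x = 0" if "norm x > R + 1" for x using that by (simp add: f_def K_def)
  have "\<exists>d>0. \<forall>e k. 0 < e \<and> e < d \<and> mollifier e k \<longrightarrow>
    integrable lborel (\<lambda>x. norm (mconv k (f R) x - f R x) powr m) \<and>
    (LINT x|lborel. norm (mconv k (f R) x - f R x) powr m) < \<delta>"
    by (rule mconv_Lr[where B="R + 1", OF f_borel m1 f_int _ assms(3)]) (rule supp)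
  then obtain d1 where d1: "0 < d1" "\<And>e k. 0 < e \<and> e < d1 \<and> mollifier e k \<Longrightarrow>
    integrable lborel (\<lambda>x. norm (mconv k (f R) x - f R x) powr m) \<and>
    (LINT x|lborel. norm (mconv k (f R) x - f R x) powr m) < \<delta>" by blast
  have "uniformly_continuous_on (cball 0 (R + 1)) w"
    by (rule compact_uniformly_continuous[OF continuous_on_subset[OF continuous_w]]) auto
  then obtain d2 where d2: "0 < d2" "\<And>x y. x \<in> cball 0 (R + 1) \<Longrightarrow> y \<in> cball 0 (R + 1) \<Longrightarrow> dist y x < d2 \<Longrightarrow> dist (w y) (w x) < \<eta>"
    unfolding uniformly_continuous_on_def using assms(1) by metis
  \<comment> \<open>The minimum meets the L^m threshold, the modulus of continuity of w and the room
    of 1 in the shell.\<close>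
  define e where "e = min (min (d1 / 2) (d2 / 2)) 1"
  have e: "0 < e" "e < d1" "e < d2" "e \<le> 1" using d1(1) d2(1) by (auto simp: e_def)
  obtain k :: "'a \<Rightarrow> real" where k: "mollifier e k" using ex_mollifier[OF e(1)] by blast
  obtain a :: 'a where a: "cball 0 (R + 1) \<subseteq> cbox (- a) a"
    using bounded_subset_cbox_symmetric[OF bounded_cball] by blast
  define W where "W = (\<lambda>x. integral (cbox (- a) a) (\<lambda>y. k (x - y) * w y))"
  have sub: "cball x e \<subseteq> cball 0 (R + 1)" if "x \<in> cball 0 R" for x :: 'a
  proof
    fix y assume "y \<in> cball x e"
    then have "norm y \<le> norm x + e" using norm_triangle_sub[of y x] by (simp add: dist_norm norm_minus_commute)
    then show "y \<in> cball 0 (R + 1)" using that e(4) by simp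
  qed
  have near: "\<bar>w y - w x\<bar> < \<eta>" if "x \<in> cball 0 R" "y \<in> cball x e" for x y
    using d2(2)[of x y] sub[OF that(1)] that e by (auto simp: dist_norm norm_minus_commute)
  have Wnear: "\<bar>W x - w x\<bar> \<le> \<eta>" if x: "x \<in> cball 0 R" for x
  proof -
    note E = moll_eq_mconv[OF k continuous_w order_trans[OF sub[OF x] a]]
    have "norm (mconv k w x - w x) \<le> \<eta>"
      by (rule mconv_near[OF k E(2)]) (use near[OF x] in \<open>auto simp: dist_norm intro: less_imp_le\<close>)
    then show ?thesis by (simp add: W_def E(1))
  qed
  \<comment> \<open>On the ball of radius e the values of w stay below M, and points with w < M lie
    outside radius 2 and satisfy w = u.\<close>
  have inK: "cball x e \<subseteq> K R \<and> (\<forall>y\<in>cball x e. w y = u y)" if x: "x \<in> cball 0 R" "w x \<le> M - \<eta>" for x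
  proof -
    have "w y < M" if "y \<in> cball x e" for y using near[OF x(1) that] x(2) by linarith
    then show ?thesis using w_less_M sub[OF x(1)] by (fastforce simp: K_def)
  qed
  have gr: "grad W x = mconv k (f R) x" if x: "x \<in> cball 0 R" "w x \<le> M - \<eta>" for x
  proof -
    note I = inK[OF x]
    have "grad W x = mconv k D x" unfolding W_def
      by (rule grad_moll_weak[OF D_grad k _ order_trans[OF sub[OF x(1)] a] continuous_w])
        (use I K(2)[of R] in auto)
    also have "\<dots> = mconv k (f R) x"
    proof -
      have "k (x - y) *\<^sub>R D y = k (x - y) *\<^sub>R f R y" for y
        using I mollifierD(3)[OF k, of "x - y"] by (cases "y \<in> cball x e") (auto simp: f_def dist_norm)
      then show ?thesis by (simp only: mconv_def)
    qed
    finally show ?thesis .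
  qed
  have z: "mconv k (f R) x = 0" if x: "x \<in> cball 0 R" and ae: "AE y in lborel. w y < w x + \<eta> \<longrightarrow> f R y = 0" for x
  proof -
    have "AE y in lborel. k (x - y) *\<^sub>R f R y = 0"
      using ae
    proof eventually_elim
      case (elim y)
      show ?case
      proof (cases "y \<in> cball x e")
        case True
        then show ?thesis using near[OF x True] elim by auto
      qed (use mollifierD(3)[OF k, of "x - y"] in \<open>simp add: dist_norm\<close>)
    qed
    then show ?thesis unfolding mconv_def by (rule integral_eq_zero_AE)
  qed
  have "\<forall>j. Ck j W" unfolding W_def by (intro allI Ck_moll mollifierD(1)[OF k] continuous_w)
  moreover have "mconv k (f R) \<in> borel_measurable borel" by (rule mconv_borel[OF k f_borel])
  ultimately show ?thesis using Wnear gr z d1(2)[of e k] e k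
    by (intro exI[of _ k] exI[of _ W]) blast
qed

text \<open>The tolerance \<eta> / (n + 1) tends to 0 but never exceeds \<eta>, so the gradient and
  vanishing clauses hold for all n with the fixed margin \<eta>.\<close>

definition approximates :: "real \<Rightarrow> real \<Rightarrow> (nat \<Rightarrow> 'a \<Rightarrow> real) \<Rightarrow> (nat \<Rightarrow> 'a \<Rightarrow> 'a) \<Rightarrow> bool" where
  "approximates \<eta> R W h \<longleftrightarrow>
    (\<forall>n. (\<forall>j. Ck j (W n)) \<and> h n \<in> borel_measurable borel \<and>
      (\<forall>x\<in>cball 0 R. \<bar>W n x - w x\<bar> \<le> \<eta> / real (Suc n)) \<and>
      (\<forall>x\<in>cball 0 R. w x \<le> M - \<eta> / real (Suc n) \<longrightarrow> grad (W n) x = h n x) \<and>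
      (\<forall>x\<in>cball 0 R. (AE y in lborel. w y < w x + \<eta> / real (Suc n) \<longrightarrow> f R y = 0) \<longrightarrow> h n x = 0) \<and>
      integrable lborel (\<lambda>x. norm (h n x - f R x) powr m) \<and>
      (LINT x|lborel. norm (h n x - f R x) powr m) < 1 / real (Suc n))"

lemma ex_approximates:
  assumes "0 < \<eta>" "\<eta> < M" "0 \<le> R"
  shows "\<exists>W h. approximates \<eta> R W h"
proof -
  have "\<exists>W h. (\<forall>j. Ck j W) \<and> h \<in> borel_measurable borel \<and>
    (\<forall>x\<in>cball 0 R. \<bar>W x - w x\<bar> \<le> \<eta> / real (Suc n)) \<and>
    (\<forall>x\<in>cball 0 R. w x \<le> M - \<eta> / real (Suc n) \<longrightarrow> grad W x = h x) \<and>
    (\<forall>x\<in>cball 0 R. (AE y in lborel. w y < w x + \<eta> / real (Suc n) \<longrightarrow> f R y = 0) \<longrightarrow> h x = 0) \<and>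
    integrable lborel (\<lambda>x. norm (h x - f R x) powr m) \<and>
    (LINT x|lborel. norm (h x - f R x) powr m) < 1 / real (Suc n)" (is "\<exists>W h. ?P n W h") for n
  proof -
    have "\<eta> / real (Suc n) \<le> \<eta>" using assms(1) by (simp add: field_simps)
    then have "0 < \<eta> / real (Suc n)" "\<eta> / real (Suc n) < M" "0 < 1 / real (Suc n)"
      using assms by auto
    from approx[OF this assms(3)] obtain k W where "?P n W (mconv k (f R))" by (elim exE)
    then show ?thesis by (intro exI)
  qed
  then have "\<forall>n. \<exists>W h. ?P n W h" by (rule allI)
  from choice[OF this] obtain W where "\<forall>n. \<exists>h. ?P n (W n) h" by (elim exE)
  from choice[OF this] obtain h where "\<forall>n. ?P n (W n) (h n)" by (elim exE)
  then show ?thesis unfolding approximates_def by (intro exI)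
qed

lemma approximatesD:
  assumes "approximates \<eta> R W h" "0 < \<eta>"
  shows "Ck j (W n)" "h n \<in> borel_measurable borel"
    "norm x \<le> R \<Longrightarrow> \<bar>W n x - w x\<bar> \<le> \<eta> / real (Suc n)"
    "norm x \<le> R \<Longrightarrow> \<bar>W n x - w x\<bar> \<le> \<eta>"
    "norm x \<le> R \<Longrightarrow> (\<lambda>n. W n x) \<longlonglongrightarrow> w x"
    "norm x \<le> R \<Longrightarrow> w x \<le> M - \<eta> \<Longrightarrow> grad (W n) x = h n x"
    "norm x \<le> R \<Longrightarrow> AE y in lborel. w y < w x + \<eta> \<longrightarrow> f R y = 0 \<Longrightarrow> h n x = 0"
    "integrable lborel (\<lambda>x. norm (h n x - f R x) powr m)"
    "(\<lambda>n. LINT x|lborel. norm (h n x - f R x) powr m) \<longlonglongrightarrow> 0"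
proof -
  note P = assms(1)[unfolded approximates_def, THEN spec]
  have le: "\<eta> / real (Suc n) \<le> \<eta>" for n using assms(2) by (simp add: field_simps)
  show "Ck j (W n)" "h n \<in> borel_measurable borel" "integrable lborel (\<lambda>x. norm (h n x - f R x) powr m)"
    using P by blast+
  show W: "norm x \<le> R \<Longrightarrow> \<bar>W n x - w x\<bar> \<le> \<eta> / real (Suc n)" for n using P[of n] by auto
  show "norm x \<le> R \<Longrightarrow> \<bar>W n x - w x\<bar> \<le> \<eta>" using W[of n] le[of n] by linarith
  show "norm x \<le> R \<Longrightarrow> w x \<le> M - \<eta> \<Longrightarrow> grad (W n) x = h n x" using P[of n] le[of n] by auto
  show "h n x = 0" if "norm x \<le> R" and ae: "AE y in lborel. w y < w x + \<eta> \<longrightarrow> f R y = 0"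
  proof -
    have "AE y in lborel. w y < w x + \<eta> / real (Suc n) \<longrightarrow> f R y = 0"
      using ae by eventually_elim (use le[of n] in auto)
    then show ?thesis using P[of n] that by auto
  qed
  show "(\<lambda>n. LINT x|lborel. norm (h n x - f R x) powr m) \<longlonglongrightarrow> 0"
  proof (rule tendsto_sandwich[OF always_eventually always_eventually tendsto_const])
    show "(\<lambda>n. 1 / real (Suc n)) \<longlonglongrightarrow> 0"
      using LIMSEQ_inverse_real_of_nat by (simp add: inverse_eq_divide)
    show "\<forall>n. (LINT x|lborel. norm (h n x - f R x) powr m) \<le> 1 / real (Suc n)"
      using P by (blast intro: less_imp_le)
    show "\<forall>n. 0 \<le> (LINT x|lborel. norm (h n x - f R x) powr m)"
      by (auto intro: Bochner_Integration.integral_nonneg)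
  qed
  show "(\<lambda>n. W n x) \<longlonglongrightarrow> w x" if x: "norm x \<le> R"
  proof (rule LIM_zero_cancel, rule Lim_null_comparison)
    show "\<forall>\<^sub>F n in sequentially. norm (W n x - w x) \<le> \<eta> / real (Suc n)"
      using W[OF x] by simp
    show "(\<lambda>n. \<eta> / real (Suc n)) \<longlonglongrightarrow> 0"
      using tendsto_mult[OF tendsto_const LIMSEQ_inverse_real_of_nat, of \<eta>] by (simp add: divide_inverse)
  qed
qed

text \<open>The function flat (M/4 - W n) has zero derivative on a ball about the origin: either W n
  \<ge> M/4 and flat' vanishes, or w is so small nearby that the mollified gradient vanishes. It is
  therefore constant, and 0 at the origin, where w = M. Filling the hole with the constant M is what
  makes the domain convex, hence connected even in dimension one.\<close>

lemma level_lower_bound: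
  assumes ae: "AE x in lborel. w x < M / 2 \<longrightarrow> D x = 0"
  shows "M / 4 \<le> w x"
proof -
  define R where "R = norm x + 1"
  have R: "0 \<le> R" "norm x < R" "0 < R" by (auto simp: R_def add_nonneg_pos)
  \<comment> \<open>W n < M/4 gives w < M/4 + \<eta>, and a further \<eta> of room must stay within
    the level M/2.\<close>
  define \<eta> where "\<eta> = M / 8"
  have \<eta>: "0 < \<eta>" "\<eta> < M" using M(1) by (auto simp: \<eta>_def)
  obtain W h where app: "approximates \<eta> R W h" using ex_approximates[OF \<eta> R(1)] by (elim exE)
  note W = approximatesD[OF app \<eta>(1)]
  have lower: "M / 4 \<le> W n x" for n
  proof -
    let ?F = "\<lambda>y. flat (M / 4 - W n y)"
    have "(?F has_derivative (\<lambda>h. 0)) (at y within ball 0 R)" if y: "y \<in> ball 0 R" for y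
    proof -
      have dW: "(W n has_derivative (\<lambda>h. grad (W n) y \<bullet> h)) (at y)"
        by (rule has_derivative_grad[OF Ck_Suc_differentiable[OF W(1)[of "Suc 0"]]])
      then have "((\<lambda>y. M / 4 - W n y) has_derivative (\<lambda>h. 0 - grad (W n) y \<bullet> h)) (at y)"
        by (intro has_derivative_diff has_derivative_const)
      from has_derivative_compose[OF this flat_has_derivative[unfolded has_field_derivative_def]]
      have d: "(?F has_derivative (\<lambda>h. flat' (M / 4 - W n y) * (0 - grad (W n) y \<bullet> h))) (at y)" .
      have "flat' (M / 4 - W n y) * (0 - grad (W n) y \<bullet> h) = 0" for h
      proof (cases "W n y < M / 4")
        case True
        have "norm y \<le> R" using y by simp
        then have "w y \<le> M / 4 + \<eta>" using True W(4)[of y n] by linarith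
        then have b: "w y + \<eta> \<le> M / 2" "w y \<le> M - \<eta>" using M(1) by (auto simp: \<eta>_def)
        have "AE z in lborel. w z < w y + \<eta> \<longrightarrow> f R z = 0"
          using ae by eventually_elim (use b in \<open>auto simp: f_def\<close>)
        then show ?thesis using W(6,7)[of y n] \<open>norm y \<le> R\<close> b by simp
      qed (simp add: flat'_def)
      then have "(\<lambda>h. flat' (M / 4 - W n y) * (0 - grad (W n) y \<bullet> h)) = (\<lambda>h. 0)" by auto
      with d show ?thesis by (auto intro: has_derivative_at_withinI)
    qed
    then obtain c where c: "\<And>y. y \<in> ball 0 R \<Longrightarrow> ?F y = c"
      using has_derivative_zero_constant[of "ball 0 R" ?F] by auto
    have "\<bar>W n 0 - M\<bar> \<le> M / 8" using W(4)[of 0 n] R(1) by (simp add: w_def \<eta>_def)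
    then have "M / 4 \<le> W n 0" using M(1) by linarith
    then have "?F 0 = 0" by (simp add: flat_def)
    moreover have "?F x = ?F 0" using c[of x] c[of 0] R by simp
    ultimately show ?thesis by (auto simp: flat_def split: if_splits)
  qed
  have "(\<lambda>n. W n x) \<longlonglongrightarrow> w x" using W(5) R(2) by simp
  then show ?thesis by (rule LIMSEQ_le_const) (use lower in auto)
qed


section \<open>Passage to the limit in the weak inequality\<close>

abbreviation A :: "'a \<Rightarrow> 'a" where "A \<equiv> flux g m s"

lemma A_bound:
  "norm (A v) \<le> (G + 1) * (1 + norm v powr (m - 1))" "norm (A v) * norm v \<le> (G + 1) * (1 + norm v powr m)"
  using flux_bound[of g v G s m] g_pos[of "norm v"] g_le[of "norm v"] s1 sm by auto

lemma G_nonneg: "0 \<le> G"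
  using g_pos[of 0] g_le[of 0] by linarith

lemma A_f_int:
  "integrable lborel (\<lambda>x. norm (A (f R x)) * norm (f R x))" "integrable lborel (\<lambda>x. norm (A (f R x)))"
proof -
  have I: "integrable lborel (\<lambda>x. (G + 1) * (2 * indicator (K R) x + norm (f R x) powr m))"
    using K_int f_int by simp
  have supp: "x \<notin> K R \<Longrightarrow> f R x = 0" for x by (simp add: f_def)
  show "integrable lborel (\<lambda>x. norm (A (f R x)) * norm (f R x))"
  proof (rule integrable_dominated[OF I])
    fix x
    show "norm (norm (A (f R x)) * norm (f R x)) \<le> (G + 1) * (2 * indicator (K R) x + norm (f R x) powr m)"
    proof (cases "x \<in> K R")
      case True
      have "norm (A (f R x)) * norm (f R x) \<le> (G + 1) * (1 + norm (f R x) powr m)" by (rule A_bound)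
      also have "\<dots> \<le> (G + 1) * (2 * indicator (K R) x + norm (f R x) powr m)"
        using G_nonneg True by (intro mult_left_mono) auto
      finally show ?thesis by simp
    qed (use supp G_nonneg in auto)
  qed measurable
  show "integrable lborel (\<lambda>x. norm (A (f R x)))"
  proof (rule integrable_dominated[OF I])
    fix x
    show "norm (norm (A (f R x))) \<le> (G + 1) * (2 * indicator (K R) x + norm (f R x) powr m)"
    proof (cases "x \<in> K R")
      case True
      have p: "norm v powr (m - 1) \<le> 1 + norm v powr m" for v :: 'a
      proof (cases "norm v \<le> 1")
        case True
        then have "norm v powr (m - 1) \<le> 1" using s1 sm powr_mono2[of "m - 1" "norm v" 1] by simp
        then show ?thesis using powr_ge_zero[of "norm v" m] by linarith
      next
        case False
        then have "norm v powr (m - 1) \<le> norm v powr m" by (intro powr_mono) auto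
        then show ?thesis by simp
      qed
      have "norm (A (f R x)) \<le> (G + 1) * (1 + norm (f R x) powr (m - 1))" by (rule A_bound)
      also have "\<dots> \<le> (G + 1) * (2 * indicator (K R) x + norm (f R x) powr m)"
        using G_nonneg True p[of "f R x"] by (intro mult_left_mono) auto
      finally show ?thesis by simp
    qed (use supp G_nonneg in auto)
  qed measurable
qed

text \<open>Young's inequality with a free parameter, by the case distinction d \<le> \<delta> t; it
  takes the place of Hoelder's inequality below.\<close>

lemma powr_split:
  fixes t d \<delta> :: real
  assumes "0 \<le> t" "0 \<le> d" "0 < \<delta>"
  shows "t powr (m - 1) * d \<le> \<delta> * t powr m + \<delta> powr (1 - m) * d powr m"
proof (cases "d \<le> \<delta> * t")
  case True
  have "t powr (m - 1) * d \<le> t powr (m - 1) * (\<delta> * t)" using True by (intro mult_left_mono) auto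
  also have "\<dots> = \<delta> * t powr m" using powr_mult_norm[OF assms(1), of m] by (simp add: algebra_simps)
  also have "\<dots> \<le> \<delta> * t powr m + \<delta> powr (1 - m) * d powr m" by simp
  finally show ?thesis .
next
  case False
  have "t \<le> d / \<delta>" using False assms(3) by (simp add: field_simps)
  then have "t powr (m - 1) * d \<le> (d / \<delta>) powr (m - 1) * d"
    using assms s1 sm by (intro mult_right_mono powr_mono2) auto
  also have "\<dots> = \<delta> powr (1 - m) * d powr m"
  proof -
    have "(d / \<delta>) powr (m - 1) = d powr (m - 1) * \<delta> powr (1 - m)"
      using assms by (simp add: powr_divide powr_diff powr_minus field_simps)
    then show ?thesis using powr_mult_norm[OF assms(2), of m] by (simp add: algebra_simps)
  qed
  also have "\<dots> \<le> \<delta> * t powr m + \<delta> powr (1 - m) * d powr m" using assms by simp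
  finally show ?thesis .
qed

text \<open>For each \<delta> the integral is at most \<delta> times a fixed finite quantity plus a
  constant depending on \<delta> times the integral of |d n|^m. The latter tends to 0 for fixed
  \<delta>, and \<delta> is arbitrary.\<close>

lemma A_times_small:
  assumes d[measurable]: "\<And>n. d n \<in> borel_measurable borel"
    and i: "\<And>n. integrable lborel (\<lambda>x. norm (d n x :: 'a) powr m)"
    and lim: "(\<lambda>n. LINT x|lborel. norm (d n x) powr m) \<longlonglongrightarrow> 0"
  shows "integrable lborel (\<lambda>x. norm (A (f R x)) * norm (d n x))"
    and "(\<lambda>n. LINT x|lborel. norm (A (f R x)) * norm (d n x)) \<longlonglongrightarrow> 0"
proof -
  have G: "0 < G + 1" using G_nonneg by simp
  let ?b = "\<lambda>\<delta> n x. (G + 1) * (\<delta> * (indicator (K R) x + norm (f R x) powr m) + 2 * \<delta> powr (1 - m) * norm (d n x) powr m)"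
  have bound: "norm (norm (A (f R x)) * norm (d n x)) \<le> ?b \<delta> n x" if "0 < \<delta>" for \<delta> n x
  proof (cases "x \<in> K R")
    case True
    have "norm (A (f R x)) * norm (d n x) \<le> ((G + 1) * (1 + norm (f R x) powr (m - 1))) * norm (d n x)"
      by (intro mult_right_mono A_bound) auto
    \<comment> \<open>The constant part of the growth bound is written as a power of 1, so that
      \<open>powr_split\<close> applies to both summands.\<close>
    also have "\<dots> = (G + 1) * (1 powr (m - 1) * norm (d n x) + norm (f R x) powr (m - 1) * norm (d n x))"
      by (simp add: algebra_simps)
    also have "\<dots> \<le> (G + 1) * ((\<delta> * 1 powr m + \<delta> powr (1 - m) * norm (d n x) powr m)
        + (\<delta> * norm (f R x) powr m + \<delta> powr (1 - m) * norm (d n x) powr m))"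
      using G that by (intro mult_left_mono add_mono powr_split) auto
    also have "\<dots> = ?b \<delta> n x" using True by (simp add: algebra_simps)
    finally show ?thesis by simp
  qed (use that G in \<open>auto simp: f_def\<close>)
  have bi: "integrable lborel (?b \<delta> n)" for \<delta> n
    using K_int f_int i by simp
  have I: "integrable lborel (\<lambda>x. norm (A (f R x)) * norm (d n x))" for n
    by (rule integrable_dominated[OF bi _ bound[OF zero_less_one]]) measurable
  then show "integrable lborel (\<lambda>x. norm (A (f R x)) * norm (d n x))" .
  define C where "C = (LINT x|lborel. indicator (K R) x + norm (f R x) powr m)"
  have C: "0 \<le> C" unfolding C_def by (intro Bochner_Integration.integral_nonneg) auto
  show "(\<lambda>n. LINT x|lborel. norm (A (f R x)) * norm (d n x)) \<longlonglongrightarrow> 0"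
  proof (rule LIMSEQ_I)
    fix r :: real assume r: "0 < r"
    \<comment> \<open>Makes the fixed part smaller than r/2; C + 1 keeps the denominator positive
      when C = 0.\<close>
    define \<delta> where "\<delta> = r / 2 / ((G + 1) * (C + 1))"
    have \<delta>: "0 < \<delta>" using r G C by (simp add: \<delta>_def)
    have small: "(G + 1) * (\<delta> * C) < r / 2"
    proof -
      have "(G + 1) * (\<delta> * C) < (G + 1) * (\<delta> * (C + 1))" using G \<delta> by (intro mult_strict_left_mono) auto
      also have "\<dots> = \<delta> * ((G + 1) * (C + 1))" by (simp only: mult_ac)
      also have "\<dots> = r / 2" using G C by (simp add: \<delta>_def)
      finally show ?thesis .
    qed
    have "(\<lambda>n. (G + 1) * (2 * \<delta> powr (1 - m) * (LINT x|lborel. norm (d n x) powr m))) \<longlonglongrightarrow> (G + 1) * (2 * \<delta> powr (1 - m) * 0)"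
      by (intro tendsto_intros lim)
    then have "eventually (\<lambda>n. (G + 1) * (2 * \<delta> powr (1 - m) * (LINT x|lborel. norm (d n x) powr m)) < r / 2) sequentially"
      using r by (intro order_tendstoD(2)[where a="r/2"]) auto
    then obtain N where N: "\<And>n. n \<ge> N \<Longrightarrow> (G + 1) * (2 * \<delta> powr (1 - m) * (LINT x|lborel. norm (d n x) powr m)) < r / 2"
      by (auto simp: eventually_sequentially)
    have "norm ((LINT x|lborel. norm (A (f R x)) * norm (d n x)) - 0) < r" if "n \<ge> N" for n
    proof -
      have "(LINT x|lborel. norm (A (f R x)) * norm (d n x)) \<le> integral\<^sup>L lborel (?b \<delta> n)"
        by (rule integral_mono[OF I bi]) (use bound[OF \<delta>, of _ n] in auto)
      also have "\<dots> = (G + 1) * (\<delta> * C) + (G + 1) * (2 * \<delta> powr (1 - m) * (LINT x|lborel. norm (d n x) powr m))"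
        unfolding C_def using K_int[of R] f_int[of R] i[of n] by (simp add: distrib_left)
      also have "\<dots> < r" using small N[OF that] by linarith
      finally show ?thesis by (simp add: Bochner_Integration.integral_nonneg)
    qed
    then show "\<exists>N. \<forall>n\<ge>N. norm ((LINT x|lborel. norm (A (f R x)) * norm (d n x)) - 0) < r" by blast
  qed
qed

text \<open>With F(t) = flat (M/2 - t), \<open>pen\<close> is F(w) and \<open>pen'\<close> is
  -F'(w), the sign being chosen to make it nonnegative.\<close>

definition pen :: "'a \<Rightarrow> real" where "pen x = flat (M / 2 - w x)"
definition pen' :: "'a \<Rightarrow> real" where "pen' x = flat' (M / 2 - w x)"

lemma pen'_nonneg: "0 \<le> pen' x" and pen'_le: "pen' x \<le> 4" and pen_nonneg: "0 \<le> pen x" and pen_le: "pen x \<le> 1"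
  by (auto simp: pen_def pen'_def flat_nonneg flat'_nonneg flat'_le flat_le_1)

lemma continuous_pen: "continuous_on UNIV pen" "continuous_on UNIV pen'"
  unfolding pen_def[abs_def] pen'_def[abs_def]
  by (intro continuous_on_compose2[OF continuous_on_flat] continuous_on_compose2[OF continuous_on_flat']
    continuous_intros continuous_w, auto)+

text \<open>This is the supersolution inequality tested with F(w) \<zeta>. For the smooth test
  functions p n \<zeta> the integrand splits into a n, which already contains the true gradient, and
  b n, which is linear in h n - f R. Dominated convergence handles the first,
  \<open>A_times_small\<close> the second.\<close>

lemma weak_inequality:
  assumes R: "0 \<le> R" and \<zeta>: "\<And>j. Ck j \<zeta>" "\<And>x. 0 \<le> \<zeta> x" "\<And>x. \<zeta> x \<le> 1" "\<And>x. R \<le> norm x \<Longrightarrow> \<zeta> x = 0"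
  shows "integrable lborel (\<lambda>x. pen' x * \<zeta> x * (A (f R x) \<bullet> f R x))"
    and "(LINT x|lborel. pen' x * \<zeta> x * (A (f R x) \<bullet> f R x)) \<le> (LINT x|lborel. pen x * (A (f R x) \<bullet> grad \<zeta> x))"
    and "integrable lborel (\<lambda>x. pen x * (A (f R x) \<bullet> grad \<zeta> x))"
proof -
  have c\<zeta>: "continuous_on UNIV \<zeta>" "continuous_on UNIV (grad \<zeta>)"
    using Ck_continuous[OF \<zeta>(1)] continuous_on_grad[OF \<zeta>(1)] .
  have \<zeta>_test: "test_function UNIV \<zeta>"
    by (rule test_functionI[OF \<zeta>(1) compact_cball[of 0 R]]) (use \<zeta>(4) in auto)
  have g\<zeta>0: "grad \<zeta> x = 0" if "R < norm x" for x
  proof (rule grad_eq_0_outside)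
    have "closure {x. \<zeta> x \<noteq> 0} \<subseteq> cball 0 R"
      using \<zeta>(4) by (intro closure_minimal subsetI) (auto intro: ccontr[of "norm _ \<le> R"])
    then show "x \<notin> closure {x. \<zeta> x \<noteq> 0}" using that by auto
  qed
  obtain Z where Z: "0 \<le> Z" "\<And>x. norm (grad \<zeta> x) \<le> Z"
  proof -
    have "bounded (grad \<zeta> ` cball 0 R)"
      by (intro compact_imp_bounded compact_continuous_image continuous_on_subset[OF c\<zeta>(2)]) auto
    then obtain B where B: "\<forall>y\<in>grad \<zeta> ` cball 0 R. norm y \<le> B" unfolding bounded_iff by blast
    have "norm (grad \<zeta> x) \<le> max B 0" for x
    proof (cases "norm x \<le> R")
      case True
      then have "norm (grad \<zeta> x) \<le> B" using B by auto
      then show ?thesis by simp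
    next
      case False
      then show ?thesis using g\<zeta>0[of x] by simp
    qed
    then show ?thesis using that[of "max B 0"] by simp
  qed
  have [measurable]: "\<zeta> \<in> borel_measurable borel" "grad \<zeta> \<in> borel_measurable borel"
    "pen \<in> borel_measurable borel" "pen' \<in> borel_measurable borel"
    using c\<zeta> continuous_pen by (auto intro: borel_measurable_continuous_onI)
  \<comment> \<open>Where p n or p' n is nonzero, w \<le> M/2 + \<eta>, which has to lie below M -
    \<eta> for the gradient identity to apply.\<close>
  define \<eta> where "\<eta> = M / 8"
  have \<eta>: "0 < \<eta>" "\<eta> < M" using M(1) by (auto simp: \<eta>_def)
  obtain W h where app: "approximates \<eta> R W h" using ex_approximates[OF \<eta> R] by (elim exE)
  note W = approximatesD[OF app \<eta>(1)]
  have cW: "continuous_on UNIV (W n)" for n by (rule Ck_continuous[OF W(1)])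
  note [measurable] = W(2)
  define p where "p = (\<lambda>n x. flat (M / 2 - W n x))"
  define p' where "p' = (\<lambda>n x. flat' (M / 2 - W n x))"
  have [measurable]: "p n \<in> borel_measurable borel" "p' n \<in> borel_measurable borel" for n
    unfolding p_def p'_def
    by (intro borel_measurable_continuous_onI continuous_on_compose2[OF continuous_on_flat]
      continuous_on_compose2[OF continuous_on_flat'] continuous_intros cW, auto)+
  have pb: "0 \<le> p n x" "p n x \<le> 1" "0 \<le> p' n x" "p' n x \<le> 4" for n x
    by (auto simp: p_def p'_def flat_nonneg flat'_nonneg flat'_le flat_le_1)
  have p_out: "w x \<le> M / 2 + \<eta>" if "norm x \<le> R" "p n x \<noteq> 0 \<or> p' n x \<noteq> 0" for n x
  proof -
    have "W n x < M / 2" using that(2) by (auto simp: p_def p'_def flat_def flat'_def split: if_splits)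
    then show ?thesis using W(4)[OF that(1), of n] by linarith
  qed
  define a where "a = (\<lambda>n x. - (p' n x * \<zeta> x * (A (f R x) \<bullet> f R x)) + p n x * (A (f R x) \<bullet> grad \<zeta> x))"
  define b where "b = (\<lambda>n x. - (p' n x * \<zeta> x * (A (f R x) \<bullet> (h n x - f R x))))"
  \<comment> \<open>The constant 4 bounds flat' and Z bounds |grad \<zeta>|; V is independent of
    n.\<close>
  define V where "V = (\<lambda>x. 4 * (norm (A (f R x)) * norm (f R x)) + norm (A (f R x)) * Z)"
  have iV: "integrable lborel V" unfolding V_def using A_f_int by simp
  have dom1: "norm (q * \<zeta> x * (A (f R x) \<bullet> v)) \<le> 4 * (norm (A (f R x)) * norm v)" if "0 \<le> q" "q \<le> 4" for q x v
  proof -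
    have "\<bar>q * \<zeta> x\<bar> \<le> 4 * 1" unfolding abs_mult using that \<zeta>(2,3)[of x] by (intro mult_mono) auto
    then have "\<bar>q * \<zeta> x\<bar> * \<bar>A (f R x) \<bullet> v\<bar> \<le> 4 * (norm (A (f R x)) * norm v)"
      using Cauchy_Schwarz_ineq2[of "A (f R x)" v] by (intro mult_mono) auto
    then show ?thesis by (simp add: abs_mult)
  qed
  have dom2: "norm (q * (A (f R x) \<bullet> grad \<zeta> x)) \<le> norm (A (f R x)) * Z" if "0 \<le> q" "q \<le> 1" for q x
  proof -
    have "\<bar>q\<bar> * \<bar>A (f R x) \<bullet> grad \<zeta> x\<bar> \<le> 1 * (norm (A (f R x)) * norm (grad \<zeta> x))"
      using that Cauchy_Schwarz_ineq2[of "A (f R x)" "grad \<zeta> x"] by (intro mult_mono) auto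
    also have "\<dots> \<le> norm (A (f R x)) * Z" using Z by (auto intro!: mult_left_mono)
    finally show ?thesis by (simp add: abs_mult)
  qed
  show i1: "integrable lborel (\<lambda>x. pen' x * \<zeta> x * (A (f R x) \<bullet> f R x))"
    by (rule integrable_dominated[OF integrable_mult_right[OF A_f_int(1)[of R], of 4] _ dom1])
      (auto simp: pen'_nonneg pen'_le)
  show i2: "integrable lborel (\<lambda>x. pen x * (A (f R x) \<bullet> grad \<zeta> x))"
    by (rule integrable_dominated[OF integrable_mult_left[OF A_f_int(2)[of R], of Z] _ dom2])
      (auto simp: pen_nonneg pen_le)
  have aV: "norm (a n x) \<le> V x" for n x
    using dom1[OF pb(3,4), of n x x "f R x"] dom2[OF pb(1,2), of n x x] norm_triangle_ineq[of "- (p' n x * \<zeta> x * (A (f R x) \<bullet> f R x))" "p n x * (A (f R x) \<bullet> grad \<zeta> x)"]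
    by (simp add: a_def V_def)
  have a_lim: "(\<lambda>n. integral\<^sup>L lborel (a n)) \<longlonglongrightarrow>
      (LINT x|lborel. - (pen' x * \<zeta> x * (A (f R x) \<bullet> f R x)) + pen x * (A (f R x) \<bullet> grad \<zeta> x))"
  proof (rule integral_dominated_convergence[OF _ _ iV])
    show "AE x in lborel. (\<lambda>n. a n x) \<longlonglongrightarrow> - (pen' x * \<zeta> x * (A (f R x) \<bullet> f R x)) + pen x * (A (f R x) \<bullet> grad \<zeta> x)"
    proof (rule AE_I2)
      fix x
      show "(\<lambda>n. a n x) \<longlonglongrightarrow> - (pen' x * \<zeta> x * (A (f R x) \<bullet> f R x)) + pen x * (A (f R x) \<bullet> grad \<zeta> x)"
      proof (cases "norm x \<le> R")
        case True
        have l: "(\<lambda>n. M / 2 - W n x) \<longlonglongrightarrow> M / 2 - w x" by (intro tendsto_intros W(5)[OF True])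
        have "(\<lambda>n. p n x) \<longlonglongrightarrow> pen x" "(\<lambda>n. p' n x) \<longlonglongrightarrow> pen' x"
          unfolding p_def p'_def pen_def pen'_def
          using continuous_on_tendsto_compose[OF continuous_on_flat l]
            continuous_on_tendsto_compose[OF continuous_on_flat' l] by auto
        then show ?thesis unfolding a_def by (intro tendsto_intros)
      next
        case False
        then show ?thesis using \<zeta>(4)[of x] g\<zeta>0[of x] by (simp add: a_def)
      qed
    qed
    show "AE x in lborel. norm (a n x) \<le> V x" for n using aV by simp
    show "a n \<in> borel_measurable lborel" for n unfolding a_def by measurable
  qed measurable
  have ia: "integrable lborel (a n)" for n
    by (rule integrable_dominated[OF iV _ aV]) (unfold a_def, measurable)
  have S: "integrable lborel (\<lambda>x. norm (A (f R x)) * norm (h n x - f R x))"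
      "(\<lambda>n. LINT x|lborel. norm (A (f R x)) * norm (h n x - f R x)) \<longlonglongrightarrow> 0" for n
    by (rule A_times_small[OF _ W(8,9)], measurable)+
  have bd: "norm (b n x) \<le> 4 * (norm (A (f R x)) * norm (h n x - f R x))" for n x
    unfolding b_def norm_minus_cancel by (rule dom1[OF pb(3,4)])
  have ib: "integrable lborel (b n)" for n
    by (rule integrable_dominated[OF integrable_mult_right[OF S(1), of 4] _ bd]) (unfold b_def, measurable)
  have b_lim: "(\<lambda>n. integral\<^sup>L lborel (b n)) \<longlonglongrightarrow> 0"
  proof (rule Lim_null_comparison)
    have "norm (integral\<^sup>L lborel (b n)) \<le> 4 * (LINT x|lborel. norm (A (f R x)) * norm (h n x - f R x))" for n
    proof -
      have "norm (integral\<^sup>L lborel (b n)) \<le> (LINT x|lborel. norm (b n x))" by (rule integral_norm_bound)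
      also have "\<dots> \<le> (LINT x|lborel. 4 * (norm (A (f R x)) * norm (h n x - f R x)))"
        by (rule integral_mono[OF integrable_norm[OF ib] integrable_mult_right[OF S(1)] bd])
      finally show ?thesis using S(1) by simp
    qed
    then show "\<forall>\<^sub>F n in sequentially. norm (integral\<^sup>L lborel (b n)) \<le> 4 * (LINT x|lborel. norm (A (f R x)) * norm (h n x - f R x))"
      by simp
    show "(\<lambda>n. 4 * (LINT x|lborel. norm (A (f R x)) * norm (h n x - f R x))) \<longlonglongrightarrow> 0"
      using tendsto_mult[OF tendsto_const S(2), of 4] by simp
  qed
  have pos: "0 \<le> integral\<^sup>L lborel (a n) + integral\<^sup>L lborel (b n)" for n
  proof -
    define \<phi> where "\<phi> = (\<lambda>x. p n x * \<zeta> x)"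
    \<comment> \<open>The cutoff \<zeta> need not vanish near the unit ball: the factor p n keeps
      the support beyond radius 2, because w = M on that ball.\<close>
    have inside: "2 < norm x \<and> w x \<le> M - \<eta>" if "norm x \<le> R" "p n x \<noteq> 0 \<or> p' n x \<noteq> 0" for x
      using p_out[OF that] w_less_M[of x] M(1) by (auto simp: \<eta>_def)
    have "test_function (- cball 0 1) \<phi>"
    proof (rule test_functionI[OF _ K(1) K(2)])
      have "(\<lambda>x. M / 2 - W n x) = (\<lambda>x. M / 2 + (-1) * W n x)" by simp
      then show "Ck j \<phi>" for j unfolding \<phi>_def p_def
        using Ck_flat[OF Ck_add[OF Ck_const Ck_mult[OF Ck_const W(1)]], of j "M / 2" "-1" n]
        by (intro Ck_mult \<zeta>(1)) simp
      show "\<phi> x = 0" if "x \<notin> K R" for x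
        using that inside[of x] \<zeta>(4)[of x] by (cases "norm x \<le> R") (auto simp: \<phi>_def K_def)
    qed
    moreover have "0 \<le> \<phi> x" for x using pb \<zeta>(2) by (simp add: \<phi>_def)
    ultimately have "0 \<le> (LINT x|lborel. A (D x) \<bullet> grad \<phi> x)" by (rule super)
    also have "\<dots> = (LINT x|lborel. a n x + b n x)"
    proof (rule Bochner_Integration.integral_cong[OF refl])
      fix x
      have dW: "(W n has_derivative (\<lambda>h. grad (W n) x \<bullet> h)) (at x)"
        by (rule has_derivative_grad[OF Ck_Suc_differentiable[OF W(1)[of "Suc 0"]]])
      have d\<zeta>: "(\<zeta> has_derivative (\<lambda>h. grad \<zeta> x \<bullet> h)) (at x)"
        by (rule has_derivative_grad[OF Ck_Suc_differentiable[OF \<zeta>(1)[of "Suc 0"]]])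
      have "((\<lambda>y. M / 2 - W n y) has_derivative (\<lambda>h. 0 - grad (W n) x \<bullet> h)) (at x)"
        using dW by (intro has_derivative_diff has_derivative_const)
      from has_derivative_compose[OF this flat_has_derivative[unfolded has_field_derivative_def]]
      have "(p n has_derivative (\<lambda>h. p' n x * (0 - grad (W n) x \<bullet> h))) (at x)"
        by (simp add: p_def p'_def)
      from has_derivative_mult[OF this d\<zeta>]
      have "(\<phi> has_derivative (\<lambda>h. (- (p' n x * \<zeta> x) *\<^sub>R grad (W n) x + p n x *\<^sub>R grad \<zeta> x) \<bullet> h)) (at x)"
        unfolding \<phi>_def by (rule has_derivative_eq_rhs) (auto simp: algebra_simps inner_add_left)
      then have gr: "grad \<phi> x = - (p' n x * \<zeta> x) *\<^sub>R grad (W n) x + p n x *\<^sub>R grad \<zeta> x"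
        by (rule grad_eqI)
      show "A (D x) \<bullet> grad \<phi> x = a n x + b n x"
      proof (cases "norm x \<le> R \<and> (p n x \<noteq> 0 \<or> p' n x \<noteq> 0)")
        case True
        then have "x \<in> K R" "grad (W n) x = h n x" using inside[of x] W(6)[of x n] by (auto simp: K_def)
        then have e: "grad \<phi> x = - (p' n x * \<zeta> x) *\<^sub>R h n x + p n x *\<^sub>R grad \<zeta> x" "f R x = D x"
          using gr by (auto simp: f_def)
        show ?thesis unfolding a_def b_def e
          by (simp add: algebra_simps inner_add_right inner_diff_right)
      next
        case False
        then have "grad \<phi> x = 0" "a n x = 0" "b n x = 0"
          using gr \<zeta>(4)[of x] g\<zeta>0[of x] by (auto simp: a_def b_def)
        then show ?thesis by simp
      qed
    qed
    also have "\<dots> = integral\<^sup>L lborel (a n) + integral\<^sup>L lborel (b n)"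
      by (rule Bochner_Integration.integral_add[OF ia ib])
    finally show ?thesis .
  qed
  have "0 \<le> (LINT x|lborel. - (pen' x * \<zeta> x * (A (f R x) \<bullet> f R x)) + pen x * (A (f R x) \<bullet> grad \<zeta> x)) + 0"
    by (rule LIMSEQ_le_const[OF tendsto_add[OF a_lim b_lim]]) (use pos in auto)
  also have "\<dots> = - (LINT x|lborel. pen' x * \<zeta> x * (A (f R x) \<bullet> f R x)) + (LINT x|lborel. pen x * (A (f R x) \<bullet> grad \<zeta> x))"
    using i1 i2 by simp
  finally show "(LINT x|lborel. pen' x * \<zeta> x * (A (f R x) \<bullet> f R x)) \<le> (LINT x|lborel. pen x * (A (f R x) \<bullet> grad \<zeta> x))"
    by simp
qed

end

section \<open>Logarithmic cutoff and the energy estimate\<close>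

text \<open>The exponent -N is scale invariant, so each of the n dyadic shells between 2 and 2^(n+1)
  contributes at most the same constant.\<close>

lemma shell_integral:
  fixes n :: nat
  defines "F \<equiv> \<lambda>n x::'a::euclidean_space. indicator {x. 2 \<le> norm x \<and> norm x < 2 ^ Suc n} x * norm x powr (- real DIM('a))"
  shows "integrable lborel (F n) \<and> integral\<^sup>L lborel (F n) \<le> real n * (2 ^ DIM('a) * measure lborel (ball (0::'a) 1))"
proof (induction n)
  case 0
  have "F 0 = (\<lambda>x. 0)" by (auto simp: F_def indicator_def)
  then show ?case by simp
next
  case (Suc n)
  define r :: real where "r = 2 ^ Suc n"
  have r: "0 < r" "2 \<le> r" using one_le_power[of "2::real" n] by (auto simp: r_def)
  \<comment> \<open>On the new shell from r to 2r the weight is at most r^(-N), and the shell is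
    enlarged to the ball of radius 2r, whose volume cancels that factor up to 2^N.\<close>
  let ?H = "\<lambda>x::'a. r powr (- real DIM('a)) * indicator (ball 0 (2 * r)) x"
  have le: "F (Suc n) x \<le> F n x + ?H x" for x
  proof (cases "norm x < r")
    case True
    then have "F (Suc n) x = F n x" using r by (auto simp: F_def r_def indicator_def)
    then show ?thesis by (simp add: indicator_def)
  next
    case False
    have "norm x powr (- real DIM('a)) \<le> r powr (- real DIM('a))"
      using False r by (intro powr_mono2') auto
    then show ?thesis by (auto simp: F_def r_def indicator_def)
  qed
  have i: "integrable lborel (\<lambda>x. F n x + ?H x)"
    by (intro Bochner_Integration.integrable_add integrable_mult_right integrable_indicator_bounded Suc.IH[THEN conjunct1]) auto
  have [measurable]: "F (Suc n) \<in> borel_measurable borel" unfolding F_def by measurable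
  have i': "integrable lborel (F (Suc n))"
  proof (rule integrable_dominated[OF i])
    show "norm (F (Suc n) x) \<le> F n x + ?H x" for x
      using le[of x] by (simp add: F_def)
  qed measurable
  have "integral\<^sup>L lborel (F (Suc n)) \<le> (LINT x|lborel. F n x + ?H x)"
    by (rule integral_mono[OF i' i le])
  also have "\<dots> = integral\<^sup>L lborel (F n) + integral\<^sup>L lborel ?H"
    by (intro Bochner_Integration.integral_add Suc.IH[THEN conjunct1] integrable_mult_right integrable_indicator_bounded) auto
  also have "integral\<^sup>L lborel ?H = r powr (- real DIM('a)) * ((2 * r) ^ DIM('a) * measure lborel (ball (0::'a) 1))"
    using content_ball_conv_unit_ball[of "2 * r" "0::'a"] r by simp
  also have "\<dots> = 2 ^ DIM('a) * measure lborel (ball (0::'a) 1)"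
    using r by (simp add: powr_minus powr_realpow power_mult_distrib)
  finally show ?case using Suc.IH i' by (simp add: algebra_simps)
qed

text \<open>Composing with \<^const>\<open>flat\<close> makes \<open>|\<nabla>\<zeta>|\<^sup>r \<zeta>\<^bsup>1-r\<^esup>\<close> bounded by a multiple of \<open>|\<nabla>\<theta>|\<^sup>r\<close> for every \<open>r\<close>,
  where \<open>\<zeta> = flat (1 - \<theta>)\<close>; this is what Young's inequality needs.\<close>

definition log_cutoff :: "real \<Rightarrow> 'a::euclidean_space \<Rightarrow> real" where
  "log_cutoff R x = flat (1 - ln (1 + x \<bullet> x) / ln (1 + R\<^sup>2))"

text \<open>Using 1 + |x|^2 instead of |x| keeps the logarithm smooth at the origin, and the
  normalisation makes the argument of \<open>flat\<close> vanish exactly at |x| = R. Monotonicity in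
  R is what later makes the energies monotone.\<close>

lemma log_cutoff:
  fixes x :: "'a::euclidean_space"
  assumes R: "0 < R"
  shows "Ck j (log_cutoff R :: 'a \<Rightarrow> real)" "0 \<le> log_cutoff R x" "log_cutoff R x \<le> 1"
    "norm x < R \<Longrightarrow> 0 < log_cutoff R x" "R \<le> norm x \<Longrightarrow> log_cutoff R x = 0"
    "R \<le> R' \<Longrightarrow> log_cutoff R x \<le> log_cutoff R' x"
proof -
  have L: "0 < ln (1 + R\<^sup>2)" using R by (intro ln_gt_zero) simp
  have p: "0 < 1 + y \<bullet> y" for y :: 'a using inner_ge_zero[of y] by linarith
  have e: "log_cutoff R = (\<lambda>x::'a. flat (1 + (- 1 / ln (1 + R\<^sup>2)) * ln (1 + x \<bullet> x)))"
    by (auto simp: log_cutoff_def)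
  show "Ck j (log_cutoff R :: 'a \<Rightarrow> real)"
    unfolding e by (intro Ck_flat Ck_add Ck_mult Ck_const Ck_ln Ck_inner_self p)
  show "0 \<le> log_cutoff R x" "log_cutoff R x \<le> 1" by (auto simp: log_cutoff_def flat_nonneg flat_le_1)
  show "0 < log_cutoff R x" if "norm x < R"
  proof -
    have "(norm x)\<^sup>2 < R\<^sup>2" using that by (intro power_strict_mono) auto
    then have "ln (1 + x \<bullet> x) < ln (1 + R\<^sup>2)" using p[of x] by (simp add: power2_norm_eq_inner)
    then show ?thesis using L by (simp add: log_cutoff_def flat_def)
  qed
  show "log_cutoff R x = 0" if "R \<le> norm x"
  proof -
    have "R\<^sup>2 \<le> (norm x)\<^sup>2" using that R by (intro power_mono) auto
    then have "ln (1 + R\<^sup>2) \<le> ln (1 + x \<bullet> x)" using R by (simp add: power2_norm_eq_inner add_pos_nonneg)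
    then show ?thesis using L by (simp add: log_cutoff_def flat_def)
  qed
  show "log_cutoff R x \<le> log_cutoff R' x" if "R \<le> R'"
  proof -
    have "R\<^sup>2 \<le> R'\<^sup>2" using that R by (intro power_mono) auto
    then have "ln (1 + R\<^sup>2) \<le> ln (1 + R'\<^sup>2)" using R by (simp add: add_pos_nonneg)
    then have "ln (1 + x \<bullet> x) / ln (1 + R'\<^sup>2) \<le> ln (1 + x \<bullet> x) / ln (1 + R\<^sup>2)"
      using L by (intro divide_left_mono) auto
    then show ?thesis unfolding log_cutoff_def by (intro flat_mono) simp
  qed
qed

lemma grad_log_cutoff:
  fixes x :: "'a::euclidean_space"
  assumes R: "0 < R"
  shows "grad (log_cutoff R) x =
    (- (flat' (1 - ln (1 + x \<bullet> x) / ln (1 + R\<^sup>2)) * (2 / ((1 + x \<bullet> x) * ln (1 + R\<^sup>2))))) *\<^sub>R x"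
proof (rule grad_eqI)
  let ?L = "ln (1 + R\<^sup>2)"
  have p: "0 < 1 + x \<bullet> x" using inner_ge_zero[of x] by linarith
  have "((\<lambda>x. 1 + x \<bullet> x) has_derivative (\<lambda>h. 0 + (x \<bullet> h + h \<bullet> x))) (at x)"
    by (intro has_derivative_add has_derivative_const has_derivative_inner has_derivative_ident)
  from has_derivative_compose[OF this DERIV_ln[OF p, unfolded has_field_derivative_def]]
  have "((\<lambda>x. ln (1 + x \<bullet> x)) has_derivative (\<lambda>h. inverse (1 + x \<bullet> x) * (0 + (x \<bullet> h + h \<bullet> x)))) (at x)" .
  then have "((\<lambda>x. 1 - ln (1 + x \<bullet> x) * inverse ?L) has_derivative
      (\<lambda>h. 0 - inverse (1 + x \<bullet> x) * (0 + (x \<bullet> h + h \<bullet> x)) * inverse ?L)) (at x)"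
    by (intro has_derivative_diff has_derivative_const has_derivative_mult_left)
  from has_derivative_compose[OF this flat_has_derivative[unfolded has_field_derivative_def]]
  show "(log_cutoff R has_derivative (\<bullet>) ((- (flat' (1 - ln (1 + x \<bullet> x) / ?L) * (2 / ((1 + x \<bullet> x) * ?L)))) *\<^sub>R x)) (at x)"
    unfolding log_cutoff_def[abs_def] divide_inverse
  proof (rule has_derivative_eq_rhs, intro ext)
    fix h
    show "flat' (1 - ln (1 + x \<bullet> x) * inverse ?L) * (0 - inverse (1 + x \<bullet> x) * (0 + (x \<bullet> h + h \<bullet> x)) * inverse ?L) =
      (- (flat' (1 - ln (1 + x \<bullet> x) * inverse ?L) * (2 * inverse ((1 + x \<bullet> x) * ?L)))) *\<^sub>R x \<bullet> h"
      unfolding inner_commute[of h x] inverse_mult_distrib inner_scaleR_left by (simp only: algebra_simps)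
  qed
qed

section \<open>The Caccioppoli estimate\<close>

context exterior_supersolution
begin

text \<open>The factors in turn: 2^(r-1) comes from Young's inequality, 4 bounds flat', (2r)^(2r)
  bounds flat \<tau> times \<tau>^(-2r), M^2/4 bounds z^2 for z \<le> M/2, and 2/L bounds |x| times
  the gradient of the normalised logarithm. As a function of L it decays like L^(-r).\<close>

definition cap :: "real \<Rightarrow> real \<Rightarrow> real" where
  "cap L r = 2 powr (r - 1) * (4 * (2 * r) powr (2 * r) * (M\<^sup>2 / 4 * (2 / L)) powr r)"

lemma cap_bound:
  assumes r: "1 < r" "real DIM('a) \<le> r" and x: "2 \<le> norm x" and z: "0 < z" "z \<le> M / 2"
    and \<tau>: "0 < \<tau>" and L: "0 < L"
  shows "flat' z * flat \<tau> * (2 powr (r - 1) * (z\<^sup>2 / \<tau>\<^sup>2 * (2 * norm x / ((1 + x \<bullet> x) * L))) powr r)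
    \<le> cap L r * norm x powr (- real DIM('a))"
proof -
  let ?b = "2 * norm x / ((1 + x \<bullet> x) * L)"
  have b: "0 \<le> ?b" "?b \<le> (2 / L) * (1 / norm x)"
  proof -
    have nn: "0 < norm x" "x \<bullet> x = norm x * norm x" using x by (auto simp: power2_norm_eq_inner[symmetric] power2_eq_square)
    show "0 \<le> ?b" using L by (intro divide_nonneg_nonneg mult_nonneg_nonneg) auto
    have "?b \<le> 2 * norm x / ((x \<bullet> x) * L)"
      using nn L by (intro divide_left_mono mult_right_mono mult_pos_pos) (auto simp: add_pos_pos)
    also have "\<dots> = (2 / L) * (1 / norm x)" using nn L by (simp add: field_simps)
    finally show "?b \<le> (2 / L) * (1 / norm x)" .
  qed
  have z2: "z\<^sup>2 \<le> M\<^sup>2 / 4"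
  proof -
    have "z\<^sup>2 \<le> (M / 2)\<^sup>2" using z by (intro power_mono) auto
    then show ?thesis by (simp add: power_divide)
  qed
  have "z\<^sup>2 / \<tau>\<^sup>2 * ?b = (z\<^sup>2 * ?b) * (1 / \<tau>)\<^sup>2" by (simp add: power_divide)
  also have "\<dots> \<le> ((M\<^sup>2 / 4) * ((2 / L) * (1 / norm x))) * (1 / \<tau>)\<^sup>2"
    using z2 b by (intro mult_right_mono mult_mono) auto
  finally have k: "z\<^sup>2 / \<tau>\<^sup>2 * ?b \<le> (M\<^sup>2 / 4 * (2 / L)) * (1 / norm x) * (1 / \<tau>)\<^sup>2" by (simp add: mult.assoc)
  have k0: "0 \<le> z\<^sup>2 / \<tau>\<^sup>2 * ?b" using b(1) by (intro mult_nonneg_nonneg) auto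
  have "(z\<^sup>2 / \<tau>\<^sup>2 * ?b) powr r \<le> ((M\<^sup>2 / 4 * (2 / L)) * (1 / norm x) * (1 / \<tau>)\<^sup>2) powr r"
    using k k0 r by (intro powr_mono2) auto
  also have "\<dots> = (M\<^sup>2 / 4 * (2 / L)) powr r * norm x powr (- r) * (1 / \<tau>) powr (2 * r)"
  proof -
    have "(1 / \<tau>) powr 2 = (1 / \<tau>)\<^sup>2" using \<tau> by (intro powr_numeral) simp
    then have e: "((1 / \<tau>)\<^sup>2) powr r = (1 / \<tau>) powr (2 * r)" "(1 / norm x) powr r = norm x powr (- r)"
      using powr_powr[of "1 / \<tau>" 2 r] x by (simp_all add: powr_divide powr_minus inverse_eq_divide)
    have "(q * a * b) powr r = q powr r * a powr r * b powr r"
      if "0 \<le> q" "0 \<le> a" "0 \<le> b" for q a b :: real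
      using that by (simp add: powr_mult)
    from this[of "M\<^sup>2 / 4 * (2 / L)" "1 / norm x" "(1 / \<tau>)\<^sup>2"] L show ?thesis
      unfolding e by (simp del: times_divide_eq_right times_divide_eq_left)
  qed
  \<comment> \<open>The dimension enters here: r \<ge> N and |x| \<ge> 2 allow the exponent -r to be
    replaced by the scale-invariant -N.\<close>
  also have "\<dots> \<le> (M\<^sup>2 / 4 * (2 / L)) powr r * norm x powr (- real DIM('a)) * (1 / \<tau>) powr (2 * r)"
    using x r by (intro mult_right_mono mult_left_mono powr_mono) auto
  finally have K: "(z\<^sup>2 / \<tau>\<^sup>2 * ?b) powr r \<le> (M\<^sup>2 / 4 * (2 / L)) powr r * norm x powr (- real DIM('a)) * (1 / \<tau>) powr (2 * r)" .
  have F: "flat \<tau> * (1 / \<tau>) powr (2 * r) \<le> (2 * r) powr (2 * r)"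
    using powr_exp_bound[of "2 * r" "1 / \<tau>"] r \<tau> by (simp add: flat_def mult.commute)
  have "flat' z * flat \<tau> * (2 powr (r - 1) * (z\<^sup>2 / \<tau>\<^sup>2 * ?b) powr r)
      \<le> 4 * flat \<tau> * (2 powr (r - 1) * ((M\<^sup>2 / 4 * (2 / L)) powr r * norm x powr (- real DIM('a)) * (1 / \<tau>) powr (2 * r)))"
    using K flat'_le[of z] flat_nonneg[of \<tau>] flat'_nonneg[of z] by (intro mult_mono) auto
  also have "\<dots> = (4 * 2 powr (r - 1) * (M\<^sup>2 / 4 * (2 / L)) powr r * norm x powr (- real DIM('a))) * (flat \<tau> * (1 / \<tau>) powr (2 * r))"
    by (simp only: mult_ac)
  also have "\<dots> \<le> (4 * 2 powr (r - 1) * (M\<^sup>2 / 4 * (2 / L)) powr r * norm x powr (- real DIM('a))) * (2 * r) powr (2 * r)"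
    using F by (intro mult_left_mono) auto
  also have "\<dots> = cap L r * norm x powr (- real DIM('a))" unfolding cap_def by (simp only: mult_ac)
  finally show ?thesis .
qed

lemma A_inner_nonneg: "0 \<le> A v \<bullet> v"
  unfolding flux_inner_self using g_pos[of "norm v"] by simp

text \<open>Young's inequality is applied to |A v| \<kappa>, where \<kappa> is the product of the
  ratios pen / pen' and |grad \<zeta>| / \<zeta>; half of the energy density can then be absorbed
  after integration. The estimate is for arbitrary v, to be used at the gradient.\<close>

lemma caccioppoli_pointwise:
  assumes R: "0 < R"
  defines "L \<equiv> ln (1 + R\<^sup>2)"
  shows "pen x * (A v \<bullet> grad (log_cutoff R) x) \<le> pen' x * log_cutoff R x * (A v \<bullet> v) / 2
     + (G * cap L m + cap L s) * (indicator {x. 2 \<le> norm x \<and> norm x < R} x * norm x powr (- real DIM('a)))"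
    (is "_ \<le> _ + ?C * _")
proof -
  have L: "0 < L" unfolding L_def using R by (intro ln_gt_zero) simp
  have cap0: "0 \<le> cap L r" for r by (simp add: cap_def)
  have C: "0 \<le> ?C" using G_nonneg cap0 by simp
  define \<tau> where "\<tau> = 1 - ln (1 + x \<bullet> x) / L"
  define z where "z = M / 2 - w x"
  have rhs: "0 \<le> pen' x * log_cutoff R x * (A v \<bullet> v) / 2
     + ?C * (indicator {x. 2 \<le> norm x \<and> norm x < R} x * norm x powr (- real DIM('a)))"
    using A_inner_nonneg[of v] pen'_nonneg[of x] log_cutoff(2)[OF R, of x] G_nonneg cap0
    by (intro add_nonneg_nonneg mult_nonneg_nonneg divide_nonneg_nonneg) auto
  have gr: "grad (log_cutoff R) x = (- (flat' \<tau> * (2 / ((1 + x \<bullet> x) * L)))) *\<^sub>R x"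
    unfolding \<tau>_def L_def by (rule grad_log_cutoff[OF R])
  show ?thesis
  \<comment> \<open>Otherwise \<open>pen\<close> or the gradient of the cutoff vanishes, and the
    right-hand side is nonnegative.\<close>
  proof (cases "0 < z \<and> 0 < \<tau>")
    case False
    then have "pen x = 0 \<or> grad (log_cutoff R) x = 0"
      using gr by (auto simp: pen_def flat_def flat'_def z_def)
    then show ?thesis using rhs by auto
  next
    case True
    then have z: "0 < z" "z \<le> M / 2" and \<tau>: "0 < \<tau>" using w_pos[of x] by (auto simp: z_def)
    have "w x < M" using z M(1) by (simp add: z_def)
    then have x2: "2 < norm x" using w_less_M by blast
    have xR: "norm x < R"
    proof (rule ccontr)
      assume "\<not> norm x < R"
      then have "log_cutoff R x = 0" using log_cutoff(5)[OF R, of x] by auto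
      then show False using \<tau> by (simp add: log_cutoff_def \<tau>_def L_def flat_def)
    qed
    have lc: "log_cutoff R x = flat \<tau>" by (simp add: log_cutoff_def \<tau>_def L_def)
    let ?b = "2 * norm x / ((1 + x \<bullet> x) * L)"
    let ?\<kappa> = "z\<^sup>2 / \<tau>\<^sup>2 * ?b"
    have b0: "0 \<le> ?b" using L by (intro divide_nonneg_nonneg mult_nonneg_nonneg) auto
    have nb: "norm (grad (log_cutoff R) x) = flat' \<tau> * ?b"
    proof -
      have "0 \<le> flat' \<tau> * (2 / ((1 + x \<bullet> x) * L))"
        using L flat'_nonneg by (intro mult_nonneg_nonneg divide_nonneg_nonneg) auto
      then have "norm (grad (log_cutoff R) x) = flat' \<tau> * (2 / ((1 + x \<bullet> x) * L)) * norm x"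
        unfolding gr norm_scaleR abs_minus_cancel by (simp only: abs_of_nonneg)
      then show ?thesis by simp
    qed
    have "pen x * (A v \<bullet> grad (log_cutoff R) x) \<le> pen x * (norm (A v) * norm (grad (log_cutoff R) x))"
      using pen_nonneg by (intro mult_left_mono norm_cauchy_schwarz)
    \<comment> \<open>The relation flat' t = flat t / t^2 is used twice: at z it turns
      \<open>pen\<close> into z^2 times \<open>pen'\<close>, at \<tau> it turns the derivative of
      the cutoff into the cutoff divided by \<tau>^2.\<close>
    also have "\<dots> = pen' x * flat \<tau> * (norm (A v) * ?\<kappa>)"
    proof -
      have "pen x = z\<^sup>2 * pen' x" using flat'_eq[OF z(1)] z by (simp add: pen_def pen'_def z_def)
      then show ?thesis unfolding nb flat'_eq[OF \<tau>] by simp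
    qed
    also have "\<dots> \<le> pen' x * flat \<tau> * ((A v \<bullet> v) / 2 + G * 2 powr (m - 1) * ?\<kappa> powr m + 2 powr (s - 1) * ?\<kappa> powr s)"
      using pen'_nonneg[of x] flat_nonneg[of \<tau>] g_pos[of "norm v"] g_le[of "norm v"] s1 sm b0
      by (intro mult_left_mono flux_young mult_nonneg_nonneg) auto
    also have "\<dots> = pen' x * log_cutoff R x * (A v \<bullet> v) / 2 +
        (G * (flat' z * flat \<tau> * (2 powr (m - 1) * ?\<kappa> powr m)) + flat' z * flat \<tau> * (2 powr (s - 1) * ?\<kappa> powr s))"
      by (simp add: lc pen'_def z_def algebra_simps)
    also have "\<dots> \<le> pen' x * log_cutoff R x * (A v \<bullet> v) / 2 +
        (G * (cap L m * norm x powr (- real DIM('a))) + cap L s * norm x powr (- real DIM('a)))"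
      using s1 sm sN x2 z \<tau> L G_nonneg by (intro add_left_mono add_mono mult_left_mono cap_bound) auto
    also have "\<dots> = pen' x * log_cutoff R x * (A v \<bullet> v) / 2
     + ?C * (indicator {x. 2 \<le> norm x \<and> norm x < R} x * norm x powr (- real DIM('a)))"
      using x2 xR by (simp add: algebra_simps)
    finally show ?thesis .
  qed
qed

text \<open>The radius 2^(n+1) leaves exactly n dyadic shells beyond radius 2.\<close>

definition energy :: "nat \<Rightarrow> real" where
  "energy n = (LINT x|lborel. pen' x * log_cutoff (2 ^ Suc n) x * (A (f (2 ^ Suc n) x) \<bullet> f (2 ^ Suc n) x))"

lemma energy_integrable:
  "integrable lborel (\<lambda>x. pen' x * log_cutoff (2 ^ Suc n) x * (A (f (2 ^ Suc n) x) \<bullet> f (2 ^ Suc n) x))"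
  by (rule weak_inequality(1)) (use log_cutoff[of "2 ^ Suc n"] in auto)

text \<open>Half of the energy is absorbed on the left, which is legitimate because the energy is
  finite; this produces the factor 2.\<close>

lemma energy_le:
  "energy n \<le> 2 * ((G * cap (ln (1 + (2 ^ Suc n)\<^sup>2)) m + cap (ln (1 + (2 ^ Suc n)\<^sup>2)) s) *
     (real n * (2 ^ DIM('a) * measure lborel (ball (0::'a) 1))))"
proof -
  define R :: real where "R = 2 ^ Suc n"
  have R: "0 < R" by (simp add: R_def)
  let ?C = "G * cap (ln (1 + R\<^sup>2)) m + cap (ln (1 + R\<^sup>2)) s"
  let ?F = "\<lambda>x::'a. indicator {x. 2 \<le> norm x \<and> norm x < R} x * norm x powr (- real DIM('a))"
  let ?E = "\<lambda>x. pen' x * log_cutoff R x * (A (f R x) \<bullet> f R x)"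
  have wi: "integrable lborel ?E" "integrable lborel (\<lambda>x. pen x * (A (f R x) \<bullet> grad (log_cutoff R) x))"
    "integral\<^sup>L lborel ?E \<le> (LINT x|lborel. pen x * (A (f R x) \<bullet> grad (log_cutoff R) x))"
    using log_cutoff(1,2,3,5)[OF R] R by (auto intro!: weak_inequality)
  have S: "integrable lborel ?F" "integral\<^sup>L lborel ?F \<le> real n * (2 ^ DIM('a) * measure lborel (ball (0::'a) 1))"
    using shell_integral[where 'a='a, of n] by (auto simp: R_def)
  have C: "0 \<le> ?C" using G_nonneg by (simp add: cap_def)
  have "integral\<^sup>L lborel ?E \<le> (LINT x|lborel. pen x * (A (f R x) \<bullet> grad (log_cutoff R) x))" by (rule wi(3))
  also have "\<dots> \<le> (LINT x|lborel. ?E x / 2 + ?C * ?F x)"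
    by (rule integral_mono[OF wi(2) _ caccioppoli_pointwise[OF R]])
      (intro Bochner_Integration.integrable_add integrable_divide_zero integrable_mult_right wi(1) S(1))
  also have "\<dots> = integral\<^sup>L lborel ?E / 2 + ?C * integral\<^sup>L lborel ?F"
    using wi(1) S(1) by simp
  also have "\<dots> \<le> integral\<^sup>L lborel ?E / 2 + ?C * (real n * (2 ^ DIM('a) * measure lborel (ball (0::'a) 1)))"
    using C S(2) by (intro add_left_mono mult_left_mono)
  finally show ?thesis unfolding energy_def R_def[symmetric] by linarith
qed

end

section \<open>Lower bound and nonexistence\<close>

context exterior_supersolution
begin

text \<open>The logarithm grows at least like n, as exp n \<le> 4^n, so \<open>cap\<close> decays
  like n^(-r); against the n shells there remains n^(1-r), which tends to 0 precisely because r >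
  1.\<close>

lemma cap_times_tendsto_0:
  assumes r: "1 < r"
  shows "(\<lambda>n. cap (ln (1 + (2 ^ Suc n)\<^sup>2)) r * real n) \<longlonglongrightarrow> 0"
proof -
  define c where "c = 2 powr (r - 1) * (4 * (2 * r) powr (2 * r) * (M\<^sup>2 / 2) powr r)"
  have c: "0 \<le> c" by (simp add: c_def)
  have ge: "real n \<le> ln (1 + (2 ^ Suc n)\<^sup>2)" for n
  proof -
    have "exp (real n) = exp 1 ^ n" by (simp add: exp_of_nat_mult[symmetric])
    also have "\<dots> \<le> 4 ^ n" using exp_le by (intro power_mono) auto
    also have "\<dots> \<le> 1 + (2 ^ Suc n)\<^sup>2"
      by (simp add: power_mult_distrib power_mult[symmetric] mult.commute power2_eq_square flip: power_even_eq)
        (simp add: power_mult_distrib[symmetric])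
    finally have "ln (exp (real n)) \<le> ln (1 + (2 ^ Suc n)\<^sup>2)" by (intro ln_mono) auto
    then show ?thesis by simp
  qed
  have b: "cap (ln (1 + (2 ^ Suc n)\<^sup>2)) r * real n \<le> c * real n powr (1 - r)" if "0 < n" for n
  proof -
    have n: "0 < real n" using that by simp
    have "(M\<^sup>2 / 4 * (2 / ln (1 + (2 ^ Suc n)\<^sup>2))) powr r \<le> (M\<^sup>2 / 2 * (1 / real n)) powr r"
    proof (rule powr_mono2)
      have "2 / ln (1 + (2 ^ Suc n)\<^sup>2) \<le> 2 / real n" using ge[of n] n by (intro divide_left_mono) auto
      then have "M\<^sup>2 / 4 * (2 / ln (1 + (2 ^ Suc n)\<^sup>2)) \<le> M\<^sup>2 / 4 * (2 / real n)" by (intro mult_left_mono) auto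
      then show "M\<^sup>2 / 4 * (2 / ln (1 + (2 ^ Suc n)\<^sup>2)) \<le> M\<^sup>2 / 2 * (1 / real n)" by simp
      have "0 \<le> ln (1 + (2 ^ Suc n)\<^sup>2 :: real)" using ge[of n] n by linarith
      then show "0 \<le> M\<^sup>2 / 4 * (2 / ln (1 + (2 ^ Suc n)\<^sup>2))" by (intro mult_nonneg_nonneg divide_nonneg_nonneg) auto
    qed (use r in auto)
    also have "\<dots> = (M\<^sup>2 / 2) powr r * real n powr (- r)"
      using n powr_mult[of "M\<^sup>2 / 2" "1 / real n" r] by (simp add: powr_divide powr_minus inverse_eq_divide)
    finally have "cap (ln (1 + (2 ^ Suc n)\<^sup>2)) r \<le> c * real n powr (- r)"
      unfolding cap_def c_def by (simp only: mult.assoc) (intro mult_left_mono, auto)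
    then have "cap (ln (1 + (2 ^ Suc n)\<^sup>2)) r * real n \<le> c * real n powr (- r) * real n"
      by (intro mult_right_mono) auto
    also have "\<dots> = c * real n powr (1 - r)" using n powr_mult_norm[of "real n" "1 - r"] by simp
    finally show ?thesis .
  qed
  have "(\<lambda>n. real n powr (1 - r)) \<longlonglongrightarrow> 0"
    using r by (intro tendsto_neg_powr filterlim_real_sequentially) auto
  then have "(\<lambda>n. c * real n powr (1 - r)) \<longlonglongrightarrow> 0" by (rule tendsto_mult_right_zero)
  then show ?thesis
  proof (rule tendsto_sandwich[OF _ _ tendsto_const, rotated 2])
    show "\<forall>\<^sub>F n in sequentially. 0 \<le> cap (ln (1 + (2 ^ Suc n)\<^sup>2)) r * real n"
      by (simp add: cap_def)
    show "\<forall>\<^sub>F n in sequentially. cap (ln (1 + (2 ^ Suc n)\<^sup>2)) r * real n \<le> c * real n powr (1 - r)"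
      using b by (intro eventually_sequentiallyI[of 1]) auto
  qed
qed

lemma energy_density_nonneg:
  "0 \<le> pen' x * log_cutoff (2 ^ Suc n) x * (A (f (2 ^ Suc n) x) \<bullet> f (2 ^ Suc n) x)"
  using pen'_nonneg[of x] log_cutoff(2)[of "2 ^ Suc n" x] A_inner_nonneg
  by (intro mult_nonneg_nonneg) auto

lemma energy_tendsto_0: "energy \<longlonglongrightarrow> 0"
proof (rule tendsto_sandwich[OF _ _ tendsto_const])
  define v where "v = 2 ^ DIM('a) * measure lborel (ball (0::'a) 1)"
  have "(\<lambda>n. 2 * (G * (cap (ln (1 + (2 ^ Suc n)\<^sup>2)) m * real n) + cap (ln (1 + (2 ^ Suc n)\<^sup>2)) s * real n) * v)
      \<longlonglongrightarrow> 2 * (G * 0 + 0) * v"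
    using s1 sm by (intro tendsto_intros cap_times_tendsto_0) auto
  then show "(\<lambda>n. 2 * (G * (cap (ln (1 + (2 ^ Suc n)\<^sup>2)) m * real n) + cap (ln (1 + (2 ^ Suc n)\<^sup>2)) s * real n) * v) \<longlonglongrightarrow> 0"
    by simp
  show "\<forall>\<^sub>F n in sequentially. energy n \<le> 2 * (G * (cap (ln (1 + (2 ^ Suc n)\<^sup>2)) m * real n) + cap (ln (1 + (2 ^ Suc n)\<^sup>2)) s * real n) * v"
    using energy_le unfolding v_def by (simp add: algebra_simps)
  show "\<forall>\<^sub>F n in sequentially. 0 \<le> energy n"
    unfolding energy_def using energy_density_nonneg
    by (intro always_eventually allI Bochner_Integration.integral_nonneg)
qed

text \<open>Both the cutoff and the truncated gradient only grow with the radius. Together with the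
  limit 0 this makes every single energy vanish.\<close>

lemma energy_mono: "energy n \<le> energy (n + k)"
  unfolding energy_def
proof (rule integral_mono[OF energy_integrable energy_integrable])
  fix x
  let ?R = "2 ^ Suc n :: real" and ?R' = "2 ^ Suc (n + k) :: real"
  have R: "?R \<le> ?R'" "0 < ?R" by (auto intro!: power_increasing)
  have "A (f ?R x) \<bullet> f ?R x \<le> A (f ?R' x) \<bullet> f ?R' x"
  proof (cases "x \<in> K ?R")
    case True
    then have "x \<in> K ?R'"
      using order_trans[OF _ add_right_mono[OF R(1), of 1]] unfolding K_def by blast
    then show ?thesis using True by (simp add: f_def)
  next
    case False
    then have "f ?R x = 0" by (simp add: f_def)
    then show ?thesis using A_inner_nonneg[of "f ?R' x"] by simp
  qed
  then show "pen' x * log_cutoff ?R x * (A (f ?R x) \<bullet> f ?R x) \<le> pen' x * log_cutoff ?R' x * (A (f ?R' x) \<bullet> f ?R' x)"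
    using pen'_nonneg[of x] log_cutoff(2)[OF R(2), of x] log_cutoff(2)[of ?R' x] log_cutoff(6)[OF R(2,1), of x] A_inner_nonneg
    by (intro mult_mono mult_left_mono mult_nonneg_nonneg) auto
qed

lemma energy_eq_0: "energy n = 0"
proof (rule antisym)
  have "(\<lambda>k. energy (n + k)) \<longlonglongrightarrow> 0"
    using LIMSEQ_ignore_initial_segment[OF energy_tendsto_0, of n] by (simp add: add.commute)
  then show "energy n \<le> 0" by (rule LIMSEQ_le_const) (use energy_mono in auto)
  show "0 \<le> energy n"
    unfolding energy_def using energy_density_nonneg by (intro Bochner_Integration.integral_nonneg)
qed

text \<open>The exceptional null sets of the countably many radii are united. At any remaining point
  with w < M/2 the factor \<open>pen'\<close> is positive, and so is the cutoff once 2^(n+1) > |x|,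
  so the energy density of D itself must be 0.\<close>

lemma D_eq_0_below_level: "AE x in lborel. w x < M / 2 \<longrightarrow> D x = 0"
proof -
  have "AE x in lborel. pen' x * log_cutoff (2 ^ Suc n) x * (A (f (2 ^ Suc n) x) \<bullet> f (2 ^ Suc n) x) = 0" for n
    using integral_nonneg_eq_0_iff_AE[OF energy_integrable[of n]] energy_density_nonneg energy_eq_0[of n]
    by (simp add: energy_def)
  then have "AE x in lborel. \<forall>n. pen' x * log_cutoff (2 ^ Suc n) x * (A (f (2 ^ Suc n) x) \<bullet> f (2 ^ Suc n) x) = 0"
    unfolding AE_all_countable by blast
  then show ?thesis
  proof eventually_elim
    case (elim x)
    show ?case
    proof
      assume wx: "w x < M / 2"
      then have "w x < M" using M(1) by linarith
      then have x2: "2 < norm x" using w_less_M by blast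
      obtain n where "norm x < 2 ^ n" using real_arch_pow[of 2 "norm x"] by auto
      then have n: "norm x < 2 ^ Suc n" by (simp add: order_less_le_trans)
      then have "x \<in> K (2 ^ Suc n)" using x2 by (simp add: K_def)
      then have fD: "f (2 ^ Suc n) x = D x" by (simp add: f_def)
      have "0 < pen' x" using wx by (simp add: pen'_def flat'_def)
      moreover have "0 < log_cutoff (2 ^ Suc n) x" using log_cutoff(4)[OF _ n] by simp
      ultimately have "A (D x) \<bullet> D x = 0" using elim[rule_format, of n] fD by auto
      then have "norm (D x) powr m * g (norm (D x)) + norm (D x) powr s = 0" by (simp add: flux_inner_self)
      moreover have "0 \<le> norm (D x) powr m * g (norm (D x))" using g_pos[of "norm (D x)"] by simp
      ultimately have "norm (D x) powr s = 0" using powr_ge_zero[of "norm (D x)" s] by linarith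
      then show "D x = 0" by simp
    qed
  qed
qed

theorem bounded_below: "\<exists>c>0. \<forall>x. 2 < norm x \<longrightarrow> c \<le> u x"
proof (intro exI conjI allI impI)
  show "0 < M / 4" using M(1) by simp
  fix x :: 'a assume "2 < norm x"
  then show "M / 4 \<le> u x"
    using level_lower_bound[OF D_eq_0_below_level, of x] by (simp add: w_def)
qed

end

text \<open>On the shell between 2 and R the integrand is at least c^p / (1 + R^\<alpha>), so the
  integral grows at least like R^(N-\<alpha>), which is unbounded.\<close>

lemma not_integrable_bounded_below:
  fixes u :: "'a::euclidean_space \<Rightarrow> real"
  assumes \<alpha>: "0 < \<alpha>" "\<alpha> < real DIM('a)" and "0 < p" "0 < c" and u: "\<And>x. 2 < norm x \<Longrightarrow> c \<le> u x"
  shows "\<not> set_integrable lebesgue (- ball 0 1) (\<lambda>y. u y powr p / (1 + norm y powr \<alpha>))"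
proof
  let ?F = "\<lambda>y. indicator (- ball 0 1) y *\<^sub>R (u y powr p / (1 + norm y powr \<alpha>))"
  let ?N = "DIM('a)"
  assume "set_integrable lebesgue (- ball 0 1) (\<lambda>y. u y powr p / (1 + norm y powr \<alpha>))"
  then have I: "integrable lebesgue ?F" by (simp add: set_integrable_def)
  have F0: "0 \<le> ?F y" for y by (simp add: add_nonneg_nonneg)
  define V where "V = measure lborel (ball (0::'a) 1)"
  have V: "0 < V" by (simp add: V_def content_ball_pos)
  define J where "J = integral\<^sup>L lebesgue ?F"
  have low: "c powr p / (1 + R powr \<alpha>) * (V * (R ^ ?N - 2 ^ ?N)) \<le> J" if R: "2 < R" for R
  proof -
    let ?H = "\<lambda>y::'a. c powr p / (1 + R powr \<alpha>) * (indicator (ball 0 R) y - indicator (cball 0 2) y)"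
    have iH: "integrable lborel ?H"
      by (intro integrable_mult_right Bochner_Integration.integrable_diff integrable_indicator_bounded) auto
    then have iH': "integrable lebesgue ?H" by (subst integrable_completion) auto
    have "integral\<^sup>L lebesgue ?H = integral\<^sup>L lborel ?H" using iH by (intro integral_completion) auto
    also have "\<dots> = c powr p / (1 + R powr \<alpha>) * ((LINT y|lborel. indicator (ball (0::'a) R) y) - (LINT y|lborel. indicator (cball (0::'a) 2) y))"
      by (subst integral_mult_right_zero, subst Bochner_Integration.integral_diff)
        (auto intro!: integrable_indicator_bounded)
    also have "\<dots> = c powr p / (1 + R powr \<alpha>) * (V * (R ^ ?N - 2 ^ ?N))"
      using content_ball_conv_unit_ball[of R "0::'a"] content_ball_conv_unit_ball[of 2 "0::'a"] R
      by (simp add: V_def content_cball_conv_ball algebra_simps)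
    finally have "c powr p / (1 + R powr \<alpha>) * (V * (R ^ ?N - 2 ^ ?N)) = integral\<^sup>L lebesgue ?H" by (rule sym)
    also have "\<dots> \<le> J" unfolding J_def
    proof (rule integral_mono[OF iH' I])
      fix y
      show "?H y \<le> ?F y"
      proof (cases "2 < norm y \<and> norm y < R")
        case True
        have "c powr p / (1 + R powr \<alpha>) \<le> u y powr p / (1 + norm y powr \<alpha>)"
          using True u[of y] assms by (intro frac_le add_left_mono powr_mono2) (auto simp: add_pos_nonneg)
        then show ?thesis using True by simp
      next
        case False
        then have "?H y \<le> 0" using R by (auto simp: indicator_def add_nonneg_nonneg)
        then show ?thesis using F0[of y] by linarith
      qed
    qed
    finally show ?thesis .
  qed
  define C where "C = 4 * J / (c powr p * V)"
  have cV: "0 < c powr p * V" using \<open>0 < c\<close> V by simp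
  \<comment> \<open>For R \<ge> 4 the removed ball takes at most half of R^N, and 1 + R^\<alpha>
    \<le> 2 R^\<alpha>; the two factors 2 make up the 4 in C.\<close>
  have up: "R powr (real ?N - \<alpha>) \<le> C" if R: "4 \<le> R" for R
  proof -
    have RN: "R powr real ?N = R ^ ?N" using R by (intro powr_realpow) auto
    have "2 * 2 ^ ?N \<le> R ^ ?N"
    proof -
      have "(2::real) ^ 1 * 2 ^ ?N \<le> 2 ^ ?N * 2 ^ ?N" by (intro mult_right_mono power_increasing) auto
      also have "\<dots> = 4 ^ ?N" by (simp add: power_mult_distrib[symmetric])
      also have "\<dots> \<le> R ^ ?N" using R by (intro power_mono) auto
      finally show ?thesis by simp
    qed
    then have a: "R ^ ?N / 2 \<le> R ^ ?N - 2 ^ ?N" by simp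
    have Ra: "1 \<le> R powr \<alpha>" using R \<alpha> by (intro ge_one_powr_ge_zero) auto
    have "c powr p * V * (R ^ ?N / 2) \<le> c powr p * V * (R ^ ?N - 2 ^ ?N)"
      using a cV by (intro mult_left_mono) auto
    also have "\<dots> = c powr p / (1 + R powr \<alpha>) * (V * (R ^ ?N - 2 ^ ?N)) * (1 + R powr \<alpha>)"
      using Ra by simp
    also have "\<dots> \<le> J * (1 + R powr \<alpha>)"
      using low[of R] R Ra by (intro mult_right_mono) auto
    also have "\<dots> \<le> J * (2 * R powr \<alpha>)"
      unfolding J_def using Ra F0 by (intro mult_left_mono Bochner_Integration.integral_nonneg) auto
    finally have "R powr real ?N * (c powr p * V) \<le> 4 * J * R powr \<alpha>" unfolding RN by (simp add: algebra_simps)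
    then have "R powr real ?N / R powr \<alpha> \<le> 4 * J / (c powr p * V)"
      using cV Ra R by (simp add: divide_le_eq pos_le_divide_eq mult.commute mult.left_commute field_simps)
    then show ?thesis by (simp add: powr_diff C_def)
  qed
  define b where "b = real ?N - \<alpha>"
  have b: "0 < b" using \<alpha> by (simp add: b_def)
  \<comment> \<open>Large enough that R^b exceeds C, with b = N - \<alpha> > 0, and at least 4 so
    that the upper bound applies.\<close>
  define R where "R = max 4 ((\<bar>C\<bar> + 1) powr (1 / b))"
  have "\<bar>C\<bar> + 1 = ((\<bar>C\<bar> + 1) powr (1 / b)) powr b" using b by (simp add: powr_powr)
  also have "\<dots> \<le> R powr b" unfolding R_def using b by (intro powr_mono2) auto
  also have "\<dots> \<le> C" unfolding b_def by (rule up) (simp add: R_def)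
  finally show False by linarith
qed

theorem theorem1p2:
  fixes g :: "real \<Rightarrow> real" and m s \<alpha> p q :: real
  assumes "0 < \<alpha>" and "\<alpha> < real DIM('a::euclidean_space)"
    and "p > 0" and "q > 0"
    and "s > 1" and "m > s" and "s \<ge> real DIM('a)"
    and "\<forall>t\<ge>0. g t > 0"
    and "antimono_on {0..} g"
    and "continuous_on {0..} g"
    and "g C1_differentiable_on {0<..}"
    and "((\<lambda>t. t * deriv g t / g t) \<longlongrightarrow> 0) (at_right 0)"
    and "\<forall>t>0. t * deriv g t / g t + m - 1 \<ge> 0"
  shows "\<not> (\<exists>u :: 'a \<Rightarrow> real. positive_solution g m s \<alpha> p q u)"
proof
  assume "\<exists>u :: 'a \<Rightarrow> real. positive_solution g m s \<alpha> p q u"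
  then obtain u :: "'a \<Rightarrow> real" where sol: "positive_solution g m s \<alpha> p q u" by blast
  obtain D where D: "borel_weak_grad (- cball 0 1) u D"
    "\<And>K. compact K \<Longrightarrow> K \<subseteq> - cball 0 1 \<Longrightarrow> integrable lborel (\<lambda>x. indicator K x * norm (D x) powr m)"
    "\<And>\<phi>. test_function (- cball 0 1) \<phi> \<Longrightarrow> (\<And>x. 0 \<le> \<phi> x) \<Longrightarrow>
       0 \<le> (LINT x|lborel. flux g m s (D x) \<bullet> grad \<phi> x)"
    using positive_solution_borel[OF sol assms(10)] by blast
  \<comment> \<open>Monotonicity of g provides the bound G = \<open>g 0\<close> of the locale;
    continuity up to 0 is what makes this value meaningful for the flux.\<close>
  have g0: "g t \<le> g 0" if "0 \<le> t" for t
    using monotone_onD[OF assms(9), of 0 t] that by simp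
  have "continuous_on (- cball 0 1) u" "\<And>x. x \<in> - cball 0 1 \<Longrightarrow> 0 < u x"
    using sol by (auto simp: positive_solution_def)
  then interpret exterior_supersolution g m s "g 0" u D
    using assms(5,6,7,8,10) D g0 by unfold_locales auto
  obtain c where "0 < c" "\<And>x. 2 < norm x \<Longrightarrow> c \<le> u x" using bounded_below by blast
  then have "\<not> set_integrable lebesgue (- ball 0 1) (\<lambda>y. u y powr p / (1 + norm y powr \<alpha>))"
    using assms(1-3) by (intro not_integrable_bounded_below) auto
  then show False using sol by (simp add: positive_solution_def)
qed

end
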